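(* Let $X$ be a nonsingular real algebraic variety. Any slice $Y$ of $X$ is coorientable, i.e. the transverse bundle of $\mathbb{R}Y$ in $\mathbb{R}X$ is orientable. A coorientation of $\mathbb{R}Y$ in $\mathbb{R}X$ is determined by a complex subvariety $V\subset\mathbb{C}X$, transverse to $\mathbb{R}X$, which carves out the slice (that is, $\mathbb{R}Y=V\cap\mathbb{R}X$).
   Context: A real algebraic variety $X$ consists of a complex algebraic variety $\mathbb{C}X$ (its complex points) with an anti-holomorphic involution $\mathrm{conj}:\mathbb{C}X\to\mathbb{C}X$; $\mathbb{R}X=\mathrm{Fix}(\mathrm{conj})$ is its set of real points. If $X$ is nonsingular, $\mathbb{C}X$ is a complex manifold and $\mathbb{R}X$ is a smooth submanifold of it. A real algebraic subvariety $Y\subset X$ is given by a $\mathrm{conj}$-invariant complex algebraic subvariety $\mathbb{C}Y\subset\mathbb{C}X$, and $\mathbb{R}Y=\mathbb{C}Y\cap\mathbb{R}X$. A complex subvariety $V\subset\mathbb{C}X$ is transverse to $\mathbb{R}X$ if at every $p\in V\cap\mathbb{R}X$ the variety $V$ is nonsingular and $T_pV+T_p\mathbb{R}X=T_p\mathbb{C}X$. A real algebraic subvariety $Y$ of $X$ is a slice if $\mathbb{R}Y=V\cap\mathbb{R}X$ for some complex subvariety $V\subset\mathbb{C}X$ transverse to $\mathbb{R}X$; then $\mathbb{R}Y$ is a smooth submanifold of $\mathbb{R}X$. For a smooth submanifold $V$ of a smooth manifold $M$, the transverse bundle $N^MV$ has fibers $N_p^MV=T_pM/T_pV$. A coorientation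 of $V$ in $M$ is an orientation of the bundle $N^MV$. The coorientation of $\mathbb{R}Y$ determined by $V$ is the one obtained, at each $p\in\mathbb{R}Y$, from the complex orientation of $N_p^{\mathbb{C}X}V$ via the map $T_p\mathbb{R}X/T_p\mathbb{R}Y\to T_p\mathbb{C}X/T_pV$ induced by inclusion (an isomorphism of real vector spaces). The complex orientation of a complex vector space is the one in which $(e_1,ie_1,\dots,e_k,ie_k)$ is positive for any complex basis $(e_1,\dots,e_k)$. *)

theory Defs
  imports "HOL-Analysis.Analysis" "Jordan_Normal_Form.Determinant"
begin

no_notation vec_index (infixl "$" 100)

section \<open>Complex algebraic varieties\<close>

inductive polynomial_fun :: "(complex^'n \<Rightarrow> complex) \<Rightarrow> bool" where
  "polynomial_fun (\<lambda>x. c)"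
| "polynomial_fun (\<lambda>x. x $ k)"
| "polynomial_fun f \<Longrightarrow> polynomial_fun g \<Longrightarrow> polynomial_fun (\<lambda>x. f x + g x)"
| "polynomial_fun f \<Longrightarrow> polynomial_fun g \<Longrightarrow> polynomial_fun (\<lambda>x. f x * g x)"

definition zariski_closed :: "(complex^'n) set \<Rightarrow> bool" where
  "zariski_closed A \<longleftrightarrow>
     (\<exists>F. (\<forall>f\<in>F. polynomial_fun f) \<and> A = {x. \<forall>f\<in>F. f x = 0})"

definition regular_on :: "(complex^'n) set \<Rightarrow> (complex^'n \<Rightarrow> complex) \<Rightarrow> bool" where
  "regular_on A f \<longleftrightarrow>
     (\<forall>a\<in>A. \<exists>g h. polynomial_fun g \<and> polynomial_fun h \<and> h a \<noteq> 0 \<and>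
        (\<forall>x\<in>A. h x \<noteq> 0 \<longrightarrow> f x = g x / h x))"

definition vec_join :: "complex^'n \<Rightarrow> complex^'m \<Rightarrow> complex^('n + 'm)" where
  "vec_join x y = (\<chi> k. case k of Inl i \<Rightarrow> x $ i | Inr j \<Rightarrow> y $ j)"

text \<open>
  Varieties in the sense of Serre: a set of points covered by finitely many affine patches with
  regular transition maps, satisfying the separation axiom.  The finitely many patches are indexed
  by a finite type, and all are embedded as closed sets in the same affine space; as an affine
  variety can be put in an affine space of larger dimension, this is no restriction.
  Varieties are not assumed to be irreducible, connected or equidimensional.
\<close>

record ('a, 'n, 'i) variety =
  patch :: "'i \<Rightarrow> 'a set"
  coord :: "'i \<Rightarrow> 'a \<Rightarrow> complex^'n"

definition points :: "('a, 'n::finite, 'i::finite) variety \<Rightarrow> 'a set" where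
  "points X = (\<Union>i. patch X i)"

definition algebraic_variety :: "('a, 'n::finite, 'i::finite) variety \<Rightarrow> bool" where
  "algebraic_variety X \<longleftrightarrow>
     (\<forall>i. inj_on (coord X i) (patch X i) \<and> zariski_closed (coord X i ` patch X i)) \<and>
     (\<forall>i j.
        (\<exists>C. zariski_closed C \<and>
           coord X i ` (patch X i \<inter> patch X j) = coord X i ` patch X i - C) \<and>
        (\<forall>k. regular_on (coord X i ` (patch X i \<inter> patch X j))
               (\<lambda>z. coord X j (inv_into (patch X i) (coord X i) z) $ k)) \<and>
        zariski_closed ((\<lambda>x. vec_join (coord X i x) (coord X j x)) ` (patch X i \<inter> patch X j)))"

definition subvariety :: "('a, 'n::finite, 'i::finite) variety \<Rightarrow> 'a set \<Rightarrow> bool" where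
  "subvariety X V \<longleftrightarrow>
     V \<subseteq> points X \<and> (\<forall>i. zariski_closed (coord X i ` (V \<inter> patch X i)))"

definition classical_topology :: "('a, 'n::finite, 'i::finite) variety \<Rightarrow> 'a topology" where
  "classical_topology X =
     topology_generated_by {{x \<in> patch X i. coord X i x \<in> U} | i U. open U}"

text \<open>
  The point \<open>a\<close> is a nonsingular point of the algebraic set \<open>A\<close> if, in a Zariski neighbourhood of
  \<open>a\<close>, the set \<open>A\<close> is given by polynomial equations with differentials linearly independent at \<open>a\<close>.
\<close>

definition nonsingular_point :: "(complex^'n) set \<Rightarrow> complex^'n \<Rightarrow> bool" where
  "nonsingular_point A a \<longleftrightarrow> a \<in> A \<and>
     (\<exists>h fs. polynomial_fun h \<and> h a \<noteq> 0 \<and> (\<forall>f\<in>set fs. polynomial_fun f) \<and>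
        (\<forall>x. h x \<noteq> 0 \<longrightarrow> (x \<in> A \<longleftrightarrow> (\<forall>f\<in>set fs. f x = 0))) \<and>
        (\<forall>c. (\<forall>v. (\<Sum>k<length fs. c k * frechet_derivative (fs ! k) (at a) v) = 0) \<longrightarrow>
             (\<forall>k<length fs. c k = 0)))"

text \<open>Nonsingularity does not depend on the affine patch in which it is tested.\<close>

definition nonsingular_at :: "('a, 'n::finite, 'i::finite) variety \<Rightarrow> 'a set \<Rightarrow> 'a \<Rightarrow> bool" where
  "nonsingular_at X V p \<longleftrightarrow> p \<in> V \<and>
     (\<forall>i. p \<in> patch X i \<longrightarrow> nonsingular_point (coord X i ` (V \<inter> patch X i)) (coord X i p))"

definition nonsingular :: "('a, 'n::finite, 'i::finite) variety \<Rightarrow> bool" where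
  "nonsingular X \<longleftrightarrow> (\<forall>p\<in>points X. nonsingular_at X (points X) p)"


section \<open>Real algebraic varieties\<close>

definition holomorphic_map_on ::
    "(complex^'n) set \<Rightarrow> (complex^'n \<Rightarrow> complex^'m) \<Rightarrow> bool" where
  "holomorphic_map_on U F \<longleftrightarrow> open U \<and>
     (\<forall>x\<in>U. \<exists>D. (F has_derivative D) (at x) \<and> (\<forall>c v. D (c *s v) = c *s D v))"

text \<open>
  As usual for analytic subsets of affine space, a map is holomorphic if locally it extends to a
  holomorphic map of an open subset of the ambient space; it is anti-holomorphic if it is
  the complex conjugate of a holomorphic one.
\<close>

definition antiholomorphic :: "('a, 'n::finite, 'i::finite) variety \<Rightarrow> ('a \<Rightarrow> 'a) \<Rightarrow> bool" where
  "antiholomorphic X \<sigma> \<longleftrightarrow>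
     (\<forall>p\<in>points X. \<forall>i j. p \<in> patch X i \<and> \<sigma> p \<in> patch X j \<longrightarrow>
        (\<exists>U F. coord X i p \<in> U \<and> holomorphic_map_on U F \<and>
           (\<forall>q\<in>patch X i. coord X i q \<in> U \<longrightarrow>
              \<sigma> q \<in> patch X j \<and> coord X j (\<sigma> q) = (\<chi> k. cnj (F (coord X i q) $ k)))))"

definition real_variety :: "('a, 'n::finite, 'i::finite) variety \<Rightarrow> ('a \<Rightarrow> 'a) \<Rightarrow> bool" where
  "real_variety X \<sigma> \<longleftrightarrow> algebraic_variety X \<and>
     (\<forall>p\<in>points X. \<sigma> p \<in> points X \<and> \<sigma> (\<sigma> p) = p) \<and> antiholomorphic X \<sigma>"

definition real_points :: "('a, 'n::finite, 'i::finite) variety \<Rightarrow> ('a \<Rightarrow> 'a) \<Rightarrow> 'a set" where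
  "real_points X \<sigma> = {p \<in> points X. \<sigma> p = p}"

text \<open>A real subvariety \<open>Y\<close> is represented by its set of complex points.\<close>

definition real_subvariety ::
    "('a, 'n::finite, 'i::finite) variety \<Rightarrow> ('a \<Rightarrow> 'a) \<Rightarrow> 'a set \<Rightarrow> bool" where
  "real_subvariety X \<sigma> Y \<longleftrightarrow> subvariety X Y \<and> \<sigma> ` Y = Y"


section \<open>Tangent spaces and slices\<close>

text \<open>
  A tangent vector is the compatible family of its components in the charts: for the velocity of a
  curve \<open>\<gamma>\<close> at \<open>p = \<gamma> 0\<close>, the component with index \<open>i\<close> is the derivative at 0 of \<open>coord X i \<circ> \<gamma>\<close>,
  or 0 if the patch with index \<open>i\<close> does not contain \<open>p\<close>.  Thus the operations of all tangent spaces
  are those of \<open>complex^'n^'i\<close>.  At points where \<open>S\<close> is a submanifold, the velocities of the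
  curves in \<open>S\<close> form its tangent space.  For nonsingular points of complex subvarieties
  this is the complex tangent space regarded as a real one.
\<close>

definition tangent_space ::
    "('a, 'n::finite, 'i::finite) variety \<Rightarrow> 'a set \<Rightarrow> 'a \<Rightarrow> (complex^'n^'i) set" where
  "tangent_space X S p =
     {v. \<exists>\<gamma> :: real \<Rightarrow> 'a. \<gamma> 0 = p \<and> (\<forall>\<^sub>F t in nhds 0. \<gamma> t \<in> S) \<and>
        (\<forall>i. if p \<in> patch X i
             then (\<forall>\<^sub>F t in nhds 0. \<gamma> t \<in> patch X i) \<and>
                  ((\<lambda>t. coord X i (\<gamma> t)) has_vector_derivative v $ i) (at 0)
             else v $ i = 0)}"

definition transverse_to_real ::
    "('a, 'n::finite, 'i::finite) variety \<Rightarrow> ('a \<Rightarrow> 'a) \<Rightarrow> 'a set \<Rightarrow> bool" where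
  "transverse_to_real X \<sigma> V \<longleftrightarrow>
     (\<forall>p \<in> V \<inter> real_points X \<sigma>. nonsingular_at X V p \<and>
        {v + w | v w. v \<in> tangent_space X V p \<and> w \<in> tangent_space X (real_points X \<sigma>) p}
          = tangent_space X (points X) p)"

text \<open>The real locus of \<open>Y\<close> is \<open>Y \<inter> real_points X \<sigma>\<close>.\<close>

definition carves_out ::
    "('a, 'n::finite, 'i::finite) variety \<Rightarrow> ('a \<Rightarrow> 'a) \<Rightarrow> 'a set \<Rightarrow> 'a set \<Rightarrow> bool" where
  "carves_out X \<sigma> V Y \<longleftrightarrow> subvariety X V \<and> transverse_to_real X \<sigma> V \<and>
     Y \<inter> real_points X \<sigma> = V \<inter> real_points X \<sigma>"

definition slice ::
    "('a, 'n::finite, 'i::finite) variety \<Rightarrow> ('a \<Rightarrow> 'a) \<Rightarrow> 'a set \<Rightarrow> bool" where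
  "slice X \<sigma> Y \<longleftrightarrow> real_subvariety X \<sigma> Y \<and> (\<exists>V. carves_out X \<sigma> V Y)"


section \<open>Orientations of quotient spaces\<close>

text \<open>Bases of a quotient \<open>A / B\<close> are given by lists of representatives in \<open>A\<close>.\<close>

definition quotient_basis ::
    "'v::real_vector set \<Rightarrow> 'v set \<Rightarrow> 'v list \<Rightarrow> bool" where
  "quotient_basis A B vs \<longleftrightarrow> set vs \<subseteq> A \<and>
     (\<forall>a\<in>A. \<exists>c. a - (\<Sum>i<length vs. c i *\<^sub>R vs ! i) \<in> B) \<and>
     (\<forall>c. (\<Sum>i<length vs. c i *\<^sub>R vs ! i) \<in> B \<longrightarrow> (\<forall>i<length vs. c i = 0))"

definition transition_matrix :: "'v::real_vector set \<Rightarrow> 'v list \<Rightarrow> 'v list \<Rightarrow> real mat \<Rightarrow> bool" where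
  "transition_matrix B us vs M \<longleftrightarrow>
     length us = length vs \<and> M \<in> carrier_mat (length vs) (length vs) \<and>
     (\<forall>j<length us. us ! j - (\<Sum>i<length vs. M $$ (i, j) *\<^sub>R vs ! i) \<in> B)"

text \<open>
  An orientation is given by its set of positive bases.  The zero space has two
  orientations: its empty basis may be positive or not.
\<close>

definition orientation_of_quotient ::
    "'v::real_vector set \<Rightarrow> 'v set \<Rightarrow> 'v list set \<Rightarrow> bool" where
  "orientation_of_quotient A B P \<longleftrightarrow> subspace A \<and> subspace B \<and> B \<subseteq> A \<and>
     (\<forall>vs\<in>P. quotient_basis A B vs) \<and>
     (\<forall>us vs M. quotient_basis A B us \<and> quotient_basis A B vs \<and> transition_matrix B us vs M \<longrightarrow>
        (Determinant.det M > 0 \<longrightarrow> (us \<in> P \<longleftrightarrow> vs \<in> P)) \<and>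
        (Determinant.det M < 0 \<longrightarrow> (us \<in> P \<longleftrightarrow> vs \<notin> P)))"

definition cscale :: "complex \<Rightarrow> complex^'n^'i \<Rightarrow> complex^'n^'i" where
  "cscale c v = (\<chi> i. c *s (v $ i))"

definition complex_quotient_basis ::
    "(complex^'n^'i) set \<Rightarrow> (complex^'n^'i) set \<Rightarrow> (complex^'n^'i) list \<Rightarrow> bool" where
  "complex_quotient_basis A B es \<longleftrightarrow> set es \<subseteq> A \<and>
     (\<forall>a\<in>A. \<exists>c. a - (\<Sum>k<length es. cscale (c k) (es ! k)) \<in> B) \<and>
     (\<forall>c. (\<Sum>k<length es. cscale (c k) (es ! k)) \<in> B \<longrightarrow> (\<forall>k<length es. c k = 0))"

definition complex_orientation ::
    "(complex^'n^'i) set \<Rightarrow> (complex^'n^'i) set \<Rightarrow> (complex^'n^'i) list set" where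
  "complex_orientation A B =
     {vs. quotient_basis A B vs \<and>
        (\<exists>es M. complex_quotient_basis A B es \<and>
           transition_matrix B vs (concat (map (\<lambda>e. [e, cscale \<i> e]) es)) M \<and>
           Determinant.det M > 0)}"


section \<open>Coorientations\<close>

definition continuous_field_on ::
    "('a, 'n::finite, 'i::finite) variety \<Rightarrow> 'a set \<Rightarrow> ('a \<Rightarrow> complex^'n^'i) \<Rightarrow> bool" where
  "continuous_field_on X D s \<longleftrightarrow>
     (\<forall>i. continuous_map (subtopology (classical_topology X) (D \<inter> patch X i)) euclidean
            (\<lambda>q. s q $ i))"

text \<open>
  A coorientation of \<open>S\<close> in \<open>M\<close> orients each fibre of the transverse bundle of \<open>S\<close> in \<open>M\<close> so that
  near each point of \<open>S\<close> there is a continuous frame of the bundle, represented by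
  vector fields along \<open>S\<close> tangent to \<open>M\<close>, whose sign is constant.
\<close>

definition coorientation ::
    "('a, 'n::finite, 'i::finite) variety \<Rightarrow> 'a set \<Rightarrow> 'a set \<Rightarrow>
     ('a \<Rightarrow> (complex^'n^'i) list set) \<Rightarrow> bool" where
  "coorientation X M S P \<longleftrightarrow>
     (\<forall>p\<in>S. orientation_of_quotient (tangent_space X M p) (tangent_space X S p) (P p)) \<and>
     (\<forall>p\<in>S. \<exists>W ss. openin (classical_topology X) W \<and> p \<in> W \<and>
        (\<forall>s\<in>set ss. continuous_field_on X (W \<inter> S) s) \<and>
        (\<forall>q\<in>W \<inter> S.
           quotient_basis (tangent_space X M q) (tangent_space X S q) (map (\<lambda>s. s q) ss) \<and>
           (map (\<lambda>s. s q) ss \<in> P q \<longleftrightarrow> map (\<lambda>s. s p) ss \<in> P p)))"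

definition coorientable ::
    "('a, 'n::finite, 'i::finite) variety \<Rightarrow> 'a set \<Rightarrow> 'a set \<Rightarrow> bool" where
  "coorientable X M S \<longleftrightarrow> (\<exists>P. coorientation X M S P)"

text \<open>
  The map induced by inclusion sends the class of \<open>v\<close> modulo the tangent space of the real locus of
  \<open>Y\<close> to the class of \<open>v\<close> modulo the tangent space of \<open>V\<close>.  So the orientation obtained via this
  map consists of the bases whose representatives also represent a basis positive in the
  complex orientation.
\<close>

definition determined_coorientation ::
    "('a, 'n::finite, 'i::finite) variety \<Rightarrow> ('a \<Rightarrow> 'a) \<Rightarrow> 'a set \<Rightarrow> 'a set \<Rightarrow>
     'a \<Rightarrow> (complex^'n^'i) list set" where
  "determined_coorientation X \<sigma> V Y p =
     {vs. quotient_basis (tangent_space X (real_points X \<sigma>) p)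
            (tangent_space X (Y \<inter> real_points X \<sigma>) p) vs \<and>
          vs \<in> complex_orientation (tangent_space X (points X) p) (tangent_space X V p)}"

end

theory Submission
  imports Defs "HOL-Complex_Analysis.Cauchy_Integral_Formula"
begin

text \<open>
  The complex orientation of a complex vector space is canonical: replacing one complex basis by
  another changes the real basis \<open>(e\<^sub>1, \<i> e\<^sub>1, \<dots>, e\<^sub>k, \<i> e\<^sub>k)\<close> by the real form of a complex matrix \<open>C\<close>, and
  the determinant of that real form is \<open>\<bar>det C\<bar>\<^sup>2\<close> (\<open>det_real_form\<close>, \<open>transition_doubled_pos\<close>).
  Transversality makes the inclusion of \<open>T\<^sub>p\<real>X / T\<^sub>p\<real>Y\<close> into \<open>T\<^sub>p\<complex>X / T\<^sub>pV\<close> an isomorphism, so the complex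
  orientation pulls back to an orientation of each fibre (\<open>orientation_of_transverse_slice\<close>).
  What is left is that these orientations vary continuously, and for this it is enough to find near
  each point of \<open>\<real>Y\<close> a continuous frame which is positive everywhere (\<open>positive_frame\<close>).

  Tangent vectors are velocities of curves, so even the linear structure of the tangent spaces has to
  be obtained from equations.  In a chart, \<open>\<complex>X\<close> and \<open>V\<close> are given by holomorphic
  equations \<open>f\<close> and \<open>g\<close> with independent differentials (\<open>nonsingular_point_equations\<close>).  The real points
  are the fixed points of an involution, and averaging a linear chart over the involution gives
  a further equation \<open>\<rho>\<close> that cuts them out of \<open>\<complex>X\<close> (\<open>involution_fixed_set\<close>).  By transversality not only \<open>(f, \<rho>)\<close>
  but also \<open>(g, \<rho>)\<close> is a submersion (\<open>local_equations\<close>).  A fixed point argument produces a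
  curve with any prescribed velocity in the kernel of a submersion (\<open>curve_in_zero_set\<close>), so the tangent spaces of
  \<open>\<complex>X\<close>, \<open>V\<close>, \<open>\<real>X\<close> and \<open>\<real>Y\<close> are the kernels of \<open>f'\<close>, \<open>g'\<close>, \<open>(f', \<rho>')\<close> and \<open>(g', \<rho>')\<close>, at all nearby points and
  with the same equations.

  The frame arises by solving linear equations with a right inverse of the differential that
  depends continuously on the point (\<open>continuous_right_inverse\<close>).  A complex basis of \<open>T\<^sub>p\<complex>X / T\<^sub>pV\<close> is first extended
  to continuous sections \<open>e\<^sub>m\<close> of \<open>T\<complex>X\<close> that remain a complex basis modulo \<open>TV\<close>; then each of
  \<open>e\<^sub>m\<close> and \<open>\<i> e\<^sub>m\<close> is moved into \<open>T\<real>X\<close> by adding a continuous section of \<open>TV\<close>.  The resulting frame of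
  \<open>T\<real>X / T\<real>Y\<close> represents \<open>(e\<^sub>1, \<i> e\<^sub>1, \<dots>)\<close> modulo \<open>TV\<close>, hence is positive at every point.
\<close>

section \<open>Real forms of complex matrices\<close>

text \<open>
  Real and imaginary parts are interleaved, so that column \<open>2 m\<close> holds the image of \<open>e\<^sub>m\<close> and column
  \<open>2 m + 1\<close> that of \<open>\<i> e\<^sub>m\<close>.  This is the order of the bases that define the complex orientation.
\<close>

definition real_form :: "complex mat \<Rightarrow> real mat" where
  "real_form C = Matrix.mat (2 * dim_row C) (2 * dim_col C) (\<lambda>(r, c).
     let z = C $$ (r div 2, c div 2) * (if even c then 1 else \<i>) in if even r then Re z else Im z)"

lemma sum_pairs:
  fixes f :: "nat \<Rightarrow> 'b::comm_monoid_add"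
  shows "(\<Sum>l<2*k. f l) = (\<Sum>m<k. f (2*m) + f (2*m+1))"
  by (induction k) (auto simp: add.assoc)

text \<open>
  Over \<open>\<complex>\<close> the coordinates \<open>x\<^sub>2\<^sub>m + \<i> x\<^sub>2\<^sub>m\<^sub>+\<^sub>1\<close> together with \<open>x\<^sub>2\<^sub>m - \<i> x\<^sub>2\<^sub>m\<^sub>+\<^sub>1\<close> turn the real form into the block diagonal matrix
  with blocks \<open>C\<close> and its complex conjugate.
\<close>

lemma det_real_form:
  assumes C: "C \<in> carrier_mat k k"
  shows "complex_of_real (Determinant.det (real_form C)) = Determinant.det C * cnj (Determinant.det C)"
proof -
  define R where "R = map_mat complex_of_real (real_form C)"
  define S where "S = Matrix.mat (2*k) (2*k) (\<lambda>(r, c).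
     if r < k then (if c div 2 = r then (if even c then 1 else \<i>) else 0)
     else (if c div 2 = r - k then (if even c then 1 else -\<i>) else 0))"
  define D where "D = four_block_mat C (0\<^sub>m k k) (0\<^sub>m k k) (map_mat cnj C)"
  have dimR: "R \<in> carrier_mat (2*k) (2*k)" using C by (auto simp: R_def real_form_def)
  have dimS: "S \<in> carrier_mat (2*k) (2*k)" by (auto simp: S_def)
  have dimD: "D \<in> carrier_mat (2*k) (2*k)" using C by (auto simp: D_def)
  have R_even: "R $$ (2*m, c) = of_real (Re (C $$ (m, c div 2) * (if even c then 1 else \<i>)))"
    and R_odd: "R $$ (Suc (2*m), c) = of_real (Im (C $$ (m, c div 2) * (if even c then 1 else \<i>)))"
    if "m < k" "c < 2*k" for m c
    using that C by (auto simp: R_def real_form_def Let_def)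
  have SR: "(S * R) $$ (r, c) = (D * S) $$ (r, c)" if r: "r < 2*k" and c: "c < 2*k" for r c
  proof -
    define z where "z m = C $$ (m, c div 2) * (if even c then 1 else \<i>)" for m
    define r' where "r' = (if r < k then r else r - k)"
    define \<epsilon> where "\<epsilon> = (if r < k then \<i> else -\<i>)"
    have r': "r' < k" using r by (auto simp: r'_def)
    have "(S * R) $$ (r, c) = (\<Sum>l<2*k. S $$ (r, l) * R $$ (l, c))"
      using r c dimS dimR by (auto simp: scalar_prod_def atLeast0LessThan)
    also have "\<dots> = (\<Sum>m<k. if m = r' then of_real (Re (z m)) + \<epsilon> * of_real (Im (z m)) else 0)"
      unfolding sum_pairs
      by (rule sum.cong) (use r c in \<open>auto simp: R_even R_odd z_def S_def r'_def \<epsilon>_def\<close>)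
    also have "\<dots> = of_real (Re (z r')) + \<epsilon> * of_real (Im (z r'))"
      using r' by simp
    also have "\<dots> = (if r < k then z r' else cnj (z r'))"
      by (auto simp: \<epsilon>_def complex_eq_iff)
    finally have 1: "(S * R) $$ (r, c) = (if r < k then z r' else cnj (z r'))" .
    have c2: "c div 2 < k" using c by auto
    have "(D * S) $$ (r, c) = (\<Sum>l\<in>{0..<k+k}. D $$ (r, l) * S $$ (l, c))"
      using r c dimS dimD by (simp add: scalar_prod_def atLeast0LessThan mult_2[symmetric])
    also have "\<dots> = (\<Sum>l\<in>{0..<k}. D $$ (r, l) * S $$ (l, c)) + (\<Sum>l\<in>{0..<k}. D $$ (r, l+k) * S $$ (l+k, c))"
    proof -
      have "(\<Sum>l\<in>{0..<k+k}. D $$ (r, l) * S $$ (l, c)) =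
        (\<Sum>l\<in>{0..<k}. D $$ (r, l) * S $$ (l, c)) + (\<Sum>l\<in>{k..<k+k}. D $$ (r, l) * S $$ (l, c))"
        by (simp add: sum.atLeastLessThan_concat)
      then show ?thesis using sum.shift_bounds_nat_ivl[of "\<lambda>l. D $$ (r, l) * S $$ (l, c)" 0 k k] by simp
    qed
    also have "\<dots> = (if r < k then (\<Sum>l\<in>{0..<k}. if l = c div 2 then z r' else 0) 
        else (\<Sum>l\<in>{0..<k}. if l = c div 2 then cnj (z r') else 0))"
    proof (cases "r < k")
      case True
      have "(\<Sum>l\<in>{0..<k}. D $$ (r, l) * S $$ (l, c)) = (\<Sum>l\<in>{0..<k}. if l = c div 2 then z r' else 0)"
        by (rule sum.cong) (use True r c C in \<open>auto simp: D_def S_def z_def r'_def\<close>)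
      moreover have "(\<Sum>l\<in>{0..<k}. D $$ (r, l+k) * S $$ (l+k, c)) = 0"
        by (rule sum.neutral) (use True r c C in \<open>auto simp: D_def S_def\<close>)
      ultimately show ?thesis using True by simp
    next
      case False
      have "(\<Sum>l\<in>{0..<k}. D $$ (r, l+k) * S $$ (l+k, c)) = (\<Sum>l\<in>{0..<k}. if l = c div 2 then cnj (z r') else 0)"
        by (rule sum.cong) (use False r c C in \<open>auto simp: D_def S_def z_def r'_def\<close>)
      moreover have "(\<Sum>l\<in>{0..<k}. D $$ (r, l) * S $$ (l, c)) = 0"
        by (rule sum.neutral) (use False r c C in \<open>auto simp: D_def S_def\<close>)
      ultimately show ?thesis using False by simp
    qed
    also have "\<dots> = (if r < k then z r' else cnj (z r'))" using c2 by simp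
    finally show ?thesis using 1 by simp
  qed
  have "S * R = D * S"
    by (rule eq_matI) (use SR dimR dimS dimD in auto)
  then have "Determinant.det S * Determinant.det R = Determinant.det D * Determinant.det S"
    using det_mult[OF dimS dimR] det_mult[OF dimD dimS] by metis
  moreover have "Determinant.det S \<noteq> 0"
  proof -
    \<comment> \<open>The rows of \<open>S\<close> are orthogonal, each of squared length 2.\<close>
    define S' where "S' = Matrix.mat (2*k) (2*k) (\<lambda>(r, c). cnj (S $$ (c, r)) / 2)"
    have dimS': "S' \<in> carrier_mat (2*k) (2*k)" by (auto simp: S'_def)
    have "(S * S') $$ (r, c) = 1\<^sub>m (2*k) $$ (r, c)" if r: "r < 2*k" and c: "c < 2*k" for r c
    proof -
      define r' where "r' = (if r < k then r else r - k)"
      have r': "r' < k" using r by (auto simp: r'_def)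
      have "(S * S') $$ (r, c) = (\<Sum>l<2*k. S $$ (r, l) * cnj (S $$ (c, l)) / 2)"
        using r c dimS dimS' by (auto simp: scalar_prod_def atLeast0LessThan S'_def)
      also have "\<dots> = (\<Sum>m<k. if m = r' then (if r = c then 1 else 0) else 0)"
        unfolding sum_pairs
        by (rule sum.cong) (use r c in \<open>auto simp: S_def r'_def\<close>)
      finally show ?thesis using r c r' by simp
    qed
    then have "S * S' = 1\<^sub>m (2*k)" by (intro eq_matI) (use dimS dimS' in auto)
    then have "Determinant.det S * Determinant.det S' = 1"
      using det_mult[OF dimS dimS'] by simp
    then show ?thesis by auto
  qed
  ultimately have "Determinant.det R = Determinant.det D" by simp
  moreover have "Determinant.det R = of_real (Determinant.det (real_form C))"
    unfolding R_def by (rule of_real_hom.hom_det)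
  moreover have "Determinant.det D = Determinant.det C * Determinant.det (map_mat cnj C)"
    unfolding D_def by (rule det_four_block_mat_lower_left_zero) (use C in auto)
  moreover have "Determinant.det (map_mat cnj C) = cnj (Determinant.det C)"
  proof -
    interpret cnj: comm_ring_hom cnj by unfold_locales auto
    show ?thesis by (rule cnj.hom_det)
  qed
  ultimately show ?thesis by simp
qed

section \<open>Bases of quotient spaces\<close>

definition indep_mod :: "'v::real_vector set \<Rightarrow> 'v list \<Rightarrow> bool" where
  "indep_mod B vs \<longleftrightarrow> (\<forall>c. (\<Sum>i<length vs. c i *\<^sub>R vs ! i) \<in> B \<longrightarrow> (\<forall>i<length vs. c i = 0))"

lemma span_mod:
  assumes B: "subspace B" and u: "u \<in> span (B \<union> set vs)"
  shows "\<exists>c. u - (\<Sum>i<length vs. c i *\<^sub>R vs ! i) \<in> B"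
proof -
  let ?T = "{u. \<exists>c. u - (\<Sum>i<length vs. c i *\<^sub>R vs ! i) \<in> B}"
  have "subspace ?T"
  proof (rule subspaceI)
    show "0 \<in> ?T" using subspace_0[OF B] by (auto intro!: exI[of _ "\<lambda>_. 0"])
  next
    fix x y assume "x \<in> ?T" "y \<in> ?T"
    then obtain c d where "x - (\<Sum>i<length vs. c i *\<^sub>R vs ! i) \<in> B" "y - (\<Sum>i<length vs. d i *\<^sub>R vs ! i) \<in> B"
      by auto
    from subspace_add[OF B this] show "x + y \<in> ?T"
      by (auto intro!: exI[of _ "\<lambda>i. c i + d i"] simp: scaleR_add_left sum.distrib algebra_simps)
  next
    fix r x assume "x \<in> ?T"
    then obtain c where "x - (\<Sum>i<length vs. c i *\<^sub>R vs ! i) \<in> B" by auto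
    from subspace_scale[OF B this, of r] show "r *\<^sub>R x \<in> ?T"
      by (auto intro!: exI[of _ "\<lambda>i. r * c i"] simp: scaleR_diff_right scaleR_sum_right)
  qed
  moreover have "B \<union> set vs \<subseteq> ?T"
  proof
    fix x assume "x \<in> B \<union> set vs"
    then show "x \<in> ?T"
    proof
      assume "x \<in> B" then show ?thesis by (auto intro!: exI[of _ "\<lambda>_. 0"])
    next
      assume "x \<in> set vs"
      then obtain j where j: "j < length vs" "x = vs ! j" by (auto simp: in_set_conv_nth)
      have "(\<Sum>i<length vs. (if i = j then 1 else 0) *\<^sub>R vs ! i) = (\<Sum>i<length vs. if i = j then vs ! i else 0)"
        by (rule sum.cong) auto
      then have "x - (\<Sum>i<length vs. (if i = j then 1 else 0) *\<^sub>R vs ! i) = 0"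
        using j by simp
      then have "x - (\<Sum>i<length vs. (if i = j then 1 else 0) *\<^sub>R vs ! i) \<in> B"
        using subspace_0[OF B] by simp
      then show ?thesis by (intro CollectI exI)
    qed
  qed
  ultimately show ?thesis using u span_minimal by blast
qed

lemma sum_append1:
  fixes f :: "nat \<Rightarrow> 'v \<Rightarrow> 'w::comm_monoid_add"
  shows "(\<Sum>i<length (vs @ [v]). f i ((vs @ [v]) ! i)) = (\<Sum>i<length vs. f i (vs ! i)) + f (length vs) v"
  by (simp add: nth_append)

text \<open>
  Each vector of the list lies outside the span of \<open>B\<close> and its predecessors.
\<close>

lemma dim_indep_mod:
  fixes B :: "'v::euclidean_space set"
  assumes B: "subspace B"
  shows "indep_mod B vs \<Longrightarrow> dim (B \<union> set vs) = dim B + length vs"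
proof (induction vs rule: rev_induct)
  case Nil
  then show ?case by simp
next
  case (snoc v vs)
  have ind: "\<forall>i<Suc (length vs). c i = 0" if "(\<Sum>i<length vs. c i *\<^sub>R vs ! i) + c (length vs) *\<^sub>R v \<in> B" for c
  proof -
    have "(\<Sum>i<length (vs @ [v]). c i *\<^sub>R (vs @ [v]) ! i) \<in> B"
      unfolding sum_append1[of "\<lambda>i x. c i *\<^sub>R x"] by (rule that)
    then have "\<forall>i<length (vs @ [v]). c i = 0"
      using spec[OF snoc.prems[unfolded indep_mod_def], of c] by (elim impE)
    then show ?thesis by simp
  qed
  have "indep_mod B vs"
    unfolding indep_mod_def
  proof (intro allI impI)
    fix c i assume "(\<Sum>i<length vs. c i *\<^sub>R vs ! i) \<in> B" "i < length vs"
    then show "c i = 0" using ind[of "\<lambda>i. if i < length vs then c i else 0", THEN spec, of i] by simp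
  qed
  note IH = snoc.IH[OF this]
  have "v \<notin> span (B \<union> set vs)"
  proof
    assume "v \<in> span (B \<union> set vs)"
    then obtain c where "v - (\<Sum>i<length vs. c i *\<^sub>R vs ! i) \<in> B" using span_mod[OF B] by blast
    then have "(\<Sum>i<length vs. (- c i) *\<^sub>R vs ! i) + v \<in> B" by (simp add: sum_negf)
    then show False using ind[of "\<lambda>i. if i < length vs then - c i else 1", THEN spec, of "length vs"] by simp
  qed
  then have "dim (insert v (B \<union> set vs)) = dim (B \<union> set vs) + 1" by (simp add: dim_insert)
  then show ?case using IH by simp
qed

text \<open>
  For the frames below independence can be checked directly, whereas spanning follows from
  the dimensions being locally constant.
\<close>

lemma quotient_basis_iff_dim:
  fixes A B :: "'v::euclidean_space set"
  assumes A: "subspace A" and B: "subspace B" and BA: "B \<subseteq> A"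
  shows "quotient_basis A B vs \<longleftrightarrow> set vs \<subseteq> A \<and> indep_mod B vs \<and> dim A = dim B + length vs"
proof -
  have qb: "quotient_basis A B vs \<longleftrightarrow> set vs \<subseteq> A \<and> indep_mod B vs \<and>
      (\<forall>a\<in>A. \<exists>c. a - (\<Sum>i<length vs. c i *\<^sub>R vs ! i) \<in> B)"
    unfolding quotient_basis_def indep_mod_def by blast
  have "(\<forall>a\<in>A. \<exists>c. a - (\<Sum>i<length vs. c i *\<^sub>R vs ! i) \<in> B) \<longleftrightarrow> dim A = dim B + length vs"
    if vs: "set vs \<subseteq> A" and ind: "indep_mod B vs"
  proof -
    have sub: "span (B \<union> set vs) \<subseteq> A" using A BA vs by (intro span_minimal) auto
    have d: "dim (span (B \<union> set vs)) = dim B + length vs" using dim_indep_mod[OF B ind] by simp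
    show ?thesis
    proof
      assume span: "\<forall>a\<in>A. \<exists>c. a - (\<Sum>i<length vs. c i *\<^sub>R vs ! i) \<in> B"
      have "a \<in> span (B \<union> set vs)" if a: "a \<in> A" for a
      proof -
        obtain c where c: "a - (\<Sum>i<length vs. c i *\<^sub>R vs ! i) \<in> B" using a span by blast
        have "(a - (\<Sum>i<length vs. c i *\<^sub>R vs ! i)) + (\<Sum>i<length vs. c i *\<^sub>R vs ! i) \<in> span (B \<union> set vs)"
          by (intro span_add span_sum span_scale span_base) (use c in auto)
        then show ?thesis by simp
      qed
      then have "A = span (B \<union> set vs)" using sub by blast
      then show "dim A = dim B + length vs" using d by simp
    next
      assume "dim A = dim B + length vs"
      then have "span (B \<union> set vs) = A" using subspace_dim_equal[OF subspace_span A sub] d by simp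
      then show "\<forall>a\<in>A. \<exists>c. a - (\<Sum>i<length vs. c i *\<^sub>R vs ! i) \<in> B" using span_mod[OF B] by blast
    qed
  qed
  then show ?thesis using qb by blast
qed

lemma quotient_basis_length_unique:
  fixes A B :: "'v::euclidean_space set"
  assumes "subspace A" "subspace B" "B \<subseteq> A" "quotient_basis A B us" "quotient_basis A B vs"
  shows "length us = length vs"
  using quotient_basis_iff_dim[OF assms(1-3), of us] quotient_basis_iff_dim[OF assms(1-3), of vs] assms(4,5)
  by simp

lemma transition_exists:
  assumes us: "set us \<subseteq> A" and vs: "quotient_basis A B vs" and len: "length us = length vs"
  obtains M where "transition_matrix B us vs M"
proof -
  have "\<forall>a\<in>A. \<exists>c. a - (\<Sum>i<length vs. c i *\<^sub>R vs ! i) \<in> B"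
    using vs unfolding quotient_basis_def by (elim conjE)
  then have "\<forall>j<length us. \<exists>c. us ! j - (\<Sum>i<length vs. c i *\<^sub>R vs ! i) \<in> B"
    using us nth_mem[of _ us] by (meson subsetD)
  then obtain c where c: "\<forall>j<length us. us ! j - (\<Sum>i<length vs. c j i *\<^sub>R vs ! i) \<in> B" by metis
  have "us ! j - (\<Sum>i<length vs. Matrix.mat (length vs) (length vs) (\<lambda>(i, j). c j i) $$ (i, j) *\<^sub>R vs ! i) \<in> B"
    if j: "j < length us" for j
  proof -
    have "(\<Sum>i<length vs. Matrix.mat (length vs) (length vs) (\<lambda>(i, j). c j i) $$ (i, j) *\<^sub>R vs ! i)
      = (\<Sum>i<length vs. c j i *\<^sub>R vs ! i)"
      by (rule sum.cong) (use j len in auto)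
    then show ?thesis using c j by simp
  qed
  then have "transition_matrix B us vs (Matrix.mat (length vs) (length vs) (\<lambda>(i, j). c j i))"
    using len unfolding transition_matrix_def by auto
  then show ?thesis using that by blast
qed

lemma transition_comp:
  assumes B: "subspace B" and M: "transition_matrix B us vs M" and N: "transition_matrix B vs ws N"
  shows "transition_matrix B us ws (N * M)"
proof -
  let ?n = "length ws"
  have len: "length us = ?n" "length vs = ?n" using M N unfolding transition_matrix_def by auto
  have dM: "M \<in> carrier_mat ?n ?n" and dN: "N \<in> carrier_mat ?n ?n"
    using M N len unfolding transition_matrix_def by auto
  have "us ! j - (\<Sum>i<?n. (N * M) $$ (i, j) *\<^sub>R ws ! i) \<in> B" if j: "j < ?n" for j
  proof -
    have 1: "us ! j - (\<Sum>k<?n. M $$ (k, j) *\<^sub>R vs ! k) \<in> B"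
      using M j len unfolding transition_matrix_def by auto
    have 2: "(\<Sum>k<?n. M $$ (k, j) *\<^sub>R (vs ! k - (\<Sum>i<?n. N $$ (i, k) *\<^sub>R ws ! i))) \<in> B"
      by (intro subspace_sum[OF B] subspace_scale[OF B])
        (use N len in \<open>auto simp: transition_matrix_def\<close>)
    have "(\<Sum>i<?n. (N * M) $$ (i, j) *\<^sub>R ws ! i) = (\<Sum>i<?n. \<Sum>k<?n. (N $$ (i, k) * M $$ (k, j)) *\<^sub>R ws ! i)"
      by (rule sum.cong) (use dM dN j in \<open>auto simp: scalar_prod_def atLeast0LessThan scaleR_sum_left\<close>)
    also have "\<dots> = (\<Sum>k<?n. M $$ (k, j) *\<^sub>R (\<Sum>i<?n. N $$ (i, k) *\<^sub>R ws ! i))"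
      by (subst sum.swap) (simp add: scaleR_sum_right mult.commute)
    finally have "us ! j - (\<Sum>i<?n. (N * M) $$ (i, j) *\<^sub>R ws ! i) =
       (us ! j - (\<Sum>k<?n. M $$ (k, j) *\<^sub>R vs ! k)) +
       (\<Sum>k<?n. M $$ (k, j) *\<^sub>R (vs ! k - (\<Sum>i<?n. N $$ (i, k) *\<^sub>R ws ! i)))"
      by (simp add: scaleR_diff_right sum_subtractf)
    then show ?thesis using subspace_add[OF B 1 2] by metis
  qed
  then show ?thesis using len dM dN unfolding transition_matrix_def by auto
qed

lemma transition_one:
  assumes len: "length us = length vs" and d: "\<And>j. j < length us \<Longrightarrow> us ! j - vs ! j \<in> B"
  shows "transition_matrix B us vs (1\<^sub>m (length vs))"
proof -
  have "(\<Sum>i<length vs. 1\<^sub>m (length vs) $$ (i, j) *\<^sub>R vs ! i) = vs ! j" if j: "j < length vs" for j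
  proof -
    have "(\<Sum>i<length vs. 1\<^sub>m (length vs) $$ (i, j) *\<^sub>R vs ! i) = (\<Sum>i<length vs. if i = j then vs ! i else 0)"
      by (rule sum.cong) (use j in auto)
    then show ?thesis using j by simp
  qed
  then show ?thesis using len d unfolding transition_matrix_def by auto
qed

lemma transition_unique:
  assumes B: "subspace B" and ind: "indep_mod B vs"
    and M: "transition_matrix B us vs M" and N: "transition_matrix B us vs N"
  shows "M = N"
proof (rule eq_matI)
  let ?n = "length vs"
  show "dim_row M = dim_row N" "dim_col M = dim_col N"
    using M N unfolding transition_matrix_def by auto
  fix i j assume "i < dim_row N" "j < dim_col N"
  then have ij: "i < ?n" "j < ?n" using N unfolding transition_matrix_def by auto
  have "us ! j - (\<Sum>i<?n. N $$ (i, j) *\<^sub>R vs ! i) - (us ! j - (\<Sum>i<?n. M $$ (i, j) *\<^sub>R vs ! i)) \<in> B"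
    by (rule subspace_diff[OF B]) (use M N ij in \<open>auto simp: transition_matrix_def\<close>)
  then have "(\<Sum>i<?n. (M $$ (i, j) - N $$ (i, j)) *\<^sub>R vs ! i) \<in> B"
    by (simp add: scaleR_diff_left sum_subtractf)
  then show "M $$ (i, j) = N $$ (i, j)"
    using ind[unfolded indep_mod_def, rule_format, OF _ ij(1)] by (metis right_minus_eq)
qed

lemma transition_det_inverse:
  assumes B: "subspace B" and ind: "indep_mod B vs"
    and M: "transition_matrix B vs us M" and N: "transition_matrix B us vs N"
  shows "Determinant.det N * Determinant.det M = 1"
proof -
  have "N * M = 1\<^sub>m (length vs)"
    by (rule transition_unique[OF B ind transition_comp[OF B M N]], rule transition_one)
      (use subspace_0[OF B] in auto)
  moreover have "M \<in> carrier_mat (length vs) (length vs)" "N \<in> carrier_mat (length vs) (length vs)"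
    using M N unfolding transition_matrix_def by auto
  ultimately show ?thesis using det_mult by (metis det_one)
qed

lemma transition_det_nonzero:
  fixes A B :: "'v::euclidean_space set"
  assumes A: "subspace A" and B: "subspace B" and BA: "B \<subseteq> A"
    and us: "quotient_basis A B us" and vs: "quotient_basis A B vs" and M: "transition_matrix B us vs M"
  shows "Determinant.det M \<noteq> 0"
proof -
  have "set vs \<subseteq> A" using vs unfolding quotient_basis_def by blast
  then obtain N where N: "transition_matrix B vs us N"
    using transition_exists us quotient_basis_length_unique[OF A B BA vs us] by metis
  have "indep_mod B vs" using vs unfolding quotient_basis_def indep_mod_def by blast
  from transition_det_inverse[OF B this N M] show ?thesis by auto
qed

section \<open>Complex orientations\<close>

lemma cscale_linear_simps:
  "cscale c (x + y) = cscale c x + cscale c y"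
  "cscale c (x - y) = cscale c x - cscale c y"
  "cscale c (- x) = - cscale c x"
  "cscale (c + d) x = cscale c x + cscale d x"
  "cscale (c * d) x = cscale c (cscale d x)"
  "cscale 1 x = x" "cscale 0 x = 0" "cscale c 0 = 0"
  "cscale (of_real r) x = r *\<^sub>R x"
  unfolding cscale_def Finite_Cartesian_Product.vec_eq_iff by (auto simp: algebra_simps scaleR_conv_of_real[where 'a=complex])

lemma cscale_Complex: "cscale (Complex a b) x = a *\<^sub>R x + b *\<^sub>R cscale \<i> x"
proof -
  have "cscale (Complex a b) x = cscale (of_real a + of_real b * \<i>) x"
    by (simp add: Complex_eq mult.commute)
  then show ?thesis by (simp only: cscale_linear_simps)
qed

lemma cscale_sum: "cscale c (\<Sum>i\<in>I. f i) = (\<Sum>i\<in>I. cscale c (f i))"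
  by (induction I rule: infinite_finite_induct) (auto simp: cscale_linear_simps)

lemma complex_quotient_basisD:
  assumes "complex_quotient_basis A B es"
  shows "set es \<subseteq> A" "a \<in> A \<Longrightarrow> \<exists>c. a - (\<Sum>k<length es. cscale (c k) (es ! k)) \<in> B"
    "(\<Sum>k<length es. cscale (c k) (es ! k)) \<in> B \<Longrightarrow> k < length es \<Longrightarrow> c k = 0"
  using assms unfolding complex_quotient_basis_def by simp_all

lemma quotient_basisD:
  assumes "quotient_basis A B vs"
  shows "set vs \<subseteq> A" "a \<in> A \<Longrightarrow> \<exists>c. a - (\<Sum>k<length vs. c k *\<^sub>R vs ! k) \<in> B"
    "(\<Sum>k<length vs. c k *\<^sub>R vs ! k) \<in> B \<Longrightarrow> k < length vs \<Longrightarrow> c k = 0" "indep_mod B vs"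
  using assms unfolding quotient_basis_def indep_mod_def by simp_all

text \<open>
  Closure under \<open>cscale\<close> is spelled out because this scaling of nested vectors is not the
  scalar multiplication of a type class instance.
\<close>

definition complex_subspace :: "(complex^'n^'i) set \<Rightarrow> bool" where
  "complex_subspace A \<longleftrightarrow> 0 \<in> A \<and> (\<forall>x\<in>A. \<forall>y\<in>A. x + y \<in> A) \<and> (\<forall>c. \<forall>x\<in>A. cscale c x \<in> A)"

lemma complex_subspaceD:
  assumes "complex_subspace A"
  shows "subspace A" "x \<in> A \<Longrightarrow> cscale c x \<in> A"
  using assms unfolding complex_subspace_def subspace_def
  by (auto simp: cscale_linear_simps(9)[symmetric])

definition doubled :: "(complex^'n^'i) list \<Rightarrow> (complex^'n^'i) list" where
  "doubled es = concat (map (\<lambda>e. [e, cscale \<i> e]) es)"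

lemma length_doubled [simp]: "length (doubled es) = 2 * length es"
  unfolding doubled_def by (induction es) auto

lemma nth_doubled:
  "m < length es \<Longrightarrow> doubled es ! (2*m) = es ! m \<and> doubled es ! Suc (2*m) = cscale \<i> (es ! m)"
proof (induction es arbitrary: m)
  case (Cons e es)
  then show ?case by (cases m) (auto simp: doubled_def)
qed simp

lemma nth_doubled':
  assumes "r < 2 * length es"
  shows "doubled es ! r = cscale (if even r then 1 else \<i>) (es ! (r div 2))"
  using nth_doubled[of "r div 2" es] assms
  by (auto simp: cscale_linear_simps elim!: evenE oddE)

lemma set_doubled: "complex_subspace A \<Longrightarrow> set (doubled es) \<subseteq> A \<longleftrightarrow> set es \<subseteq> A"
  unfolding doubled_def using complex_subspaceD(2) by fastforce

lemma sum_doubled: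
  "(\<Sum>l<length (doubled es). r l *\<^sub>R doubled es ! l) =
   (\<Sum>m<length es. cscale (Complex (r (2*m)) (r (2*m+1))) (es ! m))"
  unfolding length_doubled sum_pairs
  by (rule sum.cong) (auto simp: nth_doubled cscale_Complex)

lemma sum_doubled':
  "(\<Sum>m<length es. cscale (c m) (es ! m)) =
   (\<Sum>l<length (doubled es). (if even l then Re (c (l div 2)) else Im (c (l div 2))) *\<^sub>R doubled es ! l)"
  unfolding sum_doubled by simp

lemma indep_mod_doubled:
  assumes ind: "\<And>c k. (\<Sum>k<length es. cscale (c k) (es ! k)) \<in> B \<Longrightarrow> k < length es \<Longrightarrow> c k = 0"
  shows "indep_mod B (doubled es)"
  unfolding indep_mod_def
proof (intro allI impI)
  fix r l assume h: "(\<Sum>l<length (doubled es). r l *\<^sub>R doubled es ! l) \<in> B" and l: "l < length (doubled es)"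
  have "Complex (r (2*(l div 2))) (r (2*(l div 2)+1)) = 0"
    by (rule ind[OF h[unfolded sum_doubled]]) (use l in simp)
  then show "r l = 0" by (cases "even l") (auto simp: complex_eq_iff)
qed

lemma complex_quotient_basis_iff_doubled:
  assumes A: "complex_subspace A"
  shows "complex_quotient_basis A B es \<longleftrightarrow> quotient_basis A B (doubled es)"
proof
  assume es: "complex_quotient_basis A B es"
  have span: "\<exists>r. a - (\<Sum>l<length (doubled es). r l *\<^sub>R doubled es ! l) \<in> B" if a: "a \<in> A" for a
  proof -
    obtain c where "a - (\<Sum>k<length es. cscale (c k) (es ! k)) \<in> B"
      using complex_quotient_basisD(2)[OF es a] ..
    then show ?thesis unfolding sum_doubled'
      by (rule exI[of _ "\<lambda>l. if even l then Re (c (l div 2)) else Im (c (l div 2))"])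
  qed
  have "indep_mod B (doubled es)"
    by (rule indep_mod_doubled) (rule complex_quotient_basisD(3)[OF es])
  then show "quotient_basis A B (doubled es)"
    unfolding quotient_basis_def indep_mod_def
    using complex_quotient_basisD(1)[OF es] span set_doubled[OF A] by simp
next
  assume es: "quotient_basis A B (doubled es)"
  have span: "\<exists>c. a - (\<Sum>k<length es. cscale (c k) (es ! k)) \<in> B" if a: "a \<in> A" for a
  proof -
    obtain r where "a - (\<Sum>l<length (doubled es). r l *\<^sub>R doubled es ! l) \<in> B"
      using quotient_basisD(2)[OF es a] ..
    then show ?thesis unfolding sum_doubled
      by (rule exI[of _ "\<lambda>m. Complex (r (2*m)) (r (2*m+1))"])
  qed
  have "c k = 0" if h: "(\<Sum>k<length es. cscale (c k) (es ! k)) \<in> B" and k: "k < length es" for c k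
  proof -
    note ind = quotient_basisD(3)[OF es h[unfolded sum_doubled']]
    from ind[of "2*k"] ind[of "2*k+1"] show ?thesis
      using k by (auto simp: complex_eq_iff)
  qed
  then show "complex_quotient_basis A B es"
    unfolding complex_quotient_basis_def using es span set_doubled[OF A]
    by (simp add: quotient_basis_def)
qed

text \<open>
  A maximal complex independent list spans.  Maximal lists exist since complex independence implies
  real independence, which bounds the length by the real dimension.
\<close>

lemma complex_quotient_basis_exists:
  fixes A B :: "(complex^'n::finite^'i::finite) set"
  assumes A: "complex_subspace A" and B: "complex_subspace B"
  obtains es where "complex_quotient_basis A B es"
proof -
  define ok where "ok es \<longleftrightarrow> set es \<subseteq> A \<and>
    (\<forall>c. (\<Sum>k<length es. cscale (c k) (es ! k)) \<in> B \<longrightarrow> (\<forall>k<length es. c k = 0))" for es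
  note sB = complex_subspaceD(1)[OF B]
  have bound: "length es \<le> DIM(complex^'n^'i)" if "ok es" for es
  proof -
    have "indep_mod B es"
      unfolding indep_mod_def
    proof (intro allI impI)
      fix r k assume "(\<Sum>i<length es. r i *\<^sub>R es ! i) \<in> B" and k: "k < length es"
      then have "(\<Sum>i<length es. cscale (of_real (r i)) (es ! i)) \<in> B"
        by (simp only: cscale_linear_simps)
      then have "\<forall>k<length es. complex_of_real (r k) = 0"
        using that unfolding ok_def by (elim conjE allE[of _ "\<lambda>k. of_real (r k)"] impE)
      then show "r k = 0" using k by simp
    qed
    from dim_indep_mod[OF sB this] show ?thesis
      using dim_subset_UNIV[of "B \<union> set es"] by simp
  qed
  have "ok []" unfolding ok_def by simp
  obtain es where es: "ok es" and max: "\<And>es'. ok es' \<Longrightarrow> length es' \<le> length es"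
    using ex_has_greatest_nat[of ok "[]" length "Suc DIM(complex^'n^'i)"] \<open>ok []\<close> bound
    by (metis le_imp_less_Suc)
  have "\<exists>c. a - (\<Sum>k<length es. cscale (c k) (es ! k)) \<in> B" if a: "a \<in> A" for a
  proof (rule ccontr)
    assume no: "\<nexists>c. a - (\<Sum>k<length es. cscale (c k) (es ! k)) \<in> B"
    have "ok (es @ [a])"
      unfolding ok_def
    proof (intro conjI allI impI)
      show "set (es @ [a]) \<subseteq> A" using es a unfolding ok_def by simp
      fix c k
      assume "(\<Sum>k<length (es @ [a]). cscale (c k) ((es @ [a]) ! k)) \<in> B" and k: "k < length (es @ [a])"
      then have h: "(\<Sum>k<length es. cscale (c k) (es ! k)) + cscale (c (length es)) a \<in> B"
        unfolding sum_append1[of "\<lambda>k. cscale (c k)"] by simp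
      have c0: "c (length es) = 0"
      proof (rule ccontr)
        assume nz: "c (length es) \<noteq> 0"
        define d where "d = inverse (c (length es))"
        have "cscale d ((\<Sum>k<length es. cscale (c k) (es ! k)) + cscale (c (length es)) a) \<in> B"
          using complex_subspaceD(2)[OF B h] .
        moreover have "cscale d (cscale (c (length es)) a) = a"
          using nz cscale_linear_simps(5)[of d "c (length es)" a] by (simp add: d_def cscale_linear_simps(6))
        moreover have "cscale d (\<Sum>k<length es. cscale (c k) (es ! k)) =
            - (\<Sum>k<length es. cscale (- d * c k) (es ! k))"
          unfolding cscale_sum sum_negf[symmetric]
          by (rule sum.cong) (auto simp: cscale_def Finite_Cartesian_Product.vec_eq_iff)
        ultimately have "a - (\<Sum>k<length es. cscale (- d * c k) (es ! k)) \<in> B"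
          by (simp add: cscale_linear_simps(1) del: mult_minus_left)
        then have "\<exists>c. a - (\<Sum>k<length es. cscale (c k) (es ! k)) \<in> B"
          by (rule exI[of _ "\<lambda>k. - d * c k"])
        then show False using no by (rule notE[rotated])
      qed
      then have "(\<Sum>k<length es. cscale (c k) (es ! k)) \<in> B" using h by (simp add: cscale_linear_simps)
      then have "\<forall>k<length es. c k = 0" using es unfolding ok_def by (elim conjE allE[of _ c] impE)
      then show "c k = 0" using k c0 by (cases "k = length es") auto
    qed
    from max[OF this] show False by simp
  qed
  then have "complex_quotient_basis A B es"
    using es unfolding ok_def complex_quotient_basis_def by simp
  then show ?thesis by (rule that)
qed

text \<open>
  The transition matrix is the real form of the matrix expressing \<open>fs\<close> in terms of \<open>es\<close>, and the
  determinant of a real form is the square of an absolute value.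
\<close>

lemma transition_doubled_pos:
  fixes A B :: "(complex^'n::finite^'i::finite) set"
  assumes A: "complex_subspace A" and B: "complex_subspace B" and BA: "B \<subseteq> A"
    and es: "complex_quotient_basis A B es" and fs: "complex_quotient_basis A B fs"
    and M: "transition_matrix B (doubled fs) (doubled es) M"
  shows "Determinant.det M > 0"
proof -
  note sA = complex_subspaceD(1)[OF A] and sB = complex_subspaceD(1)[OF B]
  note es' = es[unfolded complex_quotient_basis_iff_doubled[OF A]]
  note fs' = fs[unfolded complex_quotient_basis_iff_doubled[OF A]]
  define k where "k = length es"
  have len: "length fs = k"
    using quotient_basis_length_unique[OF sA sB BA es' fs'] by (simp add: k_def)
  have "\<forall>a\<in>A. \<exists>c. a - (\<Sum>i<length es. cscale (c i) (es ! i)) \<in> B"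
    using complex_quotient_basisD(2)[OF es] by (rule ballI)
  moreover have "\<forall>j<k. fs ! j \<in> A"
    using fs len unfolding complex_quotient_basis_def by (metis nth_mem subsetD)
  ultimately have "\<forall>j<k. \<exists>c. fs ! j - (\<Sum>i<k. cscale (c i) (es ! i)) \<in> B"
    unfolding k_def by blast
  then obtain c where c: "\<And>j. j < k \<Longrightarrow> fs ! j - (\<Sum>i<k. cscale (c j i) (es ! i)) \<in> B" by metis
  define C where "C = Matrix.mat k k (\<lambda>(i, j). c j i)"
  have dC: "C \<in> carrier_mat k k" by (simp add: C_def)
  have "transition_matrix B (doubled fs) (doubled es) (real_form C)"
    unfolding transition_matrix_def
  proof (intro conjI allI impI)
    show "length (doubled fs) = length (doubled es)" using len k_def by simp
    show "real_form C \<in> carrier_mat (length (doubled es)) (length (doubled es))"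
      using dC by (simp add: real_form_def k_def)
    fix j assume "j < length (doubled fs)"
    then have j: "j < 2 * k" using len by simp
    define \<epsilon> where "\<epsilon> = (if even j then 1 else \<i>)"
    have "(\<Sum>i<length (doubled es). real_form C $$ (i, j) *\<^sub>R doubled es ! i) =
       (\<Sum>m<k. cscale (Complex (real_form C $$ (2*m, j)) (real_form C $$ (2*m+1, j))) (es ! m))"
      unfolding sum_doubled k_def by simp
    also have "\<dots> = (\<Sum>m<k. cscale (\<epsilon> * c (j div 2) m) (es ! m))"
    proof (rule sum.cong)
      fix m assume "m \<in> {..<k}"
      then have "Complex (real_form C $$ (2*m, j)) (real_form C $$ (2*m+1, j)) = \<epsilon> * c (j div 2) m"
        using j dC by (auto simp: real_form_def Let_def C_def \<epsilon>_def complex_eq_iff)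
      then show "cscale (Complex (real_form C $$ (2*m, j)) (real_form C $$ (2*m+1, j))) (es ! m)
        = cscale (\<epsilon> * c (j div 2) m) (es ! m)" by simp
    qed simp
    also have "\<dots> = cscale \<epsilon> (\<Sum>m<k. cscale (c (j div 2) m) (es ! m))"
      by (simp add: cscale_sum cscale_linear_simps)
    finally have "doubled fs ! j - (\<Sum>i<length (doubled es). real_form C $$ (i, j) *\<^sub>R doubled es ! i) =
        cscale \<epsilon> (fs ! (j div 2) - (\<Sum>m<k. cscale (c (j div 2) m) (es ! m)))"
      using nth_doubled'[of j fs] j len by (simp add: \<epsilon>_def cscale_linear_simps(2))
    then show "doubled fs ! j - (\<Sum>i<length (doubled es). real_form C $$ (i, j) *\<^sub>R doubled es ! i) \<in> B"
      using complex_subspaceD(2)[OF B] c j by auto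
  qed
  moreover have "indep_mod B (doubled es)"
    by (rule quotient_basisD(4)[OF es'])
  ultimately have "M = real_form C" using transition_unique[OF sB] M by blast
  moreover have "Determinant.det M \<noteq> 0" by (rule transition_det_nonzero[OF sA sB BA fs' es' M])
  moreover have "Determinant.det (real_form C) \<ge> 0"
  proof -
    have "complex_of_real (Determinant.det (real_form C)) = of_real ((norm (Determinant.det C))\<^sup>2)"
      using det_real_form[OF dC] complex_norm_square by simp
    then have "Determinant.det (real_form C) = (norm (Determinant.det C))\<^sup>2"
      using of_real_eq_iff by blast
    then show ?thesis by simp
  qed
  ultimately show ?thesis by simp
qed

text \<open>
  Positivity is defined by the existence of some complex basis; as all of them are related by positive
  determinants, any single one decides.
\<close>

lemma complex_orientation_iff:
  fixes A B :: "(complex^'n::finite^'i::finite) set"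
  assumes A: "complex_subspace A" and B: "complex_subspace B" and BA: "B \<subseteq> A"
    and es: "complex_quotient_basis A B es" and vs: "quotient_basis A B vs"
    and M: "transition_matrix B vs (doubled es) M"
  shows "vs \<in> complex_orientation A B \<longleftrightarrow> Determinant.det M > 0"
proof
  assume "Determinant.det M > 0"
  then show "vs \<in> complex_orientation A B"
    using es vs M unfolding complex_orientation_def doubled_def by blast
next
  assume "vs \<in> complex_orientation A B"
  then obtain fs N where fs: "complex_quotient_basis A B fs"
    and N: "transition_matrix B vs (doubled fs) N" and pos: "Determinant.det N > 0"
    unfolding complex_orientation_def doubled_def by blast
  note sA = complex_subspaceD(1)[OF A] and sB = complex_subspaceD(1)[OF B]
  note es' = es[unfolded complex_quotient_basis_iff_doubled[OF A]]
  note fs' = fs[unfolded complex_quotient_basis_iff_doubled[OF A]]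
  have len: "length (doubled fs) = length (doubled es)"
    by (rule quotient_basis_length_unique[OF sA sB BA fs' es'])
  have "set (doubled fs) \<subseteq> A" using fs' unfolding quotient_basis_def by blast
  then obtain K where K: "transition_matrix B (doubled fs) (doubled es) K"
    using transition_exists[OF _ es' len] by blast
  have "M = K * N"
  proof (rule transition_unique[OF sB _ M transition_comp[OF sB N K]])
    show "indep_mod B (doubled es)" by (rule quotient_basisD(4)[OF es'])
  qed
  moreover have "N \<in> carrier_mat (length (doubled es)) (length (doubled es))"
    "K \<in> carrier_mat (length (doubled es)) (length (doubled es))"
    using N K len unfolding transition_matrix_def by auto
  ultimately have "Determinant.det M = Determinant.det K * Determinant.det N"
    using det_mult by blast
  then show "Determinant.det M > 0"
    using pos transition_doubled_pos[OF A B BA es fs K] by simp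
qed

lemma complex_orientation_transition:
  fixes A B :: "(complex^'n::finite^'i::finite) set"
  assumes A: "complex_subspace A" and B: "complex_subspace B" and BA: "B \<subseteq> A"
    and us: "quotient_basis A B us" and vs: "quotient_basis A B vs" and M: "transition_matrix B us vs M"
  shows "Determinant.det M > 0 \<Longrightarrow> us \<in> complex_orientation A B \<longleftrightarrow> vs \<in> complex_orientation A B"
    and "Determinant.det M < 0 \<Longrightarrow> us \<in> complex_orientation A B \<longleftrightarrow> vs \<notin> complex_orientation A B"
proof -
  note sA = complex_subspaceD(1)[OF A] and sB = complex_subspaceD(1)[OF B]
  obtain es where es: "complex_quotient_basis A B es" using complex_quotient_basis_exists[OF A B] .
  note es' = es[unfolded complex_quotient_basis_iff_doubled[OF A]]
  have len: "length vs = length (doubled es)"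
    by (rule quotient_basis_length_unique[OF sA sB BA vs es'])
  have "set vs \<subseteq> A" using vs unfolding quotient_basis_def by blast
  then obtain N where N: "transition_matrix B vs (doubled es) N"
    using transition_exists[OF _ es' len] by blast
  have "N \<in> carrier_mat (length vs) (length vs)" "M \<in> carrier_mat (length vs) (length vs)"
    using M N len unfolding transition_matrix_def by auto
  then have det: "Determinant.det (N * M) = Determinant.det N * Determinant.det M"
    by (rule det_mult)
  have nz: "Determinant.det N \<noteq> 0" by (rule transition_det_nonzero[OF sA sB BA vs es' N])
  note 1 = complex_orientation_iff[OF A B BA es us transition_comp[OF sB M N]]
  note 2 = complex_orientation_iff[OF A B BA es vs N]
  show "Determinant.det M > 0 \<Longrightarrow> us \<in> complex_orientation A B \<longleftrightarrow> vs \<in> complex_orientation A B"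
    unfolding 1 2 det by (simp add: zero_less_mult_iff)
  show "Determinant.det M < 0 \<Longrightarrow> us \<in> complex_orientation A B \<longleftrightarrow> vs \<notin> complex_orientation A B"
    unfolding 1 2 det using nz by (auto simp: zero_less_mult_iff)
qed

lemma quotient_basis_cong:
  fixes A B :: "'v::euclidean_space set"
  assumes A: "subspace A" and B: "subspace B" and BA: "B \<subseteq> A" and ws: "quotient_basis A B ws"
    and len: "length vs = length ws" and d: "\<And>j. j < length ws \<Longrightarrow> vs ! j - ws ! j \<in> B"
  shows "quotient_basis A B vs"
proof -
  note qw = ws[unfolded quotient_basis_iff_dim[OF A B BA]]
  have "vs ! j \<in> A" if j: "j < length ws" for j
  proof -
    have "ws ! j \<in> A" using qw nth_mem[OF j] by blast
    from subspace_add[OF A this] show ?thesis using d[OF j] BA by force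
  qed
  then have "set vs \<subseteq> A" by (auto simp: in_set_conv_nth len)
  moreover have "indep_mod B vs"
    unfolding indep_mod_def
  proof (intro allI impI)
    fix c i assume h: "(\<Sum>i<length vs. c i *\<^sub>R vs ! i) \<in> B" and i: "i < length vs"
    have "(\<Sum>i<length vs. c i *\<^sub>R (vs ! i - ws ! i)) \<in> B"
      by (intro subspace_sum[OF B] subspace_scale[OF B] d) (use len in simp)
    from subspace_diff[OF B h this] have "(\<Sum>i<length ws. c i *\<^sub>R ws ! i) \<in> B"
      using len by (simp add: scaleR_diff_right sum_subtractf)
    then show "c i = 0" using quotient_basisD(3)[OF ws] i len by simp
  qed
  ultimately show ?thesis using qw len unfolding quotient_basis_iff_dim[OF A B BA] by simp
qed

section \<open>Orientations induced on a transverse slice\<close>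

text \<open>
  Since \<open>B = A \<inter> D\<close> and \<open>C = D + A\<close>, the inclusion of \<open>A\<close> in \<open>C\<close> induces an isomorphism of \<open>A / B\<close> with
  \<open>C / D\<close>.  For a slice, \<open>A\<close> and \<open>B\<close> are tangent spaces of real loci, \<open>C\<close> and \<open>D\<close> those of the ambient variety and of \<open>V\<close>.
\<close>

lemma quotient_basis_slice_iff:
  fixes A B C D :: "'v::real_vector set"
  assumes sC: "subspace C" and sA: "subspace A" and AC: "A \<subseteq> C" and BD: "B = A \<inter> D" and DC: "D \<subseteq> C"
    and sD: "subspace D" and sum: "\<And>x. x \<in> C \<Longrightarrow> \<exists>v\<in>D. \<exists>w\<in>A. x = v + w"
  shows "quotient_basis A B vs \<longleftrightarrow> set vs \<subseteq> A \<and> quotient_basis C D vs"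
proof (cases "set vs \<subseteq> A")
  case True
  have mem: "(\<Sum>i<length vs. c i *\<^sub>R vs ! i) \<in> A" for c
    by (intro subspace_sum[OF sA] subspace_scale[OF sA]) (use True in \<open>auto simp: nth_mem subset_iff\<close>)
  have 1: "(\<Sum>i<length vs. c i *\<^sub>R vs ! i) \<in> B \<longleftrightarrow> (\<Sum>i<length vs. c i *\<^sub>R vs ! i) \<in> D" for c
    using mem[of c] BD by auto
  have 2: "(\<forall>a\<in>A. \<exists>c. a - (\<Sum>i<length vs. c i *\<^sub>R vs ! i) \<in> B) \<longleftrightarrow>
     (\<forall>a\<in>C. \<exists>c. a - (\<Sum>i<length vs. c i *\<^sub>R vs ! i) \<in> D)"
  proof (intro iffI ballI)
    fix x assume h: "\<forall>a\<in>A. \<exists>c. a - (\<Sum>i<length vs. c i *\<^sub>R vs ! i) \<in> B" and "x \<in> C"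
    obtain v w where vw: "v \<in> D" "w \<in> A" "x = v + w" using sum \<open>x \<in> C\<close> by blast
    obtain c where "w - (\<Sum>i<length vs. c i *\<^sub>R vs ! i) \<in> B" using h vw(2) by blast
    then have "v + (w - (\<Sum>i<length vs. c i *\<^sub>R vs ! i)) \<in> D"
      using BD subspace_add[OF sD vw(1)] by blast
    then show "\<exists>c. x - (\<Sum>i<length vs. c i *\<^sub>R vs ! i) \<in> D"
      unfolding vw(3) by (auto simp: add_diff_eq)
  next
    fix x assume h: "\<forall>a\<in>C. \<exists>c. a - (\<Sum>i<length vs. c i *\<^sub>R vs ! i) \<in> D" and "x \<in> A"
    then obtain c where "x - (\<Sum>i<length vs. c i *\<^sub>R vs ! i) \<in> D" using AC by blast
    moreover have "x - (\<Sum>i<length vs. c i *\<^sub>R vs ! i) \<in> A" by (rule subspace_diff[OF sA \<open>x \<in> A\<close> mem])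
    ultimately show "\<exists>c. x - (\<Sum>i<length vs. c i *\<^sub>R vs ! i) \<in> B" using BD by blast
  qed
  show ?thesis unfolding quotient_basis_def 1 2 using True AC by (intro iffI conjI) auto
next
  case False
  then show ?thesis unfolding quotient_basis_def by blast
qed

text \<open>
  A transition matrix modulo \<open>B\<close> is also one modulo \<open>D\<close>, so the sign rules carry over from \<open>C / D\<close>.
\<close>

lemma orientation_of_transverse_slice:
  fixes A B C D :: "(complex^'n::finite^'i::finite) set"
  assumes C: "complex_subspace C" and D: "complex_subspace D" and DC: "D \<subseteq> C"
    and A: "subspace A" and AC: "A \<subseteq> C" and BD: "B = A \<inter> D"
    and sum: "\<And>x. x \<in> C \<Longrightarrow> \<exists>v\<in>D. \<exists>w\<in>A. x = v + w"
  shows "orientation_of_quotient A B {vs. quotient_basis A B vs \<and> vs \<in> complex_orientation C D}"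
proof -
  note sC = complex_subspaceD(1)[OF C] and sD = complex_subspaceD(1)[OF D]
  have sB: "subspace B" unfolding BD by (rule subspace_inter[OF A sD])
  note qb = quotient_basis_slice_iff[OF sC A AC BD DC sD sum]
  show ?thesis
    unfolding orientation_of_quotient_def
  proof (intro conjI allI impI ballI)
    show "subspace A" "subspace B" "B \<subseteq> A" using A sB BD by auto
    show "quotient_basis A B vs" if "vs \<in> {vs. quotient_basis A B vs \<and> vs \<in> complex_orientation C D}" for vs
      using that by blast
  next
    fix us vs M
    assume h: "quotient_basis A B us \<and> quotient_basis A B vs \<and> transition_matrix B us vs M"
    then have us: "quotient_basis C D us" and vs: "quotient_basis C D vs"
      using qb by blast+
    have "transition_matrix D us vs M"
      using h BD unfolding transition_matrix_def by blast
    note t = complex_orientation_transition[OF C D DC us vs this]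
    { assume "Determinant.det M > 0"
      from t(1)[OF this] show "us \<in> {vs. quotient_basis A B vs \<and> vs \<in> complex_orientation C D} \<longleftrightarrow>
        vs \<in> {vs. quotient_basis A B vs \<and> vs \<in> complex_orientation C D}" using h by simp }
    { assume "Determinant.det M < 0"
      from t(2)[OF this] show "us \<in> {vs. quotient_basis A B vs \<and> vs \<in> complex_orientation C D} \<longleftrightarrow>
        vs \<notin> {vs. quotient_basis A B vs \<and> vs \<in> complex_orientation C D}" using h by simp }
  qed
qed

section \<open>Continuously differentiable maps and their zero sets\<close>

text \<open>
  Continuity of the derivative is required for each vector separately, which is easy to verify;
  in finite dimension it amounts to continuity in the operator norm, as the lemma
  \<open>linear_family_uniformly_close\<close> shows.
\<close>

definition C1_on :: "'e::euclidean_space set \<Rightarrow> ('e \<Rightarrow> 'w::euclidean_space) \<Rightarrow> ('e \<Rightarrow> 'e \<Rightarrow> 'w) \<Rightarrow> bool" where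
  "C1_on N G D \<longleftrightarrow> open N \<and> (\<forall>x\<in>N. (G has_derivative D x) (at x)) \<and> (\<forall>v. continuous_on N (\<lambda>x. D x v))"

lemma C1_onD:
  assumes "C1_on N G D"
  shows "open N" "x \<in> N \<Longrightarrow> (G has_derivative D x) (at x)" "continuous_on N (\<lambda>x. D x v)"
    "x \<in> N \<Longrightarrow> linear (D x)" "continuous_on N G"
proof -
  have d: "open N" "\<And>x. x \<in> N \<Longrightarrow> (G has_derivative D x) (at x)" "\<And>v. continuous_on N (\<lambda>x. D x v)"
    using assms unfolding C1_on_def by blast+
  show "open N" "x \<in> N \<Longrightarrow> (G has_derivative D x) (at x)" "continuous_on N (\<lambda>x. D x v)" by (fact d)+
  show "x \<in> N \<Longrightarrow> linear (D x)" using d(2) by (rule has_derivative_linear)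
  show "continuous_on N G"
    using has_derivative_continuous_on[of N G D] d(2) has_derivative_at_withinI by blast
qed

lemma C1_on_subset: "C1_on N G D \<Longrightarrow> open M \<Longrightarrow> M \<subseteq> N \<Longrightarrow> C1_on M G D"
  unfolding C1_on_def by (meson continuous_on_subset subsetD)

lemma C1_on_Pair:
  "C1_on N F D \<Longrightarrow> C1_on N G E \<Longrightarrow> C1_on N (\<lambda>x. (F x, G x)) (\<lambda>x v. (D x v, E x v))"
  unfolding C1_on_def by (auto intro: has_derivative_Pair continuous_on_Pair)

lemma C1_on_add:
  "C1_on N F D \<Longrightarrow> C1_on N G E \<Longrightarrow> C1_on N (\<lambda>x. F x + G x) (\<lambda>x v. D x v + E x v)"
  unfolding C1_on_def by (auto intro: has_derivative_add continuous_on_add)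

lemma C1_on_linear:
  "bounded_linear L \<Longrightarrow> C1_on N F D \<Longrightarrow> C1_on N (\<lambda>x. L (F x)) (\<lambda>x v. L (D x v))"
  unfolding C1_on_def
  by (auto intro: bounded_linear.has_derivative bounded_linear.continuous_on)

lemma C1_on_id_minus: "open N \<Longrightarrow> C1_on N (\<lambda>x. x - a) (\<lambda>x v. v)"
  unfolding C1_on_def by (auto intro!: derivative_eq_intros continuous_intros)

lemma C1_on_minus_const: "C1_on N F D \<Longrightarrow> C1_on N (\<lambda>x. F x - a) D"
  unfolding C1_on_def by (auto intro!: derivative_eq_intros)

lemma linear_family_uniformly_close:
  fixes D :: "'e::euclidean_space \<Rightarrow> 'e \<Rightarrow> 'w::euclidean_space"
  assumes N: "open N" and lin: "\<And>x. x \<in> N \<Longrightarrow> linear (D x)"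
    and cont: "\<And>v. continuous_on N (\<lambda>x. D x v)" and a: "a \<in> N" and e: "e > 0"
  obtains \<delta> where "\<delta> > 0" "ball a \<delta> \<subseteq> N" "\<And>x u. x \<in> ball a \<delta> \<Longrightarrow> norm (D x u - D a u) \<le> e * norm u"
proof -
  define n where "n = real DIM('e)"
  have n: "n > 0" by (simp add: n_def)
  have "\<forall>\<^sub>F x in nhds a. norm (D x b - D a b) < e / n" if "b \<in> Basis" for b
  proof -
    have "isCont (\<lambda>x. D x b) a" using cont N a continuous_on_eq_continuous_at by blast
    then have "((\<lambda>x. D x b) \<longlongrightarrow> D a b) (nhds a)" using tendsto_at_iff_tendsto_nhds[of "\<lambda>x. D x b" a] by (simp add: isCont_def)
    then have "\<forall>\<^sub>F x in nhds a. dist (D x b) (D a b) < e / n" by (rule tendstoD) (use e n in simp)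
    then show ?thesis by (simp add: dist_norm)
  qed
  then have "\<forall>\<^sub>F x in nhds a. \<forall>b\<in>Basis. norm (D x b - D a b) < e / n"
    by (simp add: eventually_ball_finite_distrib)
  moreover have "\<forall>\<^sub>F x in nhds a. x \<in> N" using N a by (rule eventually_nhds_in_open)
  ultimately have "\<forall>\<^sub>F x in nhds a. x \<in> N \<and> (\<forall>b\<in>Basis. norm (D x b - D a b) < e / n)"
    by eventually_elim blast
  then obtain \<delta> where \<delta>: "\<delta> > 0" "\<And>x. dist x a < \<delta> \<Longrightarrow> x \<in> N \<and> (\<forall>b\<in>Basis. norm (D x b - D a b) < e / n)"
    unfolding eventually_nhds_metric by blast
  have "norm (D x u - D a u) \<le> e * norm u" if x: "x \<in> ball a \<delta>" for x u
  proof -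
    have x': "x \<in> N" "\<forall>b\<in>Basis. norm (D x b - D a b) < e / n" using \<delta>(2)[of x] x by (auto simp: dist_commute)
    have l: "linear (\<lambda>u. D x u - D a u)" using lin[OF x'(1)] lin[OF a] by (rule linear_compose_sub)
    have "D x u - D a u = (\<Sum>b\<in>Basis. (u \<bullet> b) *\<^sub>R (D x b - D a b))"
      using linear_sum[OF l, of "\<lambda>b. (u \<bullet> b) *\<^sub>R b" Basis] linear_scale[OF l]
      by (simp add: euclidean_representation)
    also have "norm \<dots> \<le> (\<Sum>b\<in>(Basis::'e set). norm u * (e / n))"
    proof (rule sum_norm_le)
      fix b :: 'e assume "b \<in> Basis"
      then show "norm ((u \<bullet> b) *\<^sub>R (D x b - D a b)) \<le> norm u * (e / n)"
        unfolding norm_scaleR by (intro mult_mono) (use x'(2) in \<open>auto simp: Basis_le_norm less_imp_le\<close>)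
    qed
    also have "\<dots> = e * norm u" using n by (simp add: n_def)
    finally show ?thesis .
  qed
  moreover have "ball a \<delta> \<subseteq> N" using \<delta>(2) by (auto simp: dist_commute)
  ultimately show ?thesis using that[OF \<delta>(1)] by blast
qed

lemma C1_locally_injective:
  fixes G :: "'e::euclidean_space \<Rightarrow> 'e"
  assumes G: "C1_on N G D" and a: "a \<in> N" and inj: "\<And>u. D a u = 0 \<Longrightarrow> u = 0"
  obtains r where "r > 0" "ball a r \<subseteq> N" "inj_on G (ball a r)"
proof -
  have "linear (D a)" using C1_onD(4)[OF G a] .
  moreover have "inj (D a)" using inj calculation by (simp add: linear_injective_0)
  ultimately obtain g where g: "linear g" "g \<circ> D a = id" using linear_injective_left_inverse by blast
  show ?thesis
  proof (rule has_derivative_locally_injective[OF a C1_onD(1)[OF G] _ g(2) C1_onD(2)[OF G]])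
    show "bounded_linear g" using g(1) by (simp add: linear_conv_bounded_linear)
    show "\<exists>d>0. \<forall>x. dist a x < d \<longrightarrow> onorm (\<lambda>v. D x v - D a v) < e" if e: "e > 0" for e
    proof -
      obtain \<delta> where \<delta>: "\<delta> > 0" "\<And>x u. x \<in> ball a \<delta> \<Longrightarrow> norm (D x u - D a u) \<le> (e/2) * norm u"
        using linear_family_uniformly_close[OF C1_onD(1)[OF G] C1_onD(4)[OF G] C1_onD(3)[OF G] a, of "e/2"] e
        by (metis half_gt_zero)
      have "onorm (\<lambda>v. D x v - D a v) < e" if "dist a x < \<delta>" for x
      proof -
        have "onorm (\<lambda>v. D x v - D a v) \<le> e/2"
          by (rule onorm_bound) (use \<delta>(2)[of x] that e in auto)
        then show ?thesis using e by simp
      qed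
      then show ?thesis using \<delta>(1) by blast
    qed
  qed (use that in auto)
qed

text \<open>
  For small \<open>t\<close> the point \<open>a + t v\<close> is a zero of \<open>G\<close> up to an error \<open>o(t)\<close>, and it is corrected by a vector \<open>R y\<close>,
  where \<open>R\<close> is a right inverse of \<open>D\<close>.  A correction of size at most \<open>e \<bar>t\<bar>\<close> is a fixed point of
  \<open>y \<mapsto> y - G (a + t v + R y)\<close>, which exists by Brouwer's theorem; as only the velocity at 0 matters, no
  regularity of the curve elsewhere is needed.  The values of \<open>G\<close> are confined to a subspace \<open>W\<close> so that
  the number of equations need not be encoded in the type.
\<close>

lemma curve_in_zero_set:
  fixes G :: "'e::euclidean_space \<Rightarrow> 'w::euclidean_space"
  assumes N: "open N" and a: "a \<in> N" and G0: "G a = 0" and cont: "continuous_on N G"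
    and der: "(G has_derivative D) (at a)" and W: "subspace W"
    and GW: "\<And>x. x \<in> N \<Longrightarrow> G x \<in> W" and DW: "range D = W" and v: "D v = 0"
  obtains c :: "real \<Rightarrow> 'e" where "c 0 = a" "\<forall>\<^sub>F t in nhds 0. c t \<in> N \<and> G (c t) = 0"
    "(c has_vector_derivative v) (at 0)"
proof -
  have lD: "linear D" using der has_derivative_linear by blast
  obtain R where R: "linear R" "\<forall>y\<in>range D. D (R y) = y"
    using linear_exists_right_inverse_on[OF lD subspace_UNIV] by blast
  note R = R(1) bspec[OF R(2), unfolded DW]
  have bR: "bounded_linear R" using R(1) by (simp add: linear_conv_bounded_linear)
  obtain K where K: "K > 0" "\<And>y. norm (R y) \<le> norm y * K"
    using bounded_linear.pos_bounded[OF bR] by blast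
  define Y where "Y t = {y \<in> W. a + t *\<^sub>R v + R y \<in> N \<and> G (a + t *\<^sub>R v + R y) = 0}" for t
  have small: "\<exists>\<delta>>0. \<forall>t. \<bar>t\<bar> < \<delta> \<longrightarrow> (\<exists>y\<in>Y t. norm y \<le> e * \<bar>t\<bar>)" if e: "e > 0" for e
  proof -
    define B where "B = norm v + K * e + 1"
    have B: "B > 0" using K(1) e by (auto simp: B_def intro: add_nonneg_pos)
    have "\<exists>d>0. \<forall>y. norm (y - a) < d \<longrightarrow> norm (G y - G a - D (y - a)) \<le> (e / B) * norm (y - a)"
      using der divide_pos_pos[OF e B] unfolding has_derivative_at_alt by blast
    then obtain d1 where d1: "d1 > 0" "\<And>y. norm (y - a) < d1 \<Longrightarrow> norm (G y - D (y - a)) \<le> (e / B) * norm (y - a)"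
      using G0 by auto
    obtain d2 where d2: "d2 > 0" "ball a d2 \<subseteq> N" using N a open_contains_ball by blast
    define d where "d = min d1 d2"
    have d: "d > 0" using d1 d2 by (simp add: d_def)
    have "\<exists>y\<in>Y t. norm y \<le> e * \<bar>t\<bar>" if t: "\<bar>t\<bar> < d / B" for t
    proof -
      define S where "S = cball 0 (e * \<bar>t\<bar>) \<inter> W"
      have hn: "norm (t *\<^sub>R v + R y) \<le> B * \<bar>t\<bar>" "norm (t *\<^sub>R v + R y) < d" if "y \<in> S" for y
      proof -
        have "norm (R y) \<le> (e * \<bar>t\<bar>) * K"
          by (rule order_trans[OF K(2) mult_right_mono]) (use K(1) that in \<open>auto simp: S_def\<close>)
        then have "norm (t *\<^sub>R v + R y) \<le> \<bar>t\<bar> * norm v + (e * \<bar>t\<bar>) * K"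
          using norm_triangle_ineq[of "t *\<^sub>R v" "R y"] by simp
        also have "\<dots> \<le> B * \<bar>t\<bar>" by (simp add: B_def algebra_simps)
        finally show 1: "norm (t *\<^sub>R v + R y) \<le> B * \<bar>t\<bar>" .
        have "B * \<bar>t\<bar> < d" using t B by (simp add: field_simps)
        then show "norm (t *\<^sub>R v + R y) < d" using 1 by simp
      qed
      define f where "f y = y - G (a + t *\<^sub>R v + R y)" for y
      have inN: "a + t *\<^sub>R v + R y \<in> N" if "y \<in> S" for y
      proof -
        have "dist a (a + t *\<^sub>R v + R y) = norm (t *\<^sub>R v + R y)"
          by (metis add.assoc add_diff_cancel_left' dist_commute dist_norm)
        then show ?thesis using hn(2)[OF that] d2(2) by (auto simp: d_def)
      qed
      obtain y where y: "y \<in> S" "f y = y"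
      proof (rule brouwer[of S f])
        show "compact S" unfolding S_def by (intro compact_Int_closed compact_cball closed_subspace W)
        show "convex S" unfolding S_def by (intro convex_Int convex_cball subspace_imp_convex W)
        have "0 \<in> S" using subspace_0[OF W] e by (simp add: S_def)
        then show "S \<noteq> {}" by blast
        show "continuous_on S f" unfolding f_def
        proof (intro continuous_intros continuous_on_compose2[OF cont])
          show "continuous_on S R" using bR by (rule linear_continuous_on)
        qed (use inN in auto)
        show "f \<in> S \<rightarrow> S"
        proof
          fix y assume y: "y \<in> S"
          let ?h = "t *\<^sub>R v + R y"
          have yW: "y \<in> W" using y by (simp add: S_def)
          have Dh: "D ?h = y" using lD v R(2)[OF yW] by (simp add: linear_add linear_scale)
          have "norm (G (a + ?h) - D ?h) \<le> (e / B) * norm ?h"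
            using d1(2)[of "a + ?h"] hn(2)[OF y] by (simp add: d_def)
          also have "\<dots> \<le> (e / B) * (B * \<bar>t\<bar>)"
            by (rule mult_left_mono[OF hn(1)[OF y]]) (use e B in simp)
          also have "\<dots> = e * \<bar>t\<bar>" using B by simp
          finally have "norm (f y) \<le> e * \<bar>t\<bar>"
            unfolding Dh f_def by (simp add: norm_minus_commute add.assoc)
          moreover have "f y \<in> W" unfolding f_def using subspace_diff[OF W yW GW[OF inN[OF y]]] .
          ultimately show "f y \<in> S" by (simp add: S_def)
        qed
      qed
      then have "y \<in> Y t" unfolding Y_def using inN by (auto simp: f_def S_def)
      then show ?thesis using y(1) by (auto simp: S_def)
    qed
    then show ?thesis using d B by (intro exI[of _ "d / B"]) auto
  qed
  \<comment> \<open>One choice of \<open>y\<close> must be small compared with \<open>t\<close> for every \<open>e\<close> at once, so a nearly shortest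
    correction is taken.  At \<open>t = 0\<close> the tolerance vanishes, which forces the curve to start at \<open>a\<close>.\<close>
  have pick: "\<exists>y\<in>Y t. \<forall>y'\<in>Y t. norm y \<le> norm y' + t\<^sup>2" if ne: "Y t \<noteq> {}" for t
  proof (cases "t = 0")
    case True
    have "0 \<in> Y t" using True a G0 subspace_0[OF W] linear_0[OF R(1)] by (simp add: Y_def)
    then show ?thesis by (intro bexI[of _ 0]) auto
  next
    case False
    have bdd: "bdd_below (norm ` Y t)" by (intro bdd_belowI[of _ 0]) auto
    have "Inf (norm ` Y t) < Inf (norm ` Y t) + t\<^sup>2" using False by simp
    then obtain y where y: "y \<in> Y t" "norm y < Inf (norm ` Y t) + t\<^sup>2"
      using cInf_lessD[of "norm ` Y t"] ne by blast
    have "norm y \<le> norm y' + t\<^sup>2" if "y' \<in> Y t" for y'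
      using y(2) cInf_lower[OF _ bdd, of "norm y'"] that by auto
    then show ?thesis using y(1) by blast
  qed
  define y where "y t = (SOME y. y \<in> Y t \<and> (\<forall>y'\<in>Y t. norm y \<le> norm y' + t\<^sup>2))" for t
  have y: "y t \<in> Y t \<and> (\<forall>y'\<in>Y t. norm (y t) \<le> norm y' + t\<^sup>2)" if "Y t \<noteq> {}" for t
    unfolding y_def by (rule someI_ex) (use pick[OF that] in blast)
  have y0: "y 0 = 0"
  proof -
    have "0 \<in> Y 0" using a G0 subspace_0[OF W] linear_0[OF R(1)] by (simp add: Y_def)
    then show ?thesis using y[of 0] by force
  qed
  define c where "c t = a + t *\<^sub>R v + R (y t)" for t
  show ?thesis
  proof (rule that)
    show c0: "c 0 = a" using y0 linear_0[OF R(1)] by (simp add: c_def)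
    obtain \<delta> where \<delta>: "\<delta> > 0" "\<And>t. \<bar>t\<bar> < \<delta> \<Longrightarrow> (\<exists>y\<in>Y t. norm y \<le> 1 * \<bar>t\<bar>)"
      using small[of 1] by auto
    have "c t \<in> N \<and> G (c t) = 0" if "\<bar>t\<bar> < \<delta>" for t
      using y[of t] \<delta>(2)[OF that] by (auto simp: c_def Y_def)
    then show "\<forall>\<^sub>F t in nhds 0. c t \<in> N \<and> G (c t) = 0"
      using \<delta>(1) unfolding eventually_nhds_metric by (auto simp: dist_real_def)
    show "(c has_vector_derivative v) (at 0)"
      unfolding has_vector_derivative_def has_derivative_at_alt
    proof (intro conjI allI impI)
      show "bounded_linear (\<lambda>x. x *\<^sub>R v)" by (rule bounded_linear_scaleR_left)
      fix e :: real assume e: "e > 0"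
      define e' where "e' = e / (2 * K)"
      have e': "e' > 0" using e K by (simp add: e'_def)
      obtain d where d: "d > 0" "\<And>t. \<bar>t\<bar> < d \<Longrightarrow> \<exists>y\<in>Y t. norm y \<le> e' * \<bar>t\<bar>"
        using small[OF e'] by auto
      have "norm (c t - c 0 - (t - 0) *\<^sub>R v) \<le> e * norm (t - 0)" if t: "norm (t - 0) < min d e'" for t
      proof -
        obtain y' where y': "y' \<in> Y t" "norm y' \<le> e' * \<bar>t\<bar>" using d(2)[of t] t by auto
        have "Y t \<noteq> {}" using y'(1) by blast
        then have "norm (y t) \<le> norm y' + t\<^sup>2" using y[of t] y'(1) by blast
        moreover have "\<bar>t\<bar> \<le> e'" using t by simp
        then have "\<bar>t\<bar> * \<bar>t\<bar> \<le> e' * \<bar>t\<bar>" by (rule mult_right_mono) (rule abs_ge_zero)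
        then have "t\<^sup>2 \<le> e' * \<bar>t\<bar>" by (simp only: abs_mult_self_eq power2_eq_square)
        ultimately have "norm (y t) \<le> 2 * e' * \<bar>t\<bar>" using y'(2) by linarith
        then have "norm (y t) * K \<le> (2 * e' * \<bar>t\<bar>) * K" using K(1) by (simp add: mult_right_mono)
        also have "\<dots> = e * \<bar>t\<bar>" using K(1) by (simp add: e'_def)
        finally have "norm (R (y t)) \<le> e * \<bar>t\<bar>" using K(2)[of "y t"] by linarith
        then show ?thesis unfolding c0 by (simp add: c_def)
      qed
      then show "\<exists>d>0. \<forall>t. norm (t - 0) < d \<longrightarrow> norm (c t - c 0 - (t - 0) *\<^sub>R v) \<le> e * norm (t - 0)"
        using d(1) e' by (intro exI[of _ "min d e'"]) auto
    qed
  qed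
qed

text \<open>
  Let \<open>R\<close> be a right inverse at \<open>a\<close>.  The maps \<open>J\<^sub>x = 1 - R D\<^sub>a + R D\<^sub>x\<close> are close to the identity \<open>J\<^sub>a\<close>, hence invertible,
  and \<open>D\<^sub>a J\<^sub>x = D\<^sub>x\<close>.  Therefore \<open>J\<^sub>x\<inverse> R\<close> is a right inverse of \<open>D\<^sub>x\<close>, and \<open>J\<^sub>x\<close> maps the kernel of \<open>D\<^sub>x\<close> onto that
  of \<open>D\<^sub>a\<close>.
\<close>

lemma continuous_right_inverse:
  fixes D :: "'e::euclidean_space \<Rightarrow> 'e \<Rightarrow> 'w::euclidean_space"
  assumes N: "open N" and lin: "\<And>x. x \<in> N \<Longrightarrow> linear (D x)"
    and cont: "\<And>v. continuous_on N (\<lambda>x. D x v)" and a: "a \<in> N"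
    and DW: "\<And>x. x \<in> N \<Longrightarrow> range (D x) \<subseteq> W" and surj: "W \<subseteq> range (D a)"
  obtains N' Q where "open N'" "a \<in> N'" "N' \<subseteq> N"
    "\<And>x y. x \<in> N' \<Longrightarrow> y \<in> W \<Longrightarrow> D x (Q x y) = y"
    "\<And>T y. T \<subseteq> N' \<Longrightarrow> continuous_on T y \<Longrightarrow> continuous_on T (\<lambda>x. Q x (y x))"
    "\<And>x. x \<in> N' \<Longrightarrow> dim {u. D x u = 0} = dim {u. D a u = 0}"
proof -
  obtain R where R: "linear R" "\<And>y. y \<in> W \<Longrightarrow> D a (R y) = y"
    using linear_exists_right_inverse_on[OF lin[OF a] subspace_UNIV] surj by blast
  have bR: "bounded_linear R" using R(1) by (simp add: linear_conv_bounded_linear)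
  obtain K where K: "K > 0" "\<And>y. norm (R y) \<le> norm y * K"
    using bounded_linear.pos_bounded[OF bR] by blast
  obtain \<delta> where \<delta>: "\<delta> > 0" "ball a \<delta> \<subseteq> N"
      "\<And>x u. x \<in> ball a \<delta> \<Longrightarrow> norm (D x u - D a u) \<le> (1 / (2*K)) * norm u"
    using linear_family_uniformly_close[OF N lin cont a, of "1 / (2*K)"] K(1) by auto
  define J where "J x u = u - R (D a u) + R (D x u)" for x u
  have linJ: "linear (J x)" if "x \<in> N" for x
    unfolding J_def
    by (intro linear_compose_add linear_compose_sub linear_id[unfolded id_def]
        linear_compose[OF lin[OF that] R(1), unfolded o_def] linear_compose[OF lin[OF a] R(1), unfolded o_def])
  have J_low: "norm u \<le> 2 * norm (J x u)" if x: "x \<in> ball a \<delta>" for x u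
  proof -
    have "norm (R (D x u - D a u)) \<le> norm (D x u - D a u) * K" by (rule K(2))
    also have "\<dots> \<le> (1 / (2*K)) * norm u * K" by (rule mult_right_mono[OF \<delta>(3)[OF x]]) (use K in simp)
    also have "\<dots> = norm u / 2" using K(1) by simp
    finally have *: "norm (R (D x u - D a u)) \<le> norm u / 2" .
    have "u = J x u - R (D x u - D a u)" using R(1) by (simp add: J_def linear_diff)
    then have "norm u \<le> norm (J x u) + norm (R (D x u - D a u))" by (metis norm_triangle_ineq4)
    then show ?thesis using * by simp
  qed
  have injJ: "inj (J x)" if x: "x \<in> ball a \<delta>" for x
  proof -
    have "linear (J x)" using linJ x \<delta>(2) by blast
    then show ?thesis using J_low[OF x] unfolding linear_injective_0[OF \<open>linear (J x)\<close>]
      by (metis norm_le_zero_iff mult_zero_right norm_zero)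
  qed
  have surjJ: "J x (inv_into UNIV (J x) w) = w" if x: "x \<in> ball a \<delta>" for x w
  proof -
    have "surj (J x)" using linear_injective_imp_surjective[OF linJ injJ[OF x]] x \<delta>(2) by blast
    then show ?thesis by (rule surj_f_inv_f)
  qed
  have DaJ: "D a (J x u) = D x u" if "x \<in> N" for x u
  proof -
    have "D a u \<in> W" "D x u \<in> W" using DW that a by blast+
    then show ?thesis using R(2) lin[OF a] by (simp add: J_def linear_add linear_diff)
  qed
  define Q where "Q x y = inv_into UNIV (J x) (R y)" for x y
  show ?thesis
  proof (rule that[of "ball a \<delta>" Q])
    show "D x (Q x y) = y" if x: "x \<in> ball a \<delta>" and y: "y \<in> W" for x y
      using DaJ[of x "Q x y"] surjJ[OF x, of "R y"] x \<delta>(2) R(2)[OF y] unfolding Q_def by auto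
    show "continuous_on T (\<lambda>x. Q x (y x))" if T: "T \<subseteq> ball a \<delta>" and y: "continuous_on T y" for T y
      unfolding continuous_on_def
    proof
      fix x0 assume x0: "x0 \<in> T"
      let ?u = "Q x0 (y x0)"
      have Jeq: "J x (Q x (y x) - ?u) = R (y x) - J x ?u" if "x \<in> T" for x
      proof -
        have x: "x \<in> ball a \<delta>" "x \<in> N" using that T \<delta>(2) by blast+
        then show ?thesis using linear_diff[OF linJ[OF x(2)]] surjJ[OF x(1), of "R (y x)"] by (simp add: Q_def)
      qed
      have cJ: "continuous_on T (\<lambda>x. R (y x) - J x ?u)"
        unfolding J_def
        by (intro continuous_intros bounded_linear.continuous_on[OF bR] y
            continuous_on_subset[OF cont]) (use T \<delta>(2) in auto)
      have "x0 \<in> ball a \<delta>" using x0 T by blast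
      then have "R (y x0) - J x0 ?u = 0" using surjJ[of x0 "R (y x0)"] by (simp add: Q_def)
      then have "((\<lambda>x. R (y x) - J x ?u) \<longlongrightarrow> 0) (at x0 within T)"
        using cJ x0 unfolding continuous_on_def by metis
      then have "((\<lambda>x. 2 * norm (R (y x) - J x ?u)) \<longlongrightarrow> 0) (at x0 within T)"
        by (intro tendsto_mult_right_zero tendsto_norm_zero)
      moreover have "\<forall>\<^sub>F x in at x0 within T. norm (Q x (y x) - ?u) \<le> 2 * norm (R (y x) - J x ?u)"
        unfolding eventually_at_filter
        by (rule always_eventually) (use J_low T in \<open>auto simp flip: Jeq\<close>)
      ultimately have "((\<lambda>x. Q x (y x) - ?u) \<longlongrightarrow> 0) (at x0 within T)"
        by (rule Lim_null_comparison[rotated])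
      then show "((\<lambda>x. Q x (y x)) \<longlongrightarrow> ?u) (at x0 within T)" by (simp add: LIM_zero_iff)
    qed
    show "dim {u. D x u = 0} = dim {u. D a u = 0}" if x: "x \<in> ball a \<delta>" for x
    proof -
      have xN: "x \<in> N" using x \<delta>(2) by blast
      have "J x ` {u. D x u = 0} = {u. D a u = 0}"
      proof (intro equalityI subsetI)
        fix w assume "w \<in> {u. D a u = 0}"
        then have "D x (inv_into UNIV (J x) w) = 0" using DaJ[OF xN, of "inv_into UNIV (J x) w"] surjJ[OF x] by simp
        then show "w \<in> J x ` {u. D x u = 0}" using surjJ[OF x, of w] by (metis (mono_tags) image_eqI mem_Collect_eq)
      qed (use DaJ[OF xN] in auto)
      then show ?thesis
        using dim_image_eq[OF linJ[OF xN], of "{u. D x u = 0}"] inj_on_subset[OF injJ[OF x]] by simp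
    qed
  qed (use \<delta> in auto)
qed

section \<open>Holomorphic maps and nonsingular points\<close>

lemma norm_cvec_scale: "norm (c *s (v::complex^'n)) = cmod c * norm v"
proof -
  have "norm (c *s v) = sqrt (\<Sum>i\<in>UNIV. (cmod c)\<^sup>2 * (norm (v $ i))\<^sup>2)"
    by (simp add: norm_vec_def L2_set_def norm_mult power_mult_distrib)
  also have "\<dots> = cmod c * norm v"
    by (simp add: norm_vec_def L2_set_def real_sqrt_mult flip: sum_distrib_left)
  finally show ?thesis .
qed

lemma bounded_linear_cvec_scale: "bounded_linear (\<lambda>c. c *s (v::complex^'n))"
  by (rule bounded_linear_intro[where K="norm v"])
    (auto simp: Finite_Cartesian_Product.vec_eq_iff algebra_simps norm_cvec_scale)

lemma bounded_linear_cvec_scale_right: "bounded_linear (\<lambda>v::complex^'n. c *s v)"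
  by (rule bounded_linear_intro[where K="cmod c"])
    (auto simp: Finite_Cartesian_Product.vec_eq_iff algebra_simps norm_cvec_scale)

text \<open>
  Directional derivatives are derivatives of holomorphic functions of one variable \<open>\<zeta>\<close>.  By Cauchy's
  inequality, applied to \<open>F (x + \<zeta> v) - F (x\<^sub>0 + \<zeta> v)\<close> on a small circle, they depend continuously on the base point.
\<close>

lemma holomorphic_imp_C1:
  fixes F :: "complex^'n \<Rightarrow> complex^'m"
  assumes hol: "holomorphic_map_on U F"
  obtains D where "C1_on U F D" "\<And>x c v. x \<in> U \<Longrightarrow> D x (c *s v) = c *s D x v"
proof -
  have U: "open U" using hol unfolding holomorphic_map_on_def by blast
  have "\<forall>x\<in>U. \<exists>D. (F has_derivative D) (at x) \<and> (\<forall>c v. D (c *s v) = c *s D v)"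
    using hol unfolding holomorphic_map_on_def by blast
  then obtain D where D: "\<And>x. x \<in> U \<Longrightarrow> (F has_derivative D x) (at x)"
    and Dc: "\<And>x c v. x \<in> U \<Longrightarrow> D x (c *s v) = c *s D x v" by metis
  have contF: "continuous_on U F"
    using has_derivative_continuous_on[of U F D] D has_derivative_at_withinI by blast
  have comp: "((\<lambda>x. D x v $ k) \<longlongrightarrow> D x0 v $ k) (at x0 within U)" if x0: "x0 \<in> U" for v k x0
  proof (rule tendstoI)
    fix e :: real assume e: "e > 0"
    obtain R where R: "R > 0" "cball x0 R \<subseteq> U" using U x0 open_contains_cball by blast
    define r where "r = R / (2 * (norm v + 1))"
    have nv: "norm v + 1 > 0" using norm_ge_zero[of v] by linarith
    have r: "r > 0" using R nv by (simp add: r_def)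
    have rv: "r * norm v \<le> R / 2"
    proof -
      have "r * norm v \<le> r * (norm v + 1)" using r by simp
      also have "\<dots> = R / 2" using nv by (simp add: r_def field_simps)
      finally show ?thesis .
    qed
    have "uniformly_continuous_on (cball x0 R) F"
      by (rule compact_uniformly_continuous[OF continuous_on_subset[OF contF R(2)] compact_cball])
    then obtain d where d: "d > 0"
      "\<And>x y. x \<in> cball x0 R \<Longrightarrow> y \<in> cball x0 R \<Longrightarrow> dist y x < d \<Longrightarrow> dist (F y) (F x) < e * r / 2"
      unfolding uniformly_continuous_on_def using e r by (metis half_gt_zero mult_pos_pos)
    have "dist (D x v $ k) (D x0 v $ k) < e" if x: "dist x x0 < min d (R/2)" for x
    proof -
      have inC: "y + \<zeta> *s v \<in> cball x0 R" if "dist y x0 \<le> R/2" "cmod \<zeta> \<le> r" for y \<zeta>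
      proof -
        have "cmod \<zeta> * norm v \<le> r * norm v" by (rule mult_right_mono) (use that in auto)
        then have "norm (\<zeta> *s v) \<le> R / 2" using rv by (simp add: norm_cvec_scale)
        then have "dist (y + \<zeta> *s v) x0 \<le> R"
          using that(1) norm_triangle_ineq[of "y - x0" "\<zeta> *s v"] by (simp add: dist_norm algebra_simps)
        then show ?thesis by (simp add: dist_commute)
      qed
      define h where "h y \<zeta> = F (y + \<zeta> *s v) $ k" for y \<zeta>
      have h: "(h y has_field_derivative D (y + \<zeta> *s v) v $ k) (at \<zeta>)"
        if "dist y x0 \<le> R/2" "cmod \<zeta> \<le> r" for y \<zeta>
      proof -
        have inU: "y + \<zeta> *s v \<in> U" using inC[OF that] R(2) by blast
        have "((\<lambda>\<zeta>. y + \<zeta> *s v) has_derivative (\<lambda>\<zeta>. \<zeta> *s v)) (at \<zeta>)"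
          by (auto intro!: derivative_eq_intros bounded_linear_imp_has_derivative[OF bounded_linear_cvec_scale])
        from has_derivative_compose[OF this D[OF inU]]
        have "((\<lambda>\<zeta>. F (y + \<zeta> *s v)) has_derivative (\<lambda>\<eta>. D (y + \<zeta> *s v) (\<eta> *s v))) (at \<zeta>)" .
        from bounded_linear.has_derivative[OF bounded_linear_vec_nth this]
        have "(h y has_derivative (\<lambda>\<eta>. D (y + \<zeta> *s v) (\<eta> *s v) $ k)) (at \<zeta>)"
          unfolding h_def .
        moreover have "(\<lambda>\<eta>. D (y + \<zeta> *s v) (\<eta> *s v) $ k) = (*) (D (y + \<zeta> *s v) v $ k)"
          by (simp add: fun_eq_iff Dc[OF inU] mult.commute)
        ultimately show ?thesis
          unfolding has_field_derivative_def by (simp only:)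
      qed
      define g where "g \<zeta> = h x \<zeta> - h x0 \<zeta>" for \<zeta>
      have dx: "dist x x0 \<le> R/2" "dist x0 x0 \<le> R/2" using x R(1) by auto
      have g: "(g has_field_derivative D (x + \<zeta> *s v) v $ k - D (x0 + \<zeta> *s v) v $ k) (at \<zeta>)" if "cmod \<zeta> \<le> r" for \<zeta>
        unfolding g_def by (intro DERIV_diff h dx that)
      have "norm ((deriv ^^ 1) g 0) \<le> fact 1 * (e * r / 2) / r ^ 1"
      proof (rule Cauchy_inequality)
        show "g holomorphic_on ball 0 r"
          using g unfolding holomorphic_on_def field_differentiable_def
          by (meson has_field_derivative_at_within mem_ball_0 less_imp_le)
        show "continuous_on (cball 0 r) g"
          by (rule DERIV_continuous_on[where D="\<lambda>\<zeta>. D (x + \<zeta> *s v) v $ k - D (x0 + \<zeta> *s v) v $ k"])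
            (use g in \<open>auto intro: has_field_derivative_at_within\<close>)
        show "0 < r" by (fact r)
        fix \<zeta> :: complex assume "norm (0 - \<zeta>) = r"
        then have \<zeta>: "cmod \<zeta> \<le> r" by simp
        have "dist (F (x + \<zeta> *s v)) (F (x0 + \<zeta> *s v)) < e * r / 2"
          by (rule d(2)[OF inC[OF dx(2) \<zeta>] inC[OF dx(1) \<zeta>]]) (use x in \<open>simp add: dist_norm\<close>)
        then have "norm (F (x + \<zeta> *s v) - F (x0 + \<zeta> *s v)) < e * r / 2" by (simp add: dist_norm)
        then show "norm (g \<zeta>) \<le> e * r / 2"
          using Finite_Cartesian_Product.norm_nth_le[of "F (x + \<zeta> *s v) - F (x0 + \<zeta> *s v)" k] by (simp add: g_def h_def)
      qed
      moreover have "deriv g 0 = D x v $ k - D x0 v $ k"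
        using DERIV_imp_deriv[OF g[of 0]] r by (simp add: Finite_Cartesian_Product.vec_eq_iff)
      ultimately have "norm (D x v $ k - D x0 v $ k) \<le> e / 2" using r by simp
      then show ?thesis using e by (simp add: dist_norm)
    qed
    then show "\<forall>\<^sub>F x in at x0 within U. dist (D x v $ k) (D x0 v $ k) < e"
      unfolding eventually_at using d(1) R(1) by (intro exI[of _ "min d (R/2)"]) auto
  qed
  have "continuous_on U (\<lambda>x. D x v)" for v
    unfolding continuous_on_def by (auto intro!: vec_tendstoI comp)
  then have "C1_on U F D" unfolding C1_on_def using U D by blast
  then show ?thesis using that Dc by blast
qed

lemma polynomial_C1:
  assumes "polynomial_fun (f :: complex^'n \<Rightarrow> complex)"
  shows "\<exists>D. C1_on UNIV f D \<and> (\<forall>x c v. D x (c *s v) = c * D x v)"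
  using assms
proof induction
  case (1 c)
  then show ?case unfolding C1_on_def by (intro exI[of _ "\<lambda>x v. 0"]) auto
next
  case (2 k)
  then show ?case unfolding C1_on_def
    by (intro exI[of _ "\<lambda>x v. v $ k"])
      (auto intro: bounded_linear_imp_has_derivative bounded_linear_vec_nth)
next
  case (3 f g)
  then obtain D E where "C1_on UNIV f D" "C1_on UNIV g E" and c: "\<And>x c v. D x (c *s v) = c * D x v"
    "\<And>x c v. E x (c *s v) = c * E x v" by blast
  from C1_on_add[OF this(1,2)] show ?case
    by (intro exI[of _ "\<lambda>x v. D x v + E x v"]) (auto simp: c algebra_simps)
next
  case (4 f g)
  then obtain D E where D: "C1_on UNIV f D" and E: "C1_on UNIV g E" and c: "\<And>x c v. D x (c *s v) = c * D x v"
    "\<And>x c v. E x (c *s v) = c * E x v" by blast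
  have "C1_on UNIV (\<lambda>x. f x * g x) (\<lambda>x v. f x * E x v + D x v * g x)"
    unfolding C1_on_def
    by (intro conjI ballI allI has_derivative_mult continuous_intros C1_onD(2)[OF D] C1_onD(2)[OF E]
        C1_onD(3)[OF D] C1_onD(3)[OF E] C1_onD(5)[OF D] C1_onD(5)[OF E]) auto
  then show ?case
    by (intro exI[of _ "\<lambda>x v. f x * E x v + D x v * g x"]) (auto simp: c algebra_simps)
qed

lemma rational_C1:
  fixes g h :: "complex^'n \<Rightarrow> complex"
  assumes "polynomial_fun g" "polynomial_fun h"
  shows "\<exists>D. C1_on {x. h x \<noteq> 0} (\<lambda>x. g x / h x) D \<and> (\<forall>x c v. D x (c *s v) = c * D x v)"
proof -
  obtain D E where D: "C1_on UNIV g D" and E: "C1_on UNIV h E"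
    and c: "\<And>x c v. D x (c *s v) = c * D x v" "\<And>x c v. E x (c *s v) = c * E x v"
    using polynomial_C1[OF assms(1)] polynomial_C1[OF assms(2)] by blast
  note DE = C1_onD(2)[OF D UNIV_I] C1_onD(2)[OF E UNIV_I]
  note co = C1_onD(3,5)[OF D] C1_onD(3,5)[OF E]
  define Q where "Q x v = - g x * (inverse (h x) * E x v * inverse (h x)) + D x v / h x" for x v
  have "C1_on {x. h x \<noteq> 0} (\<lambda>x. g x / h x) Q"
    unfolding C1_on_def
  proof (intro conjI ballI allI)
    show "open {x. h x \<noteq> 0}" by (rule open_Collect_neq) (use co in auto)
    show "((\<lambda>x. g x / h x) has_derivative Q x) (at x)" if "x \<in> {x. h x \<noteq> 0}" for x
      unfolding Q_def by (rule has_derivative_divide[OF DE]) (use that in simp)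
    show "continuous_on {x. h x \<noteq> 0} (\<lambda>x. Q x v)" for v
      unfolding Q_def
      by (intro continuous_intros continuous_on_subset[OF co(1)] continuous_on_subset[OF co(2)]
          continuous_on_subset[OF co(3)] continuous_on_subset[OF co(4)]) auto
  qed
  then show ?thesis by (intro exI[of _ Q]) (auto simp: c Q_def algebra_simps)
qed

text \<open>
  Induction on the number of functionals: subtracting from \<open>\<phi>\<^sub>r\<close> its values on the dual vectors found so far leaves a
  nonzero functional \<open>\<psi>\<close>, and a vector with \<open>\<psi> v \<noteq> 0\<close> can be normalized.
\<close>

lemma dual_family:
  fixes \<phi> :: "nat \<Rightarrow> complex^'n \<Rightarrow> complex"
  assumes add: "\<And>k x y. k < r \<Longrightarrow> \<phi> k (x + y) = \<phi> k x + \<phi> k y"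
    and scale: "\<And>k c x. k < r \<Longrightarrow> \<phi> k (c *s x) = c * \<phi> k x"
    and ind: "\<And>c. (\<forall>v. (\<Sum>k<r. c k * \<phi> k v) = 0) \<Longrightarrow> \<forall>k<r. c k = 0"
  shows "\<exists>e. \<forall>j<r. \<forall>k<r. \<phi> j (e k) = (if j = k then 1 else 0)"
  using assms
proof (induction r)
  case 0
  then show ?case by simp
next
  case (Suc r)
  have "\<exists>e. \<forall>j<r. \<forall>k<r. \<phi> j (e k) = (if j = k then 1 else 0)"
  proof (rule Suc.IH)
    fix c assume h: "\<forall>v. (\<Sum>k<r. c k * \<phi> k v) = 0"
    have "\<forall>k<Suc r. (c(r := 0)) k = 0" by (rule Suc.prems(3)) (use h in simp)
    then show "\<forall>k<r. c k = 0" by (metis fun_upd_other less_Suc_eq less_irrefl)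
  qed (use Suc.prems in auto)
  then obtain e where e: "\<And>j k. j < r \<Longrightarrow> k < r \<Longrightarrow> \<phi> j (e k) = (if j = k then 1 else 0)" by blast
  have lin_sum: "\<phi> j (\<Sum>k\<in>K. f k) = (\<Sum>k\<in>K. \<phi> j (f k))" if j: "j < Suc r" for j and K :: "nat set" and f
  proof -
    have z: "\<phi> j 0 = 0" using Suc.prems(1)[OF j, of 0 0] by simp
    show ?thesis by (induction K rule: infinite_finite_induct) (auto simp: z Suc.prems(1)[OF j])
  qed
  have diff: "\<phi> j (x - y) = \<phi> j x - \<phi> j y" if j: "j < Suc r" for j x y
    using Suc.prems(1)[OF j, of "x - y" y] by simp
  note scale = Suc.prems(2)
  define \<psi> where "\<psi> v = \<phi> r v - (\<Sum>k<r. \<phi> r (e k) * \<phi> k v)" for v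
  have "\<exists>v. \<psi> v \<noteq> 0"
  proof (rule ccontr)
    assume "\<nexists>v. \<psi> v \<noteq> 0"
    then have z: "\<psi> v = 0" for v by blast
    have h: "(\<Sum>k<Suc r. (if k = r then 1 else - \<phi> r (e k)) * \<phi> k v) = 0" for v
    proof -
      have "(\<Sum>k<r. (if k = r then 1 else - \<phi> r (e k)) * \<phi> k v) = - (\<Sum>k<r. \<phi> r (e k) * \<phi> k v)"
        unfolding sum_negf[symmetric] by (rule sum.cong) auto
      then show ?thesis using z[of v] by (simp add: \<psi>_def)
    qed
    have "\<forall>k<Suc r. (if k = r then 1 else - \<phi> r (e k)) = 0"
      by (rule Suc.prems(3)) (rule allI, rule h)
    from this[rule_format, of r] show False by simp
  qed
  then obtain v where v: "\<psi> v \<noteq> 0" by blast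
  define w where "w = inverse (\<psi> v) *s (v - (\<Sum>k<r. \<phi> k v *s e k))"
  have wr: "\<phi> r w = 1"
  proof -
    have "\<phi> r w = inverse (\<psi> v) * \<psi> v"
      by (simp add: w_def scale diff lin_sum \<psi>_def algebra_simps)
    then show ?thesis using v by simp
  qed
  have wj: "\<phi> j w = 0" if j: "j < r" for j
  proof -
    have "(\<Sum>k<r. \<phi> k v * \<phi> j (e k)) = (\<Sum>k<r. if k = j then \<phi> j v else 0)"
      by (rule sum.cong) (use e j in auto)
    then show ?thesis using j by (simp add: w_def scale diff lin_sum)
  qed
  define e' where "e' k = (if k = r then w else e k - \<phi> r (e k) *s w)" for k
  have "\<phi> j (e' k) = (if j = k then 1 else 0)" if "j < Suc r" "k < Suc r" for j k
    using that by (cases "j = r"; cases "k = r") (auto simp: e'_def diff scale wr wj e)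
  then show ?case by blast
qed

lemma C1_on_sum_scale:
  fixes f :: "'k \<Rightarrow> 'e::euclidean_space \<Rightarrow> complex" and e :: "'k \<Rightarrow> complex^'n"
  assumes N: "open N" and K: "finite K" and "\<And>k. k \<in> K \<Longrightarrow> C1_on N (f k) (D k)"
  shows "C1_on N (\<lambda>x. \<Sum>k\<in>K. f k x *s e k) (\<lambda>x v. \<Sum>k\<in>K. D k x v *s e k)"
  using K assms(3)
proof (induction K)
  case empty
  then show ?case using N by (simp add: C1_on_def)
next
  case (insert r K)
  have "C1_on N (\<lambda>x. f r x *s e r) (\<lambda>x v. D r x v *s e r)"
    by (rule C1_on_linear[OF bounded_linear_cvec_scale insert.prems]) simp
  then show ?case using C1_on_add insert by simp
qed

text \<open>
  The equations \<open>f\<^sub>k\<close> are bundled into \<open>G = \<Sum>\<^sub>k f\<^sub>k e\<^sub>k\<close>, where the vectors \<open>e\<^sub>k\<close> are dual to the differentials of the \<open>f\<^sub>k\<close> at \<open>a\<close>.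
  Then the derivative of \<open>G\<close> at \<open>a\<close> is a projection onto the span of the \<open>e\<^sub>k\<close>, where \<open>G\<close> takes its values.
  So the codomain does not depend on the number of equations.
\<close>

lemma nonsingular_point_equations:
  fixes A :: "(complex^'n) set"
  assumes "nonsingular_point A a"
  obtains N G D where "C1_on N G D" "a \<in> N" "\<And>x c v. D x (c *s v) = c *s D x v"
    "\<And>x. x \<in> N \<Longrightarrow> x \<in> A \<longleftrightarrow> G x = (0 :: complex^'n)"
    "\<And>x. D a (G x) = G x" "\<And>x u. D a (D x u) = D x u"
proof -
  obtain h fs where h: "polynomial_fun h" "h a \<noteq> 0" and fs: "\<And>f. f \<in> set fs \<Longrightarrow> polynomial_fun f"
    and A: "\<And>x. h x \<noteq> 0 \<Longrightarrow> (x \<in> A \<longleftrightarrow> (\<forall>f\<in>set fs. f x = 0))"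
    and ind: "\<And>c. (\<forall>v. (\<Sum>k<length fs. c k * frechet_derivative (fs ! k) (at a) v) = 0) \<Longrightarrow>
             (\<forall>k<length fs. c k = 0)"
    using assms unfolding nonsingular_point_def by blast
  define r where "r = length fs"
  have "\<forall>k<r. \<exists>D. C1_on UNIV (fs ! k) D \<and> (\<forall>x c v. D x (c *s v) = c * D x v)"
    unfolding r_def by (intro allI impI polynomial_C1 fs nth_mem)
  then obtain d where d: "\<And>k. k < r \<Longrightarrow> C1_on UNIV (fs ! k) (d k)"
    and dc: "\<And>k x c v. k < r \<Longrightarrow> d k x (c *s v) = c * d k x v" by metis
  have fd: "frechet_derivative (fs ! k) (at a) = d k a" if "k < r" for k
    using frechet_derivative_at[OF C1_onD(2)[OF d[OF that] UNIV_I]] by simp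
  have "\<exists>e. \<forall>j<r. \<forall>k<r. d j a (e k) = (if j = k then 1 else 0)"
  proof (rule dual_family)
    fix c assume c: "\<forall>v. (\<Sum>k<r. c k * d k a v) = 0"
    have "\<forall>v. (\<Sum>k<length fs. c k * frechet_derivative (fs ! k) (at a) v) = 0"
      using c fd by (simp add: r_def)
    then show "\<forall>k<r. c k = 0" unfolding r_def by (rule ind)
  qed (use dc linear_add[OF C1_onD(4)[OF d UNIV_I]] in auto)
  then obtain e where e: "\<And>j k. j < r \<Longrightarrow> k < r \<Longrightarrow> d j a (e k) = (if j = k then 1 else 0)" by blast
  define G where "G x = (\<Sum>k<r. (fs ! k) x *s e k)" for x
  define D where "D x v = (\<Sum>k<r. d k x v *s e k)" for x v
  define N where "N = {x. h x \<noteq> 0}"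
  have GD: "C1_on UNIV G D" unfolding G_def D_def by (rule C1_on_sum_scale) (use d in auto)
  have d_sum: "d j a (\<Sum>k<r. c k *s e k) = c j" if j: "j < r" for j c
  proof -
    have "d j a (\<Sum>k<r. c k *s e k) = (\<Sum>k<r. if k = j then c j else 0)"
      unfolding linear_sum[OF C1_onD(4)[OF d[OF j] UNIV_I]]
      by (rule sum.cong) (use j e dc in auto)
    then show ?thesis using j by simp
  qed
  have Da: "D a (\<Sum>k<r. c k *s e k) = (\<Sum>k<r. c k *s e k)" for c
    unfolding D_def by (rule sum.cong) (auto simp: d_sum)
  show ?thesis
  proof (rule that[of N G D])
    obtain E where "C1_on UNIV h E" using polynomial_C1[OF h(1)] by blast
    then have "open N" unfolding N_def by (intro open_Collect_neq) (auto intro: C1_onD(5))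
    then show "C1_on N G D" using C1_on_subset[OF GD] by simp
    show "a \<in> N" using h(2) by (simp add: N_def)
    show "D x (c *s v) = c *s D x v" for x c v
      unfolding D_def by (simp add: dc vec.scale_sum_right)
    show "D a (G x) = G x" for x unfolding G_def by (rule Da)
    show "D a (D x u) = D x u" for x u unfolding D_def[of x] by (rule Da)
    show "x \<in> A \<longleftrightarrow> G x = 0" if x: "x \<in> N" for x
    proof -
      have "G x = 0 \<longleftrightarrow> (\<forall>k<r. (fs ! k) x = 0)"
      proof
        assume "G x = 0"
        then show "\<forall>k<r. (fs ! k) x = 0"
          using d_sum[of _ "\<lambda>k. (fs ! k) x"] linear_0[OF C1_onD(4)[OF d UNIV_I]]
          unfolding G_def by metis
      qed (simp add: G_def)
      also have "\<dots> \<longleftrightarrow> (\<forall>f\<in>set fs. f x = 0)" unfolding r_def by (rule all_set_conv_all_nth[symmetric])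
      finally show ?thesis using A x unfolding N_def by simp
    qed
  qed
qed

section \<open>Transition maps and tangent spaces in a chart\<close>

lemma zariski_closed_imp_closed:
  assumes "zariski_closed (C :: (complex^'n) set)"
  shows "closed C"
proof -
  obtain F where F: "\<forall>f\<in>F. polynomial_fun f" "C = {x. \<forall>f\<in>F. f x = 0}"
    using assms unfolding zariski_closed_def by blast
  have "closed {x. f x = 0}" if f: "f \<in> F" for f
  proof -
    obtain D where "C1_on UNIV f D" using polynomial_C1[OF bspec[OF F(1) f]] by blast
    from C1_onD(5)[OF this] show ?thesis by (rule closed_Collect_eq) (rule continuous_on_const)
  qed
  then have "closed (\<Inter>f\<in>F. {x. f x = 0})" by blast
  moreover have "C = (\<Inter>f\<in>F. {x. f x = 0})" using F(2) by blast
  ultimately show ?thesis by simp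
qed

lemma transition_map:
  fixes X :: "('a, 'n::finite, 'i::finite) variety"
  assumes X: "algebraic_variety X" and p: "p \<in> patch X i" "p \<in> patch X j"
  obtains N \<Theta> D where "C1_on N \<Theta> D" "coord X i p \<in> N" "\<And>x c v. D x (c *s v) = c *s D x v"
    "\<And>q. q \<in> patch X i \<Longrightarrow> coord X i q \<in> N \<Longrightarrow> q \<in> patch X j \<and> coord X j q = \<Theta> (coord X i q)"
proof -
  let ?A = "coord X i ` (patch X i \<inter> patch X j)"
  let ?t = "\<lambda>z. coord X j (inv_into (patch X i) (coord X i) z)"
  have inj: "inj_on (coord X i) (patch X i)" using X unfolding algebraic_variety_def by blast
  obtain C where C: "zariski_closed C" "?A = coord X i ` patch X i - C"
    using X unfolding algebraic_variety_def by blast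
  have reg: "\<forall>k. regular_on ?A (\<lambda>z. ?t z $ k)" using X unfolding algebraic_variety_def by blast
  have a: "coord X i p \<in> ?A" using p by blast
  have "\<forall>k. \<exists>g h. polynomial_fun g \<and> polynomial_fun h \<and> h (coord X i p) \<noteq> 0 \<and>
      (\<forall>x\<in>?A. h x \<noteq> 0 \<longrightarrow> ?t x $ k = g x / h x)"
    using reg a unfolding regular_on_def by (intro allI) (drule spec, erule bspec)
  then obtain g h where gh': "\<forall>k. polynomial_fun (g k) \<and> polynomial_fun (h k) \<and> h k (coord X i p) \<noteq> 0 \<and>
      (\<forall>x\<in>?A. h k x \<noteq> 0 \<longrightarrow> ?t x $ k = g k x / h k x)"
    unfolding choice_iff by (elim exE)
  have gh: "polynomial_fun (g k)" "polynomial_fun (h k)" "h k (coord X i p) \<noteq> 0"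
      "x \<in> ?A \<Longrightarrow> h k x \<noteq> 0 \<Longrightarrow> ?t x $ k = g k x / h k x" for k x
    using spec[OF gh', of k] by auto
  have "\<forall>k. \<exists>D. C1_on {x. h k x \<noteq> 0} (\<lambda>x. g k x / h k x) D \<and> (\<forall>x c v. D x (c *s v) = c * D x v)"
    using rational_C1[OF gh(1,2)] by blast
  then obtain d where d': "\<forall>k. C1_on {x. h k x \<noteq> 0} (\<lambda>x. g k x / h k x) (d k) \<and> (\<forall>x c v. d k x (c *s v) = c * d k x v)"
    unfolding choice_iff by (elim exE)
  have d: "C1_on {x. h k x \<noteq> 0} (\<lambda>x. g k x / h k x) (d k)"
    and dc: "d k x (c *s v) = c * d k x v" for k x c v using spec[OF d', of k] by auto
  define N where "N = (\<Inter>k. {x. h k x \<noteq> 0}) - C"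
  have N: "open N"
    unfolding N_def by (intro open_Diff open_INT ballI zariski_closed_imp_closed C(1) C1_onD(1)[OF d]) auto
  define \<Theta> where "\<Theta> x = (\<Sum>k\<in>UNIV. (g k x / h k x) *s (axis k 1 :: complex^'n))" for x
  define D where "D x v = (\<Sum>k\<in>UNIV. d k x v *s (axis k 1 :: complex^'n))" for x v
  have nth: "(\<Sum>k\<in>UNIV. c k *s (axis k 1 :: complex^'n)) $ m = c m" for c m
    by (simp add: axis_def if_distrib[of "\<lambda>x. _ * x"] cong: if_cong)
  have \<Theta>_nth: "\<Theta> x $ m = g m x / h m x" for x m unfolding \<Theta>_def by (rule nth)
  show ?thesis
  proof (rule that)
    show "C1_on N \<Theta> D" unfolding \<Theta>_def D_def
      by (rule C1_on_sum_scale[OF N finite], rule C1_on_subset[OF d N]) (auto simp: N_def)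
    show "coord X i p \<in> N" using gh(3) a C(2) by (auto simp: N_def)
    show "D x (c *s v) = c *s D x v" for x c v
      unfolding D_def by (simp add: dc vec.scale_sum_right)
    show "q \<in> patch X j \<and> coord X j q = \<Theta> (coord X i q)" if q: "q \<in> patch X i" "coord X i q \<in> N" for q
    proof -
      have qA: "coord X i q \<in> ?A" using q C(2) unfolding N_def by blast
      then obtain q' where "q' \<in> patch X i" "q' \<in> patch X j" "coord X i q = coord X i q'" by blast
      then have "q \<in> patch X j" using inj q(1) by (metis inj_onD)
      moreover have "coord X j q $ k = \<Theta> (coord X i q) $ k" for k
        using gh(4)[OF qA, of k] q inj by (simp add: \<Theta>_nth N_def)
      ultimately show ?thesis by (simp add: Finite_Cartesian_Product.vec_eq_iff)
    qed
  qed
qed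

text \<open>
  The counterpart of \<open>tangent_space\<close> inside the affine space of a single chart.
\<close>

definition chart_tangent :: "'e::euclidean_space set \<Rightarrow> 'e \<Rightarrow> 'e set" where
  "chart_tangent A a = {w. \<exists>c :: real \<Rightarrow> 'e. c 0 = a \<and> (\<forall>\<^sub>F t in nhds 0. c t \<in> A) \<and>
     (c has_vector_derivative w) (at 0)}"

lemma vderiv_eventually_eq:
  assumes "(f has_vector_derivative v) (at 0)" "\<forall>\<^sub>F t in nhds (0::real). f t = g t"
  shows "(g has_vector_derivative v) (at 0)"
proof -
  have "f 0 = g 0" using assms(2) by (rule eventually_nhds_x_imp_x)
  then show ?thesis
    using assms has_vector_derivative_cong_ev[where S=UNIV and x=0 and f=f and g=g and f'=v] by simp
qed

lemma vderiv_eventually_in: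
  fixes c :: "real \<Rightarrow> 'e::real_normed_vector"
  assumes "(c has_vector_derivative v) (at 0)" "open N" "c 0 \<in> N"
  shows "\<forall>\<^sub>F t in nhds 0. c t \<in> N"
proof -
  have "isCont c 0" using assms(1) by (rule has_vector_derivative_continuous)
  then have "(c \<longlongrightarrow> c 0) (nhds 0)" using tendsto_at_iff_tendsto_nhds[of c 0] by (simp add: isCont_def)
  then show ?thesis using assms(2,3) by (rule topological_tendstoD)
qed

lemma vderiv_C1_compose:
  assumes "(c has_vector_derivative v) (at 0)" "C1_on N G D" "c 0 \<in> N"
  shows "((\<lambda>t. G (c t)) has_vector_derivative D (c 0) v) (at 0)"
proof -
  have "((\<lambda>t. G (c t)) has_derivative (\<lambda>t. D (c 0) (t *\<^sub>R v))) (at 0)"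
    using has_derivative_compose[OF assms(1)[unfolded has_vector_derivative_def] C1_onD(2)[OF assms(2,3)]] .
  then show ?thesis
    unfolding has_vector_derivative_def using linear_scale[OF C1_onD(4)[OF assms(2,3)]] by simp
qed

lemma chart_tangent_mono: "A \<subseteq> B \<Longrightarrow> chart_tangent A a \<subseteq> chart_tangent B a"
  unfolding chart_tangent_def by (auto elim!: eventually_mono)

lemma chart_tangent_zero_set:
  assumes G: "C1_on N G D" and x: "x \<in> N" "x \<in> A" and A: "\<And>y. y \<in> N \<Longrightarrow> y \<in> A \<longleftrightarrow> G y = 0"
    and W: "subspace W" "\<And>y. y \<in> N \<Longrightarrow> G y \<in> W" "range (D x) = W"
  shows "chart_tangent A x = {w. D x w = 0}"
proof (intro equalityI subsetI)
  fix w assume "w \<in> chart_tangent A x"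
  then obtain c where c: "c 0 = x" "\<forall>\<^sub>F t in nhds 0. c t \<in> A" "(c has_vector_derivative w) (at 0)"
    unfolding chart_tangent_def by blast
  have "\<forall>\<^sub>F t in nhds 0. c t \<in> N" using vderiv_eventually_in[OF c(3) C1_onD(1)[OF G]] c(1) x by simp
  with c(2) have "\<forall>\<^sub>F t in nhds 0. G (c t) = 0" by eventually_elim (use A in blast)
  from vderiv_eventually_eq[OF vderiv_C1_compose[OF c(3) G] this]
  have "((\<lambda>t. 0) has_vector_derivative D x w) (at 0)" using c(1) x by simp
  then have "D x w = 0" using vector_derivative_unique_at has_vector_derivative_const by blast
  then show "w \<in> {w. D x w = 0}" by simp
next
  fix w assume "w \<in> {w. D x w = 0}"
  then have w: "D x w = 0" by simp
  have G0: "G x = 0" using A x by blast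
  obtain c where c: "c 0 = x" "\<forall>\<^sub>F t in nhds 0. c t \<in> N \<and> G (c t) = 0" "(c has_vector_derivative w) (at 0)"
    using curve_in_zero_set[OF C1_onD(1)[OF G] x(1) G0 C1_onD(5)[OF G] C1_onD(2)[OF G x(1)] W w] by blast
  have "\<forall>\<^sub>F t in nhds 0. c t \<in> A" using c(2) by eventually_elim (use A in blast)
  then show "w \<in> chart_tangent A x" using c unfolding chart_tangent_def by blast
qed

text \<open>
  A tangent vector is determined by any one of its components, through the differentials of the
  transition maps.
\<close>

lemma tangent_component:
  fixes X :: "('a, 'n::finite, 'i::finite) variety"
  assumes \<Theta>: "C1_on N \<Theta> D" and tr: "\<And>q. q \<in> patch X i \<Longrightarrow> coord X i q \<in> N \<Longrightarrow> q \<in> patch X j \<and> coord X j q = \<Theta> (coord X i q)"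
    and q: "q \<in> patch X i" "coord X i q \<in> N" and v: "v \<in> tangent_space X M q"
  shows "v $ j = D (coord X i q) (v $ i)"
proof -
  obtain \<gamma> where \<gamma>: "\<gamma> 0 = q" "\<And>k. q \<in> patch X k \<Longrightarrow> (\<forall>\<^sub>F t in nhds 0. \<gamma> t \<in> patch X k) \<and>
                  ((\<lambda>t. coord X k (\<gamma> t)) has_vector_derivative v $ k) (at 0)"
    using v unfolding tangent_space_def by (auto split: if_splits)
  note i = \<gamma>(2)[OF q(1)] and j = \<gamma>(2)[OF conjunct1[OF tr[OF q]]]
  have "\<forall>\<^sub>F t in nhds 0. coord X i (\<gamma> t) \<in> N"
    by (rule vderiv_eventually_in[OF conjunct2[OF i] C1_onD(1)[OF \<Theta>]]) (use \<gamma>(1) q in simp)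
  with conjunct1[OF i] have "\<forall>\<^sub>F t in nhds 0. \<Theta> (coord X i (\<gamma> t)) = coord X j (\<gamma> t)"
    by eventually_elim (use tr in simp)
  from vderiv_eventually_eq[OF vderiv_C1_compose[OF conjunct2[OF i] \<Theta>] this]
  have "((\<lambda>t. coord X j (\<gamma> t)) has_vector_derivative D (coord X i q) (v $ i)) (at 0)"
    using \<gamma>(1) q by simp
  then show ?thesis using vector_derivative_unique_at conjunct2[OF j] by blast
qed

lemma tangent_lift:
  fixes X :: "('a, 'n::finite, 'i::finite) variety"
  assumes X: "algebraic_variety X" and p: "p \<in> patch X i"
  obtains l :: "complex^'n \<Rightarrow> complex^'n^'i" where "linear l" "\<And>c w. l (c *s w) = cscale c (l w)"
    "\<And>w. l w $ i = w"
    "\<And>M. p \<in> M \<Longrightarrow> tangent_space X M p = l ` chart_tangent (coord X i ` (M \<inter> patch X i)) (coord X i p)"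
proof -
  have inj: "inj_on (coord X i) (patch X i)" using X unfolding algebraic_variety_def by blast
  have "\<exists>N \<Theta> D. p \<in> patch X j \<longrightarrow> C1_on N \<Theta> D \<and> coord X i p \<in> N \<and> (\<forall>x c v. D x (c *s v) = c *s D x v) \<and>
    (\<forall>q. q \<in> patch X i \<and> coord X i q \<in> N \<longrightarrow> q \<in> patch X j \<and> coord X j q = \<Theta> (coord X i q))" for j
    using transition_map[OF X p, of j] by metis
  then obtain N \<Theta> D where tr: "\<And>j. p \<in> patch X j \<Longrightarrow> C1_on (N j) (\<Theta> j) (D j)"
    "\<And>j. p \<in> patch X j \<Longrightarrow> coord X i p \<in> N j"
    "\<And>j x c v. p \<in> patch X j \<Longrightarrow> D j x (c *s v) = c *s D j x v"
    "\<And>j q. p \<in> patch X j \<Longrightarrow> q \<in> patch X i \<Longrightarrow> coord X i q \<in> N j \<Longrightarrow> q \<in> patch X j \<and> coord X j q = \<Theta> j (coord X i q)"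
    by metis
  define a where "a = coord X i p"
  define l where "l w = (\<chi> j. if j = i then w else if p \<in> patch X j then D j a w else 0)" for w
  have lin: "linear (D j a)" if "p \<in> patch X j" for j
    using C1_onD(4)[OF tr(1)[OF that] tr(2)[OF that]] by (simp add: a_def)
  show ?thesis
  proof (rule that[of l])
    show "linear l"
      by (rule linearI) (auto simp: l_def Finite_Cartesian_Product.vec_eq_iff linear_add[OF lin] linear_scale[OF lin])
    show "l (c *s w) = cscale c (l w)" for c w
      by (auto simp: l_def Finite_Cartesian_Product.vec_eq_iff cscale_def tr(3))
    show "l w $ i = w" for w by (simp add: l_def)
    show "tangent_space X M p = l ` chart_tangent (coord X i ` (M \<inter> patch X i)) (coord X i p)" if pM: "p \<in> M" for M
    proof (intro equalityI subsetI)
      fix v assume v: "v \<in> tangent_space X M p"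
      then obtain \<gamma> where \<gamma>: "\<gamma> 0 = p" "\<forall>\<^sub>F t in nhds 0. \<gamma> t \<in> M"
         "\<And>k. if p \<in> patch X k then (\<forall>\<^sub>F t in nhds 0. \<gamma> t \<in> patch X k) \<and>
                  ((\<lambda>t. coord X k (\<gamma> t)) has_vector_derivative v $ k) (at 0) else v $ k = 0"
        unfolding tangent_space_def by blast
      have i: "\<forall>\<^sub>F t in nhds 0. \<gamma> t \<in> patch X i" "((\<lambda>t. coord X i (\<gamma> t)) has_vector_derivative v $ i) (at 0)"
        using \<gamma>(3)[of i] p by auto
      have "\<forall>\<^sub>F t in nhds 0. coord X i (\<gamma> t) \<in> coord X i ` (M \<inter> patch X i)"
        using \<gamma>(2) i(1) by eventually_elim blast
      then have "v $ i \<in> chart_tangent (coord X i ` (M \<inter> patch X i)) (coord X i p)"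
        unfolding chart_tangent_def using i(2) \<gamma>(1)
        by (intro CollectI exI[of _ "\<lambda>t. coord X i (\<gamma> t)"]) simp
      moreover have "v = l (v $ i)"
      proof (rule Finite_Cartesian_Product.vec_eq_iff[THEN iffD2, rule_format])
        fix j show "v $ j = l (v $ i) $ j"
        proof (cases "j \<noteq> i \<and> p \<in> patch X j")
          case True
          then have "v $ j = D j (coord X i p) (v $ i)"
            by (intro tangent_component[OF tr(1) tr(4) p tr(2) v]) auto
          then show ?thesis using True by (simp add: l_def a_def)
        next
          case False
          then show ?thesis using \<gamma>(3)[of j] by (auto simp: l_def)
        qed
      qed
      ultimately show "v \<in> l ` chart_tangent (coord X i ` (M \<inter> patch X i)) (coord X i p)" by blast
    next
      fix v assume "v \<in> l ` chart_tangent (coord X i ` (M \<inter> patch X i)) (coord X i p)"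
      then obtain w c where v: "v = l w" and c: "c 0 = coord X i p"
        "\<forall>\<^sub>F t in nhds 0. c t \<in> coord X i ` (M \<inter> patch X i)" "(c has_vector_derivative w) (at 0)"
        unfolding chart_tangent_def by blast
      define \<gamma> where "\<gamma> t = inv_into (patch X i) (coord X i) (c t)" for t
      have ev: "\<forall>\<^sub>F t in nhds 0. \<gamma> t \<in> M \<and> \<gamma> t \<in> patch X i \<and> coord X i (\<gamma> t) = c t"
        using c(2) by eventually_elim (use inj in \<open>auto simp: \<gamma>_def\<close>)
      have \<gamma>0: "\<gamma> 0 = p" unfolding \<gamma>_def c(1) using inj p by simp
      have "if p \<in> patch X j then (\<forall>\<^sub>F t in nhds 0. \<gamma> t \<in> patch X j) \<and>
                  ((\<lambda>t. coord X j (\<gamma> t)) has_vector_derivative v $ j) (at 0) else v $ j = 0" for j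
      proof (cases "j = i")
        case True
        have "\<forall>\<^sub>F t in nhds 0. c t = coord X i (\<gamma> t)" using ev by eventually_elim simp
        from vderiv_eventually_eq[OF c(3) this] show ?thesis
          using True p ev by (auto simp: v l_def elim: eventually_mono)
      next
        case False
        show ?thesis
        proof (cases "p \<in> patch X j")
          case True
          have N: "\<forall>\<^sub>F t in nhds 0. c t \<in> N j"
            by (rule vderiv_eventually_in[OF c(3) C1_onD(1)[OF tr(1)[OF True]]]) (use tr(2)[OF True] c(1) in simp)
          have e2: "\<forall>\<^sub>F t in nhds 0. \<gamma> t \<in> patch X j \<and> \<Theta> j (c t) = coord X j (\<gamma> t)"
            using ev N by eventually_elim (use tr(4)[OF True] in metis)
          then have "\<forall>\<^sub>F t in nhds 0. \<Theta> j (c t) = coord X j (\<gamma> t)" by eventually_elim simp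
          from vderiv_eventually_eq[OF vderiv_C1_compose[OF c(3) tr(1)[OF True]] this]
          have "((\<lambda>t. coord X j (\<gamma> t)) has_vector_derivative D j a w) (at 0)"
            using tr(2)[OF True] c(1) by (simp add: a_def)
          then show ?thesis using e2 True False by (auto simp: v l_def elim: eventually_mono)
        qed (use False in \<open>simp add: v l_def\<close>)
      qed
      moreover have "\<forall>\<^sub>F t in nhds 0. \<gamma> t \<in> M" using ev by eventually_elim simp
      ultimately show "v \<in> tangent_space X M p"
        using \<gamma>0 unfolding tangent_space_def by blast
    qed
  qed
qed

section \<open>The fixed set of an involution\<close>

text \<open>
  Let \<open>L\<close> be the differential of the involution \<open>s\<close> of \<open>Z\<close> at its fixed point \<open>a\<close>, and \<open>\<pi>\<close> the projection onto the
  tangent space \<open>T\<close> of \<open>Z\<close>.  The average \<open>\<Phi>\<close> of the local coordinate \<open>\<pi> (x - a)\<close> satisfies \<open>\<Phi> (s x) = L (\<Phi> x)\<close> on \<open>Z\<close>, and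
  \<open>(f, \<Phi>)\<close> is injective near \<open>a\<close>.  Hence a point \<open>x\<close> of \<open>Z\<close> near \<open>a\<close> is fixed exactly if \<open>\<rho> x = \<Phi> x - L (\<Phi> x)\<close> vanishes.
\<close>

lemma involution_fixed_set:
  fixes f s :: "'e::euclidean_space \<Rightarrow> 'e"
  assumes f: "C1_on N f Df" and a: "a \<in> N" and Z: "\<And>x. x \<in> N \<Longrightarrow> x \<in> Z \<longleftrightarrow> f x = 0" and aZ: "a \<in> Z"
    and Q: "\<And>x. Df a (f x) = f x" "\<And>x u. Df a (Df x u) = Df x u"
    and s: "C1_on U s Ds" and aU: "a \<in> U" and sa: "s a = a"
    and sZ: "\<And>x. x \<in> Z \<Longrightarrow> x \<in> U \<Longrightarrow> s x \<in> Z"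
    and ss: "\<And>x. x \<in> Z \<Longrightarrow> x \<in> U \<Longrightarrow> s x \<in> U \<Longrightarrow> s (s x) = x"
  defines "T \<equiv> {w. Df a w = 0}"
  obtains M \<rho> D\<rho> where "C1_on M \<rho> D\<rho>" "a \<in> M" "M \<subseteq> N" "M \<subseteq> U"
    "\<And>x. x \<in> M \<Longrightarrow> x \<in> Z \<Longrightarrow> s x = x \<longleftrightarrow> \<rho> x = 0"
    "\<And>w. w \<in> T \<Longrightarrow> D\<rho> a w = 2 *\<^sub>R (w - Ds a w)"
    "\<And>x. \<rho> x \<in> (\<lambda>w. w - Ds a w) ` T" "\<And>x u. x \<in> M \<Longrightarrow> D\<rho> x u \<in> (\<lambda>w. w - Ds a w) ` T"
proof -
  define L where "L = Ds a"
  have lQ: "linear (Df a)" using C1_onD(4)[OF f a] .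
  have lL: "linear L" using C1_onD(4)[OF s aU] by (simp add: L_def)
  have bL: "bounded_linear L" using lL by (simp add: linear_conv_bounded_linear)
  have sT: "subspace T" unfolding T_def by (rule linear_subspace_kernel[OF lQ])
  have CT: "chart_tangent Z a = T"
    unfolding T_def
  proof (rule chart_tangent_zero_set[OF f a aZ Z])
    show "subspace (range (Df a))" by (rule linear_subspace_image[OF lQ subspace_UNIV])
    show "f y \<in> range (Df a)" for y using Q(1)[of y] by (metis rangeI)
  qed simp_all
  \<comment> \<open>Applying \<open>s\<close> to curves in \<open>Z\<close> shows that \<open>L\<close> is an involution of \<open>T\<close>, though not of the ambient space.\<close>
  have LT: "L w \<in> T \<and> L (L w) = w" if w: "w \<in> T" for w
  proof -
    obtain c where c: "c 0 = a" "\<forall>\<^sub>F t in nhds 0. c t \<in> Z" "(c has_vector_derivative w) (at 0)"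
      using w unfolding CT[symmetric] chart_tangent_def by blast
    have cU: "\<forall>\<^sub>F t in nhds 0. c t \<in> U" using vderiv_eventually_in[OF c(3) C1_onD(1)[OF s]] c(1) aU by simp
    have sc: "((\<lambda>t. s (c t)) has_vector_derivative L w) (at 0)"
      using vderiv_C1_compose[OF c(3) s] c(1) aU by (simp add: L_def)
    have "\<forall>\<^sub>F t in nhds 0. s (c t) \<in> Z" using c(2) cU by eventually_elim (rule sZ)
    then have 1: "L w \<in> T" unfolding CT[symmetric] chart_tangent_def using sc c(1) sa by auto
    have scU: "\<forall>\<^sub>F t in nhds 0. s (c t) \<in> U"
      using vderiv_eventually_in[OF sc C1_onD(1)[OF s]] c(1) sa aU by simp
    have "\<forall>\<^sub>F t in nhds 0. s (s (c t)) = c t" using c(2) cU scU by eventually_elim (rule ss)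
    from vderiv_eventually_eq[OF vderiv_C1_compose[OF sc s] this]
    have "(c has_vector_derivative L (L w)) (at 0)" using c(1) sa aU by (simp add: L_def)
    then show ?thesis using 1 c(3) vector_derivative_unique_at by blast
  qed
  define \<pi> where "\<pi> x = x - Df a x" for x
  have b\<pi>: "bounded_linear \<pi>"
    unfolding \<pi>_def using lQ
    by (simp add: linear_conv_bounded_linear bounded_linear_sub bounded_linear_ident)
  have l\<pi>: "linear \<pi>" using b\<pi> by (simp add: linear_conv_bounded_linear)
  have \<pi>T: "\<pi> x \<in> T" for x
    unfolding T_def \<pi>_def using Q(2)[of a x] by (simp add: linear_diff[OF lQ])
  have \<pi>id: "\<pi> x = x" if "x \<in> T" for x using that by (simp add: T_def \<pi>_def)
  define \<Phi> where "\<Phi> x = \<pi> (x - a) + L (\<pi> (s x - a))" for x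
  define D\<Phi> where "D\<Phi> x v = \<pi> v + L (\<pi> (Ds x v))" for x v
  have oNU: "open (N \<inter> U)" using C1_onD(1)[OF f] C1_onD(1)[OF s] by blast
  have \<Phi>: "C1_on (N \<inter> U) \<Phi> D\<Phi>"
    unfolding \<Phi>_def D\<Phi>_def
    by (intro C1_on_add C1_on_linear[OF b\<pi>] C1_on_linear[OF bL] C1_on_id_minus oNU C1_on_minus_const
        C1_on_subset[OF s oNU]) auto
  have \<Phi>T: "\<Phi> x \<in> T" for x
    unfolding \<Phi>_def using \<pi>T LT subspace_add[OF sT] by blast
  have D\<Phi>T: "D\<Phi> x v \<in> T" for x v
    unfolding D\<Phi>_def using \<pi>T LT subspace_add[OF sT] by blast
  have D\<Phi>a: "D\<Phi> a w = 2 *\<^sub>R w" if "w \<in> T" for w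
    using LT[OF that] that by (simp add: D\<Phi>_def \<pi>id L_def scaleR_2)
  define \<rho> where "\<rho> x = \<Phi> x - L (\<Phi> x)" for x
  define D\<rho> where "D\<rho> x v = D\<Phi> x v - L (D\<Phi> x v)" for x v
  \<comment> \<open>The sum represents the pair, since \<open>f\<close> and \<open>\<Phi>\<close> have values in complementary subspaces.\<close>
  have "C1_on (N \<inter> U) (\<lambda>x. f x + \<Phi> x) (\<lambda>x v. Df x v + D\<Phi> x v)"
    by (intro C1_on_add \<Phi> C1_on_subset[OF f oNU]) auto
  moreover have "u = 0" if u: "Df a u + D\<Phi> a u = 0" for u
  proof -
    have "Df a (Df a u + D\<Phi> a u) = Df a u"
      using D\<Phi>T[of a u] Q(2)[of a u] by (simp add: linear_add[OF lQ] T_def)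
    then have "Df a u = 0" using u linear_0[OF lQ] by simp
    then show ?thesis using u D\<Phi>a[of u] by (simp add: T_def)
  qed
  ultimately obtain r where r: "r > 0" "ball a r \<subseteq> N \<inter> U" "inj_on (\<lambda>x. f x + \<Phi> x) (ball a r)"
    using C1_locally_injective[of "N \<inter> U" "\<lambda>x. f x + \<Phi> x" "\<lambda>x v. Df x v + D\<Phi> x v" a] a aU by blast
  define M where "M = ball a r \<inter> (U \<inter> s -` ball a r)"
  have "open (U \<inter> s -` ball a r)" using C1_onD(1,5)[OF s] by (simp add: continuous_open_preimage)
  then have oM: "open M" unfolding M_def by auto
  have b1: "bounded_linear (\<lambda>y. y - L y)" using bL by (intro bounded_linear_sub bounded_linear_ident)
  show ?thesis
  proof (rule that[of M \<rho> D\<rho>])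
    show MN: "M \<subseteq> N" "M \<subseteq> U" using r(2) unfolding M_def by auto
    show "C1_on M \<rho> D\<rho>"
      unfolding \<rho>_def D\<rho>_def by (rule C1_on_linear[OF b1 C1_on_subset[OF \<Phi> oM]]) (use MN in auto)
    show "a \<in> M" using r(1) aU sa by (simp add: M_def)
    show "D\<rho> a w = 2 *\<^sub>R (w - Ds a w)" if "w \<in> T" for w
      using D\<Phi>a[OF that] linear_scale[OF lL] by (simp add: D\<rho>_def L_def scaleR_diff_right)
    show "\<rho> x \<in> (\<lambda>w. w - Ds a w) ` T" for x using \<Phi>T[of x] by (auto simp: \<rho>_def L_def)
    show "D\<rho> x u \<in> (\<lambda>w. w - Ds a w) ` T" for x u using D\<Phi>T[of x u] by (auto simp: D\<rho>_def L_def)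
    show "s x = x \<longleftrightarrow> \<rho> x = 0" if x: "x \<in> M" "x \<in> Z" for x
    proof -
      have xs: "x \<in> U" "s x \<in> ball a r" "x \<in> ball a r" using x unfolding M_def by auto
      then have sxU: "s x \<in> U" "s x \<in> N" "x \<in> N" using r(2) by auto
      have sxZ: "s x \<in> Z" using sZ x xs by blast
      have \<Phi>s: "\<Phi> (s x) = L (\<Phi> x)"
        using ss[OF x(2) xs(1) sxU(1)] LT[OF \<pi>T[of "s x - a"]] by (simp add: \<Phi>_def linear_add[OF lL])
      show ?thesis
      proof
        assume "s x = x" then show "\<rho> x = 0" using \<Phi>s by (simp add: \<rho>_def)
      next
        assume "\<rho> x = 0"
        then have "f (s x) + \<Phi> (s x) = f x + \<Phi> x"
          using \<Phi>s Z[OF sxU(2)] Z[OF sxU(3)] sxZ x(2) by (simp add: \<rho>_def)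
        then show "s x = x" using inj_onD[OF r(3)] xs by blast
      qed
    qed
  qed
qed

section \<open>Local equations at a point of a slice\<close>

lemma bounded_linear_cnj_vec: "bounded_linear (\<lambda>y::complex^'n. (\<chi> k. cnj (y $ k)) :: complex^'n)"
  by (rule bounded_linear_intro[where K=1])
    (auto simp: Finite_Cartesian_Product.vec_eq_iff norm_vec_def)

text \<open>
  Equations valid throughout a neighbourhood \<open>N\<close> in the chart \<open>i\<close>: \<open>f\<close> for the variety, \<open>g\<close> for \<open>V\<close>, and \<open>\<rho>\<close> for the
  real points among the points of the variety.  Both pairs \<open>(f, \<rho>)\<close> and \<open>(g, \<rho>)\<close> are submersions, the second
  one because of transversality.
\<close>

locale slice_chart =
  fixes X :: "('a, 'n::finite, 'i::finite) variety" and \<sigma> :: "'a \<Rightarrow> 'a" and V :: "'a set" and i :: 'i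
    and N :: "(complex^'n) set" and f g \<rho> :: "complex^'n \<Rightarrow> complex^'n"
    and Df Dg D\<rho> :: "complex^'n \<Rightarrow> complex^'n \<Rightarrow> complex^'n" and Wf Wg W\<rho> :: "(complex^'n) set"
  assumes C1: "C1_on N f Df" "C1_on N g Dg" "C1_on N \<rho> D\<rho>"
    and complex_linear: "\<And>x c v. Df x (c *s v) = c *s Df x v" "\<And>x c v. Dg x (c *s v) = c *s Dg x v"
    and subspaces: "subspace Wf" "subspace Wg" "subspace W\<rho>"
    and in_subspaces: "x \<in> N \<Longrightarrow> f x \<in> Wf" "x \<in> N \<Longrightarrow> g x \<in> Wg" "x \<in> N \<Longrightarrow> \<rho> x \<in> W\<rho>"
    and zeros: "x \<in> N \<Longrightarrow> x \<in> coord X i ` patch X i \<longleftrightarrow> f x = 0"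
      "x \<in> N \<Longrightarrow> x \<in> coord X i ` (V \<inter> patch X i) \<longleftrightarrow> g x = 0"
      "q \<in> patch X i \<Longrightarrow> coord X i q \<in> N \<Longrightarrow> q \<in> real_points X \<sigma> \<longleftrightarrow> \<rho> (coord X i q) = 0"
    and range_f: "x \<in> N \<Longrightarrow> range (\<lambda>u. (Df x u, D\<rho> x u)) = Wf \<times> W\<rho>"
    and range_g: "x \<in> N \<Longrightarrow> range (\<lambda>u. (Dg x u, D\<rho> x u)) = Wg \<times> W\<rho>"

text \<open>
  Here \<open>Dh\<close> is the differential of \<open>f\<close> or \<open>g\<close> and \<open>Dr\<close> that of \<open>\<rho>\<close>.  The first component is attained using that \<open>Dh\<close> is idempotent;
  the second is then adjusted by a vector in the kernel of \<open>Dh\<close>, as the fixed vectors of \<open>L\<close> contribute nothing to \<open>w - L w\<close>.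
\<close>

lemma pair_range_subset:
  assumes lin: "linear Dh" "linear Dr" and idem: "\<And>u. Dh (Dh u) = Dh u" and L: "linear L"
    and T: "subspace T" and Dr: "\<And>w. w \<in> T \<Longrightarrow> Dr w = 2 *\<^sub>R (w - L w)" "\<And>u. Dr u \<in> (\<lambda>w. w - L w) ` T"
    and dec: "\<And>\<tau>. \<tau> \<in> T \<Longrightarrow> \<exists>v w. \<tau> = v + w \<and> Dh v = 0 \<and> v \<in> T \<and> L w = w"
  shows "range Dh \<times> (\<lambda>w. w - L w) ` T \<subseteq> range (\<lambda>u. (Dh u, Dr u))"
proof
  fix y assume "y \<in> range Dh \<times> (\<lambda>w. w - L w) ` T"
  then obtain b \<tau> where y: "y = (Dh b, \<tau> - L \<tau>)" and \<tau>: "\<tau> \<in> T" by auto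
  obtain \<tau>' where \<tau>': "\<tau>' \<in> T" "Dr (Dh b) = \<tau>' - L \<tau>'" using Dr(2)[of "Dh b"] by blast
  have "(1/2) *\<^sub>R (\<tau> - \<tau>') \<in> T" by (rule subspace_scale[OF T subspace_diff[OF T \<tau> \<tau>'(1)]])
  then obtain v w where vw: "(1/2) *\<^sub>R (\<tau> - \<tau>') = v + w" "Dh v = 0" "v \<in> T" "L w = w" using dec by blast
  have v: "v = (1/2) *\<^sub>R (\<tau> - \<tau>') - w" using vw(1) by simp
  have Lv: "L v = (1/2) *\<^sub>R (L \<tau> - L \<tau>') - w"
    unfolding v using vw(4) by (simp add: linear_diff[OF L] linear_scale[OF L])
  have "Dr v = (\<tau> - L \<tau>) - (\<tau>' - L \<tau>')"
    unfolding Dr(1)[OF vw(3)] Lv by (simp add: v scaleR_diff_right algebra_simps)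
  then have "y = (Dh (Dh b + v), Dr (Dh b + v))"
    using y \<tau>'(2) vw(2) idem by (simp add: linear_add[OF lin(1)] linear_add[OF lin(2)])
  then show "y \<in> range (\<lambda>u. (Dh u, Dr u))" by (rule range_eqI)
qed

text \<open>
  Vectors tangent to the real points are fixed by the differential \<open>L\<close> of the involution.  Together with
  transversality this decomposes each vector of \<open>T\<close> into one tangent to \<open>V\<close> and one fixed by \<open>L\<close>, which is what
  \<open>pair_range_subset\<close> needs for \<open>g\<close>.  For \<open>f\<close> the decomposition is trivial.
\<close>

lemma local_equations:
  fixes X :: "('a, 'n::finite, 'i::finite) variety"
  assumes X: "real_variety X \<sigma>" and ns: "nonsingular X" and VX: "subvariety X V"
    and tr: "transverse_to_real X \<sigma> V" and pV: "p \<in> V" and pR: "p \<in> real_points X \<sigma>" and i: "p \<in> patch X i"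
  obtains N f g \<rho> Df Dg D\<rho> Wf Wg W\<rho> where
    "slice_chart X \<sigma> V i N f g \<rho> Df Dg D\<rho> Wf Wg W\<rho>" "coord X i p \<in> N"
proof -
  define a where "a = coord X i p"
  define Z where "Z = coord X i ` patch X i"
  have alg: "algebraic_variety X" using X unfolding real_variety_def by blast
  have inj: "inj_on (coord X i) (patch X i)" using alg unfolding algebraic_variety_def by blast
  have patch: "patch X i \<subseteq> points X" unfolding points_def by blast
  have VP: "V \<subseteq> points X" using VX unfolding subvariety_def by blast
  have pX: "p \<in> points X" using patch i by blast
  have \<sigma>p: "\<sigma> p = p" using pR unfolding real_points_def by blast
  have \<sigma>\<sigma>: "\<sigma> (\<sigma> q) = q" if "q \<in> points X" for q using X that unfolding real_variety_def by blast
  have "nonsingular_point (coord X i ` (points X \<inter> patch X i)) a"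
    using ns pX i unfolding nonsingular_def nonsingular_at_def a_def by blast
  moreover have "points X \<inter> patch X i = patch X i" using patch by blast
  ultimately have "nonsingular_point Z a" unfolding Z_def by simp
  then obtain N1 f Df where f: "C1_on N1 f Df" "a \<in> N1" "\<And>x c v. Df x (c *s v) = c *s Df x v"
    "\<And>x. x \<in> N1 \<Longrightarrow> x \<in> Z \<longleftrightarrow> f x = (0 :: complex^'n)"
    "\<And>x. Df a (f x) = f x" "\<And>x u. Df a (Df x u) = Df x u"
    by (rule nonsingular_point_equations) (rule that)
  have "nonsingular_point (coord X i ` (V \<inter> patch X i)) a"
    using tr pV pR i unfolding transverse_to_real_def nonsingular_at_def a_def by blast
  then obtain N2 g Dg where g: "C1_on N2 g Dg" "a \<in> N2" "\<And>x c v. Dg x (c *s v) = c *s Dg x v"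
    "\<And>x. x \<in> N2 \<Longrightarrow> x \<in> coord X i ` (V \<inter> patch X i) \<longleftrightarrow> g x = (0 :: complex^'n)"
    "\<And>x. Dg a (g x) = g x" "\<And>x u. Dg a (Dg x u) = Dg x u"
    by (rule nonsingular_point_equations) (rule that)
  have "antiholomorphic X \<sigma>" using X unfolding real_variety_def by blast
  then have "\<forall>j k. p \<in> patch X j \<and> \<sigma> p \<in> patch X k \<longrightarrow>
        (\<exists>U F. coord X j p \<in> U \<and> holomorphic_map_on U F \<and>
           (\<forall>q\<in>patch X j. coord X j q \<in> U \<longrightarrow>
              \<sigma> q \<in> patch X k \<and> coord X k (\<sigma> q) = (\<chi> m. cnj (F (coord X j q) $ m))))"
    unfolding antiholomorphic_def using pX by (rule bspec)
  from spec[OF spec[OF this, of i], of i] obtain U F where UF': "coord X i p \<in> U \<and> holomorphic_map_on U F \<and>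
       (\<forall>q\<in>patch X i. coord X i q \<in> U \<longrightarrow>
          \<sigma> q \<in> patch X i \<and> coord X i (\<sigma> q) = (\<chi> k. cnj (F (coord X i q) $ k)))"
    using i \<sigma>p by auto
  have UF: "a \<in> U" "holomorphic_map_on U F"
    "q \<in> patch X i \<Longrightarrow> coord X i q \<in> U \<Longrightarrow>
       \<sigma> q \<in> patch X i \<and> coord X i (\<sigma> q) = (\<chi> k. cnj (F (coord X i q) $ k))" for q
    using UF' by (auto simp: a_def)
  obtain DF where DF: "C1_on U F DF" by (rule holomorphic_imp_C1[OF UF(2)]) (rule that)
  define s where "s x = (\<chi> k. cnj (F x $ k))" for x
  define Ds where "Ds x v = (\<chi> k. cnj (DF x v $ k))" for x v
  have s: "C1_on U s Ds" unfolding s_def Ds_def by (rule C1_on_linear[OF bounded_linear_cnj_vec DF])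
  have s\<sigma>: "\<sigma> q \<in> patch X i" "coord X i (\<sigma> q) = s (coord X i q)" if "q \<in> patch X i" "coord X i q \<in> U" for q
    using UF(3)[OF that] by (simp_all add: s_def)
  have aZ: "a \<in> Z" using i by (simp add: a_def Z_def)
  have sa: "s a = a" using s\<sigma>(2)[OF i] \<sigma>p UF(1) by (simp add: a_def)
  have sZ: "s x \<in> Z" if x: "x \<in> Z" "x \<in> U" for x
  proof -
    obtain q where q: "q \<in> patch X i" "x = coord X i q" using x(1) unfolding Z_def by blast
    show ?thesis using s\<sigma>[OF q(1)] x(2) q(2) unfolding Z_def by (metis imageI)
  qed
  have ss: "s (s x) = x" if x: "x \<in> Z" "x \<in> U" "s x \<in> U" for x
  proof -
    obtain q where q: "q \<in> patch X i" "x = coord X i q" using x(1) unfolding Z_def by blast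
    have 1: "\<sigma> q \<in> patch X i" "coord X i (\<sigma> q) = s x" using s\<sigma>[OF q(1)] x(2) q(2) by auto
    have "coord X i (\<sigma> (\<sigma> q)) = s (s x)" using s\<sigma>(2)[OF 1(1)] 1(2) x(3) by simp
    then show ?thesis using \<sigma>\<sigma>[of q] patch q by auto
  qed
  define T where "T = {w. Df a w = 0}"
  define L where "L = Ds a"
  define W\<rho> where "W\<rho> = (\<lambda>w. w - L w) ` T"
  note inv_fix = involution_fixed_set[OF f(1,2,4) aZ f(5,6) s UF(1) sa sZ ss,
      folded T_def L_def, folded W\<rho>_def]
  obtain M \<rho> D\<rho> where \<rho>: "C1_on M \<rho> D\<rho>" "a \<in> M" "M \<subseteq> N1" "M \<subseteq> U"
    "\<And>x. x \<in> M \<Longrightarrow> x \<in> Z \<Longrightarrow> s x = x \<longleftrightarrow> \<rho> x = 0"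
    "\<And>w. w \<in> T \<Longrightarrow> D\<rho> a w = 2 *\<^sub>R (w - L w)"
    "\<And>x. \<rho> x \<in> W\<rho>" "\<And>x u. x \<in> M \<Longrightarrow> D\<rho> x u \<in> W\<rho>"
    by (rule inv_fix) (assumption | rule that)+
  define Wf where "Wf = range (Df a)"
  define Wg where "Wg = range (Dg a)"
  have lf: "linear (Df a)" and lg: "linear (Dg a)" and lr: "linear (D\<rho> a)" and lL: "linear L"
    using C1_onD(4)[OF f(1,2)] C1_onD(4)[OF g(1,2)] C1_onD(4)[OF \<rho>(1,2)] C1_onD(4)[OF s UF(1)]
    by (auto simp: L_def)
  have sT: "subspace T" unfolding T_def by (rule linear_subspace_kernel[OF lf])
  have sWf: "subspace Wf" unfolding Wf_def by (rule linear_subspace_image[OF lf subspace_UNIV])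
  have sWg: "subspace Wg" unfolding Wg_def by (rule linear_subspace_image[OF lg subspace_UNIV])
  have sW\<rho>: "subspace W\<rho>" unfolding W\<rho>_def
    by (rule linear_subspace_image[OF _ sT]) (intro linear_compose_sub linear_id[unfolded id_def] lL)
  have fW: "f x \<in> Wf" "Df x u \<in> Wf" for x u
    unfolding Wf_def using rangeI[of "Df a" "f x"] rangeI[of "Df a" "Df x u"] f(5)[of x] f(6)[of x u] by simp_all
  have gW: "g x \<in> Wg" "Dg x u \<in> Wg" for x u
    unfolding Wg_def using rangeI[of "Dg a" "g x"] rangeI[of "Dg a" "Dg x u"] g(5)[of x] g(6)[of x u] by simp_all
  have CTZ: "chart_tangent Z a = T"
    unfolding T_def by (rule chart_tangent_zero_set[OF f(1,2) aZ f(4) sWf]) (use fW in \<open>auto simp: Wf_def\<close>)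
  have CTV: "chart_tangent (coord X i ` (V \<inter> patch X i)) a = {w. Dg a w = 0}"
    by (rule chart_tangent_zero_set[OF g(1,2) _ g(4) sWg]) (use pV i gW in \<open>auto simp: Wg_def a_def\<close>)
  have CTR: "L w = w" if w: "w \<in> chart_tangent (coord X i ` (real_points X \<sigma> \<inter> patch X i)) a" for w
  proof -
    obtain c where c: "c 0 = a" "\<forall>\<^sub>F t in nhds 0. c t \<in> coord X i ` (real_points X \<sigma> \<inter> patch X i)"
      "(c has_vector_derivative w) (at 0)"
      using w unfolding chart_tangent_def by blast
    have "\<forall>\<^sub>F t in nhds 0. c t \<in> U" using vderiv_eventually_in[OF c(3) C1_onD(1)[OF s]] c(1) UF(1) by simp
    with c(2) have "\<forall>\<^sub>F t in nhds 0. s (c t) = c t"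
    proof eventually_elim
      case (elim t)
      then obtain q where q: "q \<in> real_points X \<sigma>" "q \<in> patch X i" "c t = coord X i q" by blast
      then show ?case using s\<sigma>(2)[OF q(2)] elim(2) by (simp add: real_points_def)
    qed
    from vderiv_eventually_eq[OF vderiv_C1_compose[OF c(3) s] this]
    have "(c has_vector_derivative L w) (at 0)" using c(1) UF(1) by (simp add: L_def)
    then show ?thesis using c(3) vector_derivative_unique_at by blast
  qed
  obtain l :: "complex^'n \<Rightarrow> complex^'n^'i" where l: "linear l" "\<And>w. l w $ i = w"
    "\<And>M. p \<in> M \<Longrightarrow> tangent_space X M p = l ` chart_tangent (coord X i ` (M \<inter> patch X i)) a"
    using tangent_lift[OF alg i] unfolding a_def by metis
  have decg: "\<exists>v w. \<tau> = v + w \<and> Dg a v = 0 \<and> v \<in> T \<and> L w = w" if \<tau>: "\<tau> \<in> T" for \<tau>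
  proof -
    have "l \<tau> \<in> tangent_space X (points X) p"
      unfolding l(3)[OF pX] \<open>points X \<inter> patch X i = patch X i\<close> Z_def[symmetric] CTZ using \<tau> by blast
    then have "l \<tau> \<in> {v + w | v w. v \<in> tangent_space X V p \<and> w \<in> tangent_space X (real_points X \<sigma>) p}"
      using tr pV pR unfolding transverse_to_real_def by blast
    then obtain v w where vw: "l \<tau> = l v + l w" "v \<in> chart_tangent (coord X i ` (V \<inter> patch X i)) a"
      "w \<in> chart_tangent (coord X i ` (real_points X \<sigma> \<inter> patch X i)) a"
      unfolding l(3)[OF pV] l(3)[OF pR] by blast
    have "\<tau> = v + w" using arg_cong[OF vw(1), of "\<lambda>z. z $ i"] l(2) by simp
    moreover have "v \<in> T" using vw(2) chart_tangent_mono[of "coord X i ` (V \<inter> patch X i)" Z]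
      unfolding CTZ[symmetric] Z_def by blast
    ultimately show ?thesis using vw(2) CTR[OF vw(3)] unfolding CTV by blast
  qed
  define N0 where "N0 = N1 \<inter> N2 \<inter> M"
  have N0: "open N0" "a \<in> N0" "N0 \<subseteq> N1" "N0 \<subseteq> N2" "N0 \<subseteq> M"
    using C1_onD(1)[OF f(1)] C1_onD(1)[OF g(1)] C1_onD(1)[OF \<rho>(1)] f(2) g(2) \<rho>(2) by (auto simp: N0_def)
  note C1 = C1_on_subset[OF f(1) N0(1,3)] C1_on_subset[OF g(1) N0(1,4)] C1_on_subset[OF \<rho>(1) N0(1,5)]
  note Pf = C1_on_Pair[OF C1(1,3)] and Pg = C1_on_Pair[OF C1(2,3)]
  have surjf: "Wf \<times> W\<rho> \<subseteq> range (\<lambda>u. (Df a u, D\<rho> a u))"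
    unfolding Wf_def W\<rho>_def
  proof (rule pair_range_subset[OF lf lr f(6) lL sT \<rho>(6)])
    show "\<exists>v w. \<tau> = v + w \<and> Df a v = 0 \<and> v \<in> T \<and> L w = w" if "\<tau> \<in> T" for \<tau>
      using that linear_0[OF lL] by (intro exI[of _ \<tau>] exI[of _ 0]) (simp add: T_def)
  qed (use \<rho>(8)[OF \<rho>(2)] in \<open>auto simp: W\<rho>_def\<close>)
  have surjg: "Wg \<times> W\<rho> \<subseteq> range (\<lambda>u. (Dg a u, D\<rho> a u))"
    unfolding Wg_def W\<rho>_def
    by (rule pair_range_subset[OF lg lr g(6) lL sT \<rho>(6) _ decg]) (use \<rho>(8)[OF \<rho>(2)] in \<open>auto simp: W\<rho>_def\<close>)
  have rf: "range (\<lambda>u. (Df x u, D\<rho> x u)) \<subseteq> Wf \<times> W\<rho>" and rg: "range (\<lambda>u. (Dg x u, D\<rho> x u)) \<subseteq> Wg \<times> W\<rho>"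
    if "x \<in> N0" for x using fW gW \<rho>(8) that N0(5) by blast+
  obtain Nf Qf where Nf: "open Nf" "a \<in> Nf" "Nf \<subseteq> N0"
    "\<And>x y. x \<in> Nf \<Longrightarrow> y \<in> Wf \<times> W\<rho> \<Longrightarrow> (Df x (Qf x y), D\<rho> x (Qf x y)) = y"
    by (rule continuous_right_inverse[OF N0(1) C1_onD(4)[OF Pf] C1_onD(3)[OF Pf] N0(2) rf surjf]) (assumption | rule that)+
  obtain Ng Qg where Ng: "open Ng" "a \<in> Ng" "Ng \<subseteq> N0"
    "\<And>x y. x \<in> Ng \<Longrightarrow> y \<in> Wg \<times> W\<rho> \<Longrightarrow> (Dg x (Qg x y), D\<rho> x (Qg x y)) = y"
    by (rule continuous_right_inverse[OF N0(1) C1_onD(4)[OF Pg] C1_onD(3)[OF Pg] N0(2) rg surjg]) (assumption | rule that)+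
  define N where "N = Nf \<inter> Ng"
  have N: "open N" "a \<in> N" "N \<subseteq> N0" using Nf Ng by (auto simp: N_def)
  have "slice_chart X \<sigma> V i N f g \<rho> Df Dg D\<rho> Wf Wg W\<rho>"
  proof
    show "C1_on N f Df" "C1_on N g Dg" "C1_on N \<rho> D\<rho>"
      using C1_on_subset[OF _ N(1,3)] C1 by blast+
    show "Df x (c *s v) = c *s Df x v" "Dg x (c *s v) = c *s Dg x v" for x c v by (fact f(3) g(3))+
    show "subspace Wf" "subspace Wg" "subspace W\<rho>" by (fact sWf sWg sW\<rho>)+
    show "f x \<in> Wf" "g x \<in> Wg" "\<rho> x \<in> W\<rho>" for x by (fact fW(1) gW(1) \<rho>(7))+
    show "x \<in> coord X i ` patch X i \<longleftrightarrow> f x = 0" if "x \<in> N" for x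
      using f(4) that N(3) N0(3) unfolding Z_def by blast
    show "x \<in> coord X i ` (V \<inter> patch X i) \<longleftrightarrow> g x = 0" if "x \<in> N" for x
      using g(4) that N(3) N0(4) by blast
    show "q \<in> real_points X \<sigma> \<longleftrightarrow> \<rho> (coord X i q) = 0" if q: "q \<in> patch X i" "coord X i q \<in> N" for q
    proof -
      have xM: "coord X i q \<in> M" using q(2) N(3) N0(5) by blast
      then have xU: "coord X i q \<in> U" using \<rho>(4) by blast
      have "q \<in> real_points X \<sigma> \<longleftrightarrow> \<sigma> q = q" using q(1) patch by (auto simp: real_points_def)
      also have "\<dots> \<longleftrightarrow> s (coord X i q) = coord X i q"
        using inj_on_eq_iff[OF inj s\<sigma>(1)[OF q(1) xU] q(1)] s\<sigma>(2)[OF q(1) xU] by simp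
      also have "\<dots> \<longleftrightarrow> \<rho> (coord X i q) = 0" by (rule \<rho>(5)[OF xM]) (use q in \<open>simp add: Z_def\<close>)
      finally show ?thesis .
    qed
    show "range (\<lambda>u. (Df x u, D\<rho> x u)) = Wf \<times> W\<rho>" if x: "x \<in> N" for x
    proof
      show "range (\<lambda>u. (Df x u, D\<rho> x u)) \<subseteq> Wf \<times> W\<rho>" using rf x N(3) by blast
      show "Wf \<times> W\<rho> \<subseteq> range (\<lambda>u. (Df x u, D\<rho> x u))"
      proof
        fix y assume "y \<in> Wf \<times> W\<rho>"
        then have "y = (Df x (Qf x y), D\<rho> x (Qf x y))" using Nf(4)[of x y] x by (simp add: N_def)
        then show "y \<in> range (\<lambda>u. (Df x u, D\<rho> x u))" by (rule range_eqI)
      qed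
    qed
    show "range (\<lambda>u. (Dg x u, D\<rho> x u)) = Wg \<times> W\<rho>" if x: "x \<in> N" for x
    proof
      show "range (\<lambda>u. (Dg x u, D\<rho> x u)) \<subseteq> Wg \<times> W\<rho>" using rg x N(3) by blast
      show "Wg \<times> W\<rho> \<subseteq> range (\<lambda>u. (Dg x u, D\<rho> x u))"
      proof
        fix y assume "y \<in> Wg \<times> W\<rho>"
        then have "y = (Dg x (Qg x y), D\<rho> x (Qg x y))" using Ng(4)[of x y] x by (simp add: N_def)
        then show "y \<in> range (\<lambda>u. (Dg x u, D\<rho> x u))" by (rule range_eqI)
      qed
    qed
  qed
  then show ?thesis using that N(2) unfolding a_def by blast
qed

context slice_chart
begin

text \<open>
  A submersion \<open>(f, \<rho>)\<close> has submersive components.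
\<close>

lemma range_Df: "x \<in> N \<Longrightarrow> range (Df x) = Wf"
  and range_Dg: "x \<in> N \<Longrightarrow> range (Dg x) = Wg"
proof -
  assume x: "x \<in> N"
  have "range (Df x) = fst ` range (\<lambda>u. (Df x u, D\<rho> x u))" "range (Dg x) = fst ` range (\<lambda>u. (Dg x u, D\<rho> x u))"
    by (auto simp: image_image)
  moreover have "W\<rho> \<noteq> {}" using subspace_0[OF subspaces(3)] by blast
  ultimately show "range (Df x) = Wf" "range (Dg x) = Wg" by (simp_all add: range_f range_g x)
qed

lemma tangent_spaces:
  assumes alg: "algebraic_variety X" and q: "q \<in> patch X i" "coord X i q \<in> N" "q \<in> V" "q \<in> real_points X \<sigma>"
  obtains l :: "complex^'n \<Rightarrow> complex^'n^'i" where "linear l" "\<And>c w. l (c *s w) = cscale c (l w)"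
    "\<And>w. l w $ i = w"
    "tangent_space X (points X) q = l ` {w. Df (coord X i q) w = 0}"
    "tangent_space X V q = l ` {w. Dg (coord X i q) w = 0}"
    "tangent_space X (real_points X \<sigma>) q = l ` {w. Df (coord X i q) w = 0 \<and> D\<rho> (coord X i q) w = 0}"
    "tangent_space X (V \<inter> real_points X \<sigma>) q = l ` {w. Dg (coord X i q) w = 0 \<and> D\<rho> (coord X i q) w = 0}"
proof -
  let ?x = "coord X i q"
  obtain l :: "complex^'n \<Rightarrow> complex^'n^'i" where l: "linear l" "\<And>c w. l (c *s w) = cscale c (l w)"
    "\<And>w. l w $ i = w"
    "\<And>M. q \<in> M \<Longrightarrow> tangent_space X M q = l ` chart_tangent (coord X i ` (M \<inter> patch X i)) ?x"
    using tangent_lift[OF alg q(1)] by metis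
  have patch: "points X \<inter> patch X i = patch X i" unfolding points_def by blast
  have qX: "q \<in> points X" using patch q(1) by blast
  have 1: "chart_tangent (coord X i ` patch X i) ?x = {w. Df ?x w = 0}"
    by (rule chart_tangent_zero_set[OF C1(1) q(2) _ zeros(1) subspaces(1) in_subspaces(1) range_Df])
      (use q in auto)
  have 2: "chart_tangent (coord X i ` (V \<inter> patch X i)) ?x = {w. Dg ?x w = 0}"
    by (rule chart_tangent_zero_set[OF C1(2) q(2) _ zeros(2) subspaces(2) in_subspaces(2) range_Dg])
      (use q in auto)
  have 3: "chart_tangent (coord X i ` (real_points X \<sigma> \<inter> patch X i)) ?x = {w. (Df ?x w, D\<rho> ?x w) = 0}"
  proof (rule chart_tangent_zero_set[OF C1_on_Pair[OF C1(1,3)] q(2) _ _ subspace_Times[OF subspaces(1,3)]])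
    show "y \<in> coord X i ` (real_points X \<sigma> \<inter> patch X i) \<longleftrightarrow> (f y, \<rho> y) = 0" if "y \<in> N" for y
      using zeros(1)[OF that] zeros(3) that by (auto simp: zero_prod_def)
  qed (use q in_subspaces range_f in auto)
  have 4: "chart_tangent (coord X i ` (V \<inter> real_points X \<sigma> \<inter> patch X i)) ?x = {w. (Dg ?x w, D\<rho> ?x w) = 0}"
  proof (rule chart_tangent_zero_set[OF C1_on_Pair[OF C1(2,3)] q(2) _ _ subspace_Times[OF subspaces(2,3)]])
    show "y \<in> coord X i ` (V \<inter> real_points X \<sigma> \<inter> patch X i) \<longleftrightarrow> (g y, \<rho> y) = 0" if "y \<in> N" for y
      using zeros(2)[OF that] zeros(3) that by (auto simp: zero_prod_def)
  qed (use q in_subspaces range_g in auto)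
  show ?thesis
    by (rule that[OF l(1-3)])
      (use l(4)[OF qX] l(4)[OF q(3)] l(4)[OF q(4)] l(4)[of "V \<inter> real_points X \<sigma>"] q 1 2 3 4 patch in
        \<open>simp_all add: zero_prod_def\<close>)
qed

end

lemma complex_subspace_lift_kernel:
  fixes l :: "complex^'n::finite \<Rightarrow> complex^'n^'i::finite"
  assumes l: "linear l" "\<And>c w. l (c *s w) = cscale c (l w)" and D: "linear D" "\<And>c w. D (c *s w) = c *s D w"
  shows "complex_subspace (l ` {w. D w = 0})"
  unfolding complex_subspace_def
proof (intro conjI ballI allI)
  show "0 \<in> l ` {w. D w = 0}" using linear_0[OF l(1)] linear_0[OF D(1)] by force
  show "x + y \<in> l ` {w. D w = 0}" if "x \<in> l ` {w. D w = 0}" "y \<in> l ` {w. D w = 0}" for x y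
    using that by (auto simp: linear_add[OF D(1)] simp flip: linear_add[OF l(1)])
  show "cscale c x \<in> l ` {w. D w = 0}" if "x \<in> l ` {w. D w = 0}" for c x
    using that by (auto simp: D(2) simp flip: l(2))
qed

lemma tangent_space_mono: "S \<subseteq> M \<Longrightarrow> tangent_space X S p \<subseteq> tangent_space X M p"
  unfolding tangent_space_def by (auto elim!: eventually_mono)

lemma transverse_tangent_spaces:
  fixes X :: "('a, 'n::finite, 'i::finite) variety"
  assumes X: "real_variety X \<sigma>" and ns: "nonsingular X" and VX: "subvariety X V"
    and tr: "transverse_to_real X \<sigma> V" and pV: "p \<in> V" and pR: "p \<in> real_points X \<sigma>"
  shows "complex_subspace (tangent_space X (points X) p)" "complex_subspace (tangent_space X V p)"
    "subspace (tangent_space X (real_points X \<sigma>) p)"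
    "tangent_space X V p \<subseteq> tangent_space X (points X) p"
    "tangent_space X (real_points X \<sigma>) p \<subseteq> tangent_space X (points X) p"
    "tangent_space X (V \<inter> real_points X \<sigma>) p = tangent_space X (real_points X \<sigma>) p \<inter> tangent_space X V p"
    "\<And>x. x \<in> tangent_space X (points X) p \<Longrightarrow>
       \<exists>v\<in>tangent_space X V p. \<exists>w\<in>tangent_space X (real_points X \<sigma>) p. x = v + w"
proof -
  have alg: "algebraic_variety X" using X unfolding real_variety_def by blast
  show VP: "tangent_space X V p \<subseteq> tangent_space X (points X) p"
    by (rule tangent_space_mono) (use VX in \<open>simp add: subvariety_def\<close>)
  show "tangent_space X (real_points X \<sigma>) p \<subseteq> tangent_space X (points X) p"
    by (rule tangent_space_mono) (auto simp: real_points_def)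
  show "\<exists>v\<in>tangent_space X V p. \<exists>w\<in>tangent_space X (real_points X \<sigma>) p. x = v + w"
    if x: "x \<in> tangent_space X (points X) p" for x
  proof -
    have "p \<in> V \<inter> real_points X \<sigma>" using pV pR by blast
    from conjunct2[OF bspec[OF tr[unfolded transverse_to_real_def] this]] x
    have "x \<in> {v + w |v w. v \<in> tangent_space X V p \<and> w \<in> tangent_space X (real_points X \<sigma>) p}" by simp
    then show ?thesis by blast
  qed
  obtain i where i: "p \<in> patch X i" using pR unfolding real_points_def points_def by blast
  obtain N f g \<rho> Df Dg D\<rho> Wf Wg W\<rho> where
    sc: "slice_chart X \<sigma> V i N f g \<rho> Df Dg D\<rho> Wf Wg W\<rho>" and aN: "coord X i p \<in> N"
    by (rule local_equations[OF X ns VX tr pV pR i]) (rule that)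
  interpret slice_chart X \<sigma> V i N f g \<rho> Df Dg D\<rho> Wf Wg W\<rho> by (fact sc)
  let ?a = "coord X i p"
  obtain l :: "complex^'n \<Rightarrow> complex^'n^'i" where l: "linear l" "\<And>c w. l (c *s w) = cscale c (l w)"
    "\<And>w. l w $ i = w"
    "tangent_space X (points X) p = l ` {w. Df ?a w = 0}"
    "tangent_space X V p = l ` {w. Dg ?a w = 0}"
    "tangent_space X (real_points X \<sigma>) p = l ` {w. Df ?a w = 0 \<and> D\<rho> ?a w = 0}"
    "tangent_space X (V \<inter> real_points X \<sigma>) p = l ` {w. Dg ?a w = 0 \<and> D\<rho> ?a w = 0}"
    by (rule tangent_spaces[OF alg i aN pV pR]) (rule that)
  note lin = C1_onD(4)[OF C1(1) aN] C1_onD(4)[OF C1(2) aN] C1_onD(4)[OF C1(3) aN]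
  show "complex_subspace (tangent_space X (points X) p)" "complex_subspace (tangent_space X V p)"
    unfolding l(4,5)
    by (intro complex_subspace_lift_kernel l(1,2) lin complex_linear)+
  have "subspace ({w. Df ?a w = 0} \<inter> {w. D\<rho> ?a w = 0})"
    by (intro subspace_inter linear_subspace_kernel lin)
  from linear_subspace_image[OF l(1) this]
  show "subspace (tangent_space X (real_points X \<sigma>) p)" unfolding l(6) by (simp add: Collect_conj_eq)
  have inj: "l u = l v \<longleftrightarrow> u = v" for u v using l(3) by metis
  have sub: "Df ?a w = 0" if "Dg ?a w = 0" for w
  proof -
    have "l w \<in> l ` {w. Df ?a w = 0}" using VP that unfolding l(4,5) by blast
    then show ?thesis using inj by auto
  qed
  show "tangent_space X (V \<inter> real_points X \<sigma>) p = tangent_space X (real_points X \<sigma>) p \<inter> tangent_space X V p"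
    unfolding l(5,6,7) using sub by (auto simp: inj)
qed

section \<open>Continuous positive frames\<close>

lemma C1_continuous_apply:
  assumes G: "C1_on N G D" and T: "T \<subseteq> N" and u: "continuous_on T u"
  shows "continuous_on T (\<lambda>x. D x (u x))"
proof -
  have "continuous_on T (\<lambda>x. \<Sum>b\<in>Basis. (u x \<bullet> b) *\<^sub>R D x b)"
    by (intro continuous_intros u continuous_on_subset[OF C1_onD(3)[OF G] T])
  moreover have "(\<Sum>b\<in>Basis. (u x \<bullet> b) *\<^sub>R D x b) = D x (u x)" if "x \<in> T" for x
  proof -
    have l: "linear (D x)" using C1_onD(4)[OF G] T that by blast
    have "D x (u x) = D x (\<Sum>b\<in>Basis. (u x \<bullet> b) *\<^sub>R b)" by (simp add: euclidean_representation)
    then show ?thesis by (simp add: linear_sum[OF l] linear_scale[OF l])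
  qed
  ultimately show ?thesis by (simp cong: continuous_on_cong)
qed

lemma openin_chart:
  "open O' \<Longrightarrow> openin (classical_topology X) {q \<in> patch X i. coord X i q \<in> O'}"
  unfolding classical_topology_def by (rule topology_generated_by_Basis) blast

text \<open>
  The other components of such a field are images of \<open>u\<close> under differentials of transition maps.  The representation
  of a transition map as a fraction is only local, so continuity is proved point by point.
\<close>

lemma continuous_field_from_chart:
  fixes X :: "('a, 'n::finite, 'i::finite) variety"
  assumes X: "algebraic_variety X" and D: "\<And>q. q \<in> D \<Longrightarrow> q \<in> patch X i \<and> coord X i q \<in> N"
    and u: "continuous_on N u"
    and s: "\<And>q. q \<in> D \<Longrightarrow> s q \<in> tangent_space X (points X) q \<and> s q $ i = u (coord X i q)"
  shows "continuous_field_on X D s"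
  unfolding continuous_field_on_def continuous_map_def
proof (intro allI conjI impI)
  fix j
  let ?Y = "subtopology (classical_topology X) (D \<inter> patch X j)"
  show "(\<lambda>q. s q $ j) \<in> topspace ?Y \<rightarrow> topspace euclidean" by simp
  fix O' :: "(complex^'n) set" assume "openin euclidean O'"
  then have O': "open O'" by simp
  show "openin ?Y {q \<in> topspace ?Y. s q $ j \<in> O'}"
  proof (subst openin_subopen, intro ballI)
    fix p assume "p \<in> {q \<in> topspace ?Y. s q $ j \<in> O'}"
    then have p: "p \<in> D" "p \<in> patch X j" "s p $ j \<in> O'" by auto
    obtain M \<Theta> D\<Theta> where M: "C1_on M \<Theta> D\<Theta>" "coord X i p \<in> M"
      "\<And>q. q \<in> patch X i \<Longrightarrow> coord X i q \<in> M \<Longrightarrow> q \<in> patch X j \<and> coord X j q = \<Theta> (coord X i q)"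
      by (rule transition_map[OF X conjunct1[OF D[OF p(1)]] p(2)]) blast
    have eq: "s q $ j = D\<Theta> (coord X i q) (u (coord X i q))" if q: "q \<in> D" "coord X i q \<in> M" for q
    proof -
      have "s q $ j = D\<Theta> (coord X i q) (s q $ i)"
        by (rule tangent_component[OF M(1) M(3) _ q(2)]) (use D q(1) s in auto)
      then show ?thesis using s[OF q(1)] by simp
    qed
    have "continuous_on (N \<inter> M) (\<lambda>x. D\<Theta> x (u x))"
      by (rule C1_continuous_apply[OF M(1) _ continuous_on_subset[OF u]]) auto
    then obtain A where A: "open A" "A \<inter> (N \<inter> M) = (\<lambda>x. D\<Theta> x (u x)) -` O' \<inter> (N \<inter> M)"
      unfolding continuous_on_open_invariant using O' by blast
    let ?B = "{q \<in> patch X i. coord X i q \<in> A \<inter> M}"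
    have B: "openin (classical_topology X) ?B" by (rule openin_chart) (use A(1) C1_onD(1)[OF M(1)] in blast)
    show "\<exists>T. openin ?Y T \<and> p \<in> T \<and> T \<subseteq> {q \<in> topspace ?Y. s q $ j \<in> O'}"
    proof (intro exI conjI)
      show "openin ?Y (?B \<inter> (D \<inter> patch X j))" using B by (rule openin_subtopology_Int)
      have "coord X i p \<in> (\<lambda>x. D\<Theta> x (u x)) -` O' \<inter> (N \<inter> M)"
        using eq[OF p(1) M(2)] p(3) D[OF p(1)] M(2) by simp
      then have "coord X i p \<in> A \<inter> M" unfolding A(2)[symmetric] by blast
      then show "p \<in> ?B \<inter> (D \<inter> patch X j)" using p D[OF p(1)] by blast
      show "?B \<inter> (D \<inter> patch X j) \<subseteq> {q \<in> topspace ?Y. s q $ j \<in> O'}"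
      proof
        fix q assume q: "q \<in> ?B \<inter> (D \<inter> patch X j)"
        then have qM: "coord X i q \<in> A \<inter> (N \<inter> M)" using D[of q] by blast
        then have "s q $ j \<in> O'" using eq[of q] q unfolding A(2) by auto
        moreover have "q \<in> topspace ?Y"
          using openin_subset[OF openin_subtopology_Int[OF B]] q by blast
        ultimately show "q \<in> {q \<in> topspace ?Y. s q $ j \<in> O'}" by blast
      qed
    qed
  qed
qed

text \<open>
  A real linear projection becomes complex linear when averaged over multiplication by \<open>\<i>\<close>.
\<close>

lemma complex_projection_exists:
  fixes W :: "(complex^'n) set"
  assumes W: "subspace W" and iW: "\<And>c w. w \<in> W \<Longrightarrow> c *s w \<in> W"
  obtains P :: "complex^'n \<Rightarrow> complex^'n" where "linear P" "\<And>c x. P (c *s x) = c *s P x" "\<And>w. w \<in> W \<Longrightarrow> P w = w" "range P \<subseteq> W"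
proof -
  have "\<exists>g. g ` UNIV \<subseteq> W \<and> linear g \<and> (\<forall>v\<in>W. g (id v) = v)"
    by (rule linear_exists_left_inverse_on[OF linear_id W]) simp
  then obtain g where g: "range g \<subseteq> W" "linear g" "\<And>v. v \<in> W \<Longrightarrow> g v = v" by auto
  define P where "P x = (1/2) *\<^sub>R (g x - \<i> *s g (\<i> *s x))" for x
  have sR: "r *\<^sub>R x = complex_of_real r *s x" for r and x :: "complex^'n"
    by (simp add: Finite_Cartesian_Product.vec_eq_iff scaleR_conv_of_real[where 'a=complex])
  have li: "linear (\<lambda>x::complex^'n. \<i> *s x)"
    using bounded_linear_cvec_scale_right by (rule bounded_linear.linear)
  have lP: "linear P"
    unfolding P_def
    by (intro linear_compose_scale_right linear_compose_sub g(2)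
        linear_compose[OF linear_compose[OF li g(2)] li, unfolded o_def])
  have Pi: "P (\<i> *s x) = \<i> *s P x" for x
  proof -
    have "\<i> *s (\<i> *s x) = - x" by (simp add: Finite_Cartesian_Product.vec_eq_iff)
    then have "P (\<i> *s x) = (1/2) *\<^sub>R (g (\<i> *s x) + \<i> *s g x)"
      by (simp add: P_def linear_neg[OF g(2)] Finite_Cartesian_Product.vec_eq_iff)
    then show ?thesis by (simp add: P_def Finite_Cartesian_Product.vec_eq_iff algebra_simps scaleR_conv_of_real[where 'a=complex])
  qed
  have Pc: "P (c *s x) = c *s P x" for c x
  proof -
    have c: "c *s y = Re c *\<^sub>R y + Im c *\<^sub>R (\<i> *s y)" for y :: "complex^'n"
      by (simp add: Finite_Cartesian_Product.vec_eq_iff complex_eq_iff algebra_simps)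
    show ?thesis unfolding c[of x] c[of "P x"] by (simp add: linear_add[OF lP] linear_scale[OF lP] Pi)
  qed
  show ?thesis
  proof (rule that[OF lP Pc])
    show "P w = w" if w: "w \<in> W" for w
    proof -
      have "g (\<i> *s w) = \<i> *s w" by (rule g(3)[OF iW[OF w]])
      then show ?thesis by (simp add: P_def g(3)[OF w] Finite_Cartesian_Product.vec_eq_iff flip: scaleR_2)
    qed
    show "range P \<subseteq> W"
      unfolding P_def using g(1) by (auto intro!: subspace_scale[OF W] subspace_diff[OF W] iW)
  qed
qed

context slice_chart
begin

lemma kernel_inclusion:
  assumes alg: "algebraic_variety X" and VX: "V \<subseteq> points X"
    and q: "q \<in> patch X i" "coord X i q \<in> N" "q \<in> V" "q \<in> real_points X \<sigma>" and w: "Dg (coord X i q) w = 0"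
  shows "Df (coord X i q) w = 0"
proof -
  obtain l :: "complex^'n \<Rightarrow> complex^'n^'i" where l: "\<And>w. l w $ i = w"
    "tangent_space X (points X) q = l ` {w. Df (coord X i q) w = 0}"
    "tangent_space X V q = l ` {w. Dg (coord X i q) w = 0}"
    by (rule tangent_spaces[OF alg q]) (rule that)
  have "l w \<in> l ` {w. Df (coord X i q) w = 0}"
    using tangent_space_mono[OF VX, of X q] w unfolding l(2,3) by blast
  then show ?thesis using l(1) by (metis (mono_tags, lifting) imageE mem_Collect_eq)
qed

text \<open>
  The sections \<open>e\<^sub>m\<close> solve \<open>f' e\<^sub>m = 0\<close> and \<open>P g' e\<^sub>m = g'\<^sub>a w\<^sub>m\<close>, where the \<open>w\<^sub>m\<close> form a complex basis at the
  given point and \<open>P\<close> projects onto the image under \<open>g'\<^sub>a\<close> of the kernel of \<open>f'\<^sub>a\<close>.  As the right hand side is constant and \<open>P\<close> is complex linear, they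
  stay complex independent modulo the kernel of \<open>g'\<close>.  The correction \<open>h\<close> solves \<open>g' h = 0\<close> and \<open>\<rho>' h = - \<rho>' E\<close>; it changes
  nothing modulo \<open>TV\<close> and makes \<open>E + h\<close> tangent to the real points.
\<close>

lemma positive_frame:
  assumes X: "real_variety X \<sigma>" "nonsingular X" "subvariety X V" "transverse_to_real X \<sigma> V"
    and p: "p \<in> patch X i" "coord X i p \<in> N" "p \<in> V" "p \<in> real_points X \<sigma>"
  obtains W ss where "openin (classical_topology X) W" "p \<in> W"
    "\<And>s. s \<in> set ss \<Longrightarrow> continuous_field_on X (W \<inter> (V \<inter> real_points X \<sigma>)) s"
    "\<And>q. q \<in> W \<inter> (V \<inter> real_points X \<sigma>) \<Longrightarrow>
       quotient_basis (tangent_space X (real_points X \<sigma>) q) (tangent_space X (V \<inter> real_points X \<sigma>) q) (map (\<lambda>s. s q) ss) \<and>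
       map (\<lambda>s. s q) ss \<in> complex_orientation (tangent_space X (points X) q) (tangent_space X V q)"
proof -
  have alg: "algebraic_variety X" using X(1) unfolding real_variety_def by blast
  have VX: "V \<subseteq> points X" using X(3) unfolding subvariety_def by blast
  define a where "a = coord X i p"
  have a: "a \<in> N" using p by (simp add: a_def)
  note oN = C1_onD(1)[OF C1(1)]
  note linf = C1_onD(4)[OF C1(1)] and ling = C1_onD(4)[OF C1(2)] and linr = C1_onD(4)[OF C1(3)]
  note tsp = transverse_tangent_spaces[OF X]
  define S where "S = V \<inter> real_points X \<sigma>"
  have "\<exists>l :: complex^'n \<Rightarrow> complex^'n^'i. q \<in> patch X i \<and> coord X i q \<in> N \<and> q \<in> S \<longrightarrow>
    linear l \<and> (\<forall>c w. l (c *s w) = cscale c (l w)) \<and> (\<forall>w. l w $ i = w) \<and>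
    tangent_space X (points X) q = l ` {w. Df (coord X i q) w = 0} \<and>
    tangent_space X V q = l ` {w. Dg (coord X i q) w = 0} \<and>
    tangent_space X (real_points X \<sigma>) q = l ` {w. Df (coord X i q) w = 0 \<and> D\<rho> (coord X i q) w = 0}" for q
  proof (cases "q \<in> patch X i \<and> coord X i q \<in> N \<and> q \<in> S")
    case True
    then have q: "q \<in> patch X i" "coord X i q \<in> N" "q \<in> V" "q \<in> real_points X \<sigma>" by (auto simp: S_def)
    obtain l :: "complex^'n \<Rightarrow> complex^'n^'i" where "linear l" "\<And>c w. l (c *s w) = cscale c (l w)"
      "\<And>w. l w $ i = w"
      "tangent_space X (points X) q = l ` {w. Df (coord X i q) w = 0}"
      "tangent_space X V q = l ` {w. Dg (coord X i q) w = 0}"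
      "tangent_space X (real_points X \<sigma>) q = l ` {w. Df (coord X i q) w = 0 \<and> D\<rho> (coord X i q) w = 0}"
      by (rule tangent_spaces[OF alg q]) (rule that)
    then show ?thesis by (intro exI[of _ l]) simp
  qed blast
  then have "\<exists>L. \<forall>q. q \<in> patch X i \<and> coord X i q \<in> N \<and> q \<in> S \<longrightarrow>
    linear (L q) \<and> (\<forall>c w. L q (c *s w) = cscale c (L q w)) \<and> (\<forall>w. L q w $ i = w) \<and>
    tangent_space X (points X) q = L q ` {w. Df (coord X i q) w = 0} \<and>
    tangent_space X V q = L q ` {w. Dg (coord X i q) w = 0} \<and>
    tangent_space X (real_points X \<sigma>) q = L q ` {w. Df (coord X i q) w = 0 \<and> D\<rho> (coord X i q) w = 0}"
    by (intro choice allI)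
  then obtain L :: "'a \<Rightarrow> complex^'n \<Rightarrow> complex^'n^'i" where L': "\<forall>q. q \<in> patch X i \<and> coord X i q \<in> N \<and> q \<in> S \<longrightarrow>
    linear (L q) \<and> (\<forall>c w. L q (c *s w) = cscale c (L q w)) \<and> (\<forall>w. L q w $ i = w) \<and>
    tangent_space X (points X) q = L q ` {w. Df (coord X i q) w = 0} \<and>
    tangent_space X V q = L q ` {w. Dg (coord X i q) w = 0} \<and>
    tangent_space X (real_points X \<sigma>) q = L q ` {w. Df (coord X i q) w = 0 \<and> D\<rho> (coord X i q) w = 0}" ..
  have L: "linear (L q)" "L q (c *s w) = cscale c (L q w)" "L q w $ i = w"
    "tangent_space X (points X) q = L q ` {w. Df (coord X i q) w = 0}"
    "tangent_space X V q = L q ` {w. Dg (coord X i q) w = 0}"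
    "tangent_space X (real_points X \<sigma>) q = L q ` {w. Df (coord X i q) w = 0 \<and> D\<rho> (coord X i q) w = 0}"
    if "q \<in> patch X i" "coord X i q \<in> N" "q \<in> S" for q c w
    using L' that by simp_all
  have pS: "p \<in> S" using p by (simp add: S_def)
  note Lp = L[OF p(1,2) pS, folded a_def]
  have inj: "L q u = L q w \<longleftrightarrow> u = w" if "q \<in> patch X i" "coord X i q \<in> N" "q \<in> S" for q u w
    using L(3)[OF that] by metis
  obtain es where es: "complex_quotient_basis (tangent_space X (points X) p) (tangent_space X V p) es"
    using complex_quotient_basis_exists[OF tsp(1,2)[OF p(3,4)]] .
  define k where "k = length es"
  define w where "w m = es ! m $ i" for m
  have wm: "Df a (w m) = 0" "L p (w m) = es ! m" if "m < k" for m
  proof -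
    have "es ! m \<in> L p ` {w. Df a w = 0}"
      using complex_quotient_basisD(1)[OF es] nth_mem[of m es] that unfolding Lp(4) k_def by blast
    then obtain u where "es ! m = L p u" "Df a u = 0" by blast
    then show "Df a (w m) = 0" "L p (w m) = es ! m" using Lp(3) by (simp_all add: w_def)
  qed
  have w_ind: "c m = 0" if h: "Dg a (\<Sum>m<k. c m *s w m) = 0" and m: "m < k" for c m
  proof -
    have "L p (\<Sum>m<k. c m *s w m) = (\<Sum>m<length es. cscale (c m) (es ! m))"
      unfolding linear_sum[OF Lp(1)] k_def[symmetric] by (rule sum.cong) (auto simp: Lp(2) wm)
    moreover have "L p (\<Sum>m<k. c m *s w m) \<in> tangent_space X V p" unfolding Lp(5) using h by blast
    ultimately show ?thesis using complex_quotient_basisD(3)[OF es, of c m] m by (simp add: k_def)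
  qed
  define W1 where "W1 = Dg a ` {u. Df a u = 0}"
  have sW1: "subspace W1" unfolding W1_def
    by (rule linear_subspace_image[OF ling[OF a] linear_subspace_kernel[OF linf[OF a]]])
  have "c *s y \<in> W1" if y: "y \<in> W1" for c y
  proof -
    obtain u where "y = Dg a u" "Df a u = 0" using y unfolding W1_def by blast
    then have "c *s y = Dg a (c *s u)" "Df a (c *s u) = 0" by (simp_all add: complex_linear)
    then show ?thesis unfolding W1_def by blast
  qed
  then obtain P :: "complex^'n \<Rightarrow> complex^'n" where P: "linear P" "\<And>c x. P (c *s x) = c *s P x"
    "\<And>y. y \<in> W1 \<Longrightarrow> P y = y" "range P \<subseteq> W1"
    using complex_projection_exists[OF sW1] by metis
  have bP: "bounded_linear P" using P(1) by (simp add: linear_conv_bounded_linear)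
  note PD = C1_on_Pair[OF C1(1) C1_on_linear[OF bP C1(2)]]
  have surj1: "Wf \<times> W1 \<subseteq> range (\<lambda>u. (Df a u, P (Dg a u)))"
  proof
    fix y assume "y \<in> Wf \<times> W1"
    then obtain b y2 where y: "y = (b, y2)" "b \<in> Wf" "y2 \<in> W1" by blast
    obtain u where u: "Df a u = b" using y(2) range_Df[OF a] by (metis imageE)
    have "y2 - P (Dg a u) \<in> W1" by (rule subspace_diff[OF sW1 y(3)]) (use P(4) in blast)
    then obtain v where v: "Dg a v = y2 - P (Dg a u)" "Df a v = 0" unfolding W1_def by force
    have "P (Dg a v) = y2 - P (Dg a u)" using \<open>y2 - P (Dg a u) \<in> W1\<close> P(3) v(1) by simp
    then have "y = (Df a (u + v), P (Dg a (u + v)))"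
      using y(1) u v(2) by (simp add: linear_add[OF linf[OF a]] linear_add[OF ling[OF a]] linear_add[OF P(1)])
    then show "y \<in> range (\<lambda>u. (Df a u, P (Dg a u)))" by (rule range_eqI)
  qed
  have r1: "range (\<lambda>u. (Df x u, P (Dg x u))) \<subseteq> Wf \<times> W1" if "x \<in> N" for x
    using range_Df[OF that] P(4) by blast
  obtain N1 Q1 where Q1: "open N1" "a \<in> N1" "N1 \<subseteq> N"
    "\<And>x y. x \<in> N1 \<Longrightarrow> y \<in> Wf \<times> W1 \<Longrightarrow> (Df x (Q1 x y), P (Dg x (Q1 x y))) = y"
    "\<And>T y. T \<subseteq> N1 \<Longrightarrow> continuous_on T y \<Longrightarrow> continuous_on T (\<lambda>x. Q1 x (y x))"
    by (rule continuous_right_inverse[OF oN C1_onD(4)[OF PD] C1_onD(3)[OF PD] a r1 surj1]) (assumption | rule that)+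
  note PG = C1_on_Pair[OF C1(2,3)]
  have r2: "range (\<lambda>u. (Dg x u, D\<rho> x u)) \<subseteq> Wg \<times> W\<rho>" if "x \<in> N" for x by (simp add: range_g[OF that])
  have surj2: "Wg \<times> W\<rho> \<subseteq> range (\<lambda>u. (Dg a u, D\<rho> a u))" by (simp add: range_g[OF a])
  obtain N2 Q2 where Q2: "open N2" "a \<in> N2" "N2 \<subseteq> N"
    "\<And>x y. x \<in> N2 \<Longrightarrow> y \<in> Wg \<times> W\<rho> \<Longrightarrow> (Dg x (Q2 x y), D\<rho> x (Q2 x y)) = y"
    "\<And>T y. T \<subseteq> N2 \<Longrightarrow> continuous_on T y \<Longrightarrow> continuous_on T (\<lambda>x. Q2 x (y x))"
    by (rule continuous_right_inverse[OF oN C1_onD(4)[OF PG] C1_onD(3)[OF PG] a r2 surj2]) (assumption | rule that)+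
  have r3: "range (Df x) \<subseteq> Wf" "range (Dg x) \<subseteq> Wg" if "x \<in> N" for x
    using range_Df[OF that] range_Dg[OF that] by simp_all
  have surj3: "Wf \<subseteq> range (Df a)" "Wg \<subseteq> range (Dg a)"
    using range_Df[OF a] range_Dg[OF a] by simp_all
  obtain N3 where N3: "open N3" "a \<in> N3" "N3 \<subseteq> N" "\<And>x. x \<in> N3 \<Longrightarrow> dim {u. Df x u = 0} = dim {u. Df a u = 0}"
    by (rule continuous_right_inverse[OF oN linf C1_onD(3)[OF C1(1)] a r3(1) surj3(1)]) (assumption | rule that)+
  obtain N4 where N4: "open N4" "a \<in> N4" "N4 \<subseteq> N" "\<And>x. x \<in> N4 \<Longrightarrow> dim {u. Dg x u = 0} = dim {u. Dg a u = 0}"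
    by (rule continuous_right_inverse[OF oN ling C1_onD(3)[OF C1(2)] a r3(2) surj3(2)]) (assumption | rule that)+
  define N' where "N' = N1 \<inter> N2 \<inter> N3 \<inter> N4"
  have N': "open N'" "a \<in> N'" "N' \<subseteq> N" "N' \<subseteq> N1" "N' \<subseteq> N2" "N' \<subseteq> N3" "N' \<subseteq> N4"
    using Q1(1-3) Q2(1-3) N3(1-3) N4(1-3) by (auto simp: N'_def)
  define e where "e m x = Q1 x (0, Dg a (w m))" for m x
  define E where "E j x = (if even j then 1 else \<i>) *s e (j div 2) x" for j x
  define h where "h j x = Q2 x (0, - D\<rho> x (E j x))" for j x
  define u where "u j x = E j x + h j x" for j x
  have e: "Df x (e m x) = 0" "P (Dg x (e m x)) = Dg a (w m)" if "x \<in> N'" "m < k" for x m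
  proof -
    have "Dg a (w m) \<in> W1" unfolding W1_def using wm(1)[OF that(2)] by blast
    then have "(0, Dg a (w m)) \<in> Wf \<times> W1" using subspace_0[OF subspaces(1)] by blast
    from Q1(4)[OF _ this, of x] show "Df x (e m x) = 0" "P (Dg x (e m x)) = Dg a (w m)"
      using that N'(4) by (auto simp: e_def)
  qed
  have E: "Df x (E j x) = 0" if "x \<in> N'" "j < 2*k" for x j
    using e(1)[OF that(1), of "j div 2"] that by (simp add: E_def complex_linear)
  have h: "Dg x (h j x) = 0" "D\<rho> x (h j x) = - D\<rho> x (E j x)" if x: "x \<in> N'" for x j
  proof -
    have xN: "x \<in> N" using x N'(3) by blast
    have "(\<lambda>u. (Df x u, D\<rho> x u)) (- E j x) \<in> Wf \<times> W\<rho>" unfolding range_f[OF xN, symmetric] by (rule rangeI)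
    then have "- D\<rho> x (E j x) \<in> W\<rho>" by (simp add: linear_neg[OF linr[OF xN]])
    then have "(0, - D\<rho> x (E j x)) \<in> Wg \<times> W\<rho>" using subspace_0[OF subspaces(2)] by blast
    from Q2(4)[OF _ this, of x] show "Dg x (h j x) = 0" "D\<rho> x (h j x) = - D\<rho> x (E j x)"
      using x N'(5) by (auto simp: h_def)
  qed
  have conte: "continuous_on N' (e m)" for m
    unfolding e_def by (rule Q1(5)[OF N'(4)]) (rule continuous_on_const)
  have contE: "continuous_on N' (E j)" for j
    unfolding E_def by (rule bounded_linear.continuous_on[OF bounded_linear_cvec_scale_right conte])
  have contu: "continuous_on N' (u j)" for j
    unfolding u_def h_def
    by (intro continuous_intros contE Q2(5)[OF N'(5)] C1_continuous_apply[OF C1(3) N'(3)])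
  define W where "W = {q \<in> patch X i. coord X i q \<in> N'}"
  define ss where "ss = map (\<lambda>j q. L q (u j (coord X i q))) [0..<2*k]"
  have main: "quotient_basis (tangent_space X (points X) q) (tangent_space X V q) (map (\<lambda>s. s q) ss) \<and>
      set (map (\<lambda>s. s q) ss) \<subseteq> tangent_space X (real_points X \<sigma>) q \<and>
      map (\<lambda>s. s q) ss \<in> complex_orientation (tangent_space X (points X) q) (tangent_space X V q)"
    if q: "q \<in> W \<inter> S" for q
  proof -
    define x where "x = coord X i q"
    have qi: "q \<in> patch X i" "coord X i q \<in> N" "q \<in> S" and xN': "x \<in> N'" and qVR: "q \<in> V" "q \<in> real_points X \<sigma>"
      using q N'(3) by (auto simp: W_def S_def x_def)
    have xN: "x \<in> N" using xN' N'(3) by blast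
    note Lq = L[OF qi, folded x_def]
    note injq = inj[OF qi]
    note tq = tsp[OF qVR]
    note sC = complex_subspaceD(1)[OF tq(1)] and sD = complex_subspaceD(1)[OF tq(2)]
    define fs where "fs = map (\<lambda>m. L q (e m x)) [0..<k]"
    have len_fs: "length fs = k" by (simp add: fs_def)
    have fs_nth: "fs ! m = L q (e m x)" if "m < k" for m using that by (simp add: fs_def)
    have set_fs: "set fs \<subseteq> tangent_space X (points X) q"
      unfolding Lq(4) fs_def using e(1)[OF xN'] by auto
    have ind: "c m = 0" if hc: "(\<Sum>m<length fs. cscale (c m) (fs ! m)) \<in> tangent_space X V q" and m: "m < length fs" for c m
    proof -
      have "(\<Sum>m<length fs. cscale (c m) (fs ! m)) = L q (\<Sum>m<k. c m *s e m x)"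
        unfolding linear_sum[OF Lq(1)] len_fs by (rule sum.cong) (auto simp: Lq(2) fs_nth)
      then have "Dg x (\<Sum>m<k. c m *s e m x) = 0"
        using hc unfolding Lq(5) by (auto simp: injq)
      then have "P (\<Sum>m<k. c m *s Dg x (e m x)) = 0"
        using linear_0[OF P(1)] by (simp add: linear_sum[OF ling[OF xN]] complex_linear)
      then have "(\<Sum>m<k. c m *s P (Dg x (e m x))) = 0" by (simp add: linear_sum[OF P(1)] P(2))
      moreover have "(\<Sum>m<k. c m *s P (Dg x (e m x))) = (\<Sum>m<k. c m *s Dg a (w m))"
        by (rule sum.cong) (use e(2)[OF xN'] in auto)
      ultimately have "(\<Sum>m<k. c m *s Dg a (w m)) = 0" by simp
      then have "Dg a (\<Sum>m<k. c m *s w m) = 0"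
        by (simp add: linear_sum[OF ling[OF a]] complex_linear)
      then show ?thesis using w_ind m len_fs by blast
    qed
    have dims: "dim (tangent_space X (points X) q) = dim (tangent_space X V q) + length (doubled fs)"
    proof -
      have dimL: "dim (L r ` {v. D v = 0}) = dim {v. D v = 0}" if "r \<in> patch X i" "coord X i r \<in> N" "r \<in> S"
        for r and D :: "complex^'n \<Rightarrow> complex^'n"
        by (rule dim_image_eq[OF L(1)[OF that]]) (auto simp: inj_on_def inj[OF that])
      note tp = tsp[OF p(3,4)]
      have "dim (tangent_space X (points X) p) = dim (tangent_space X V p) + length (doubled es)"
        using es[unfolded complex_quotient_basis_iff_doubled[OF tp(1)]]
        unfolding quotient_basis_iff_dim[OF complex_subspaceD(1)[OF tp(1)] complex_subspaceD(1)[OF tp(2)] tp(4)]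
        by blast
      then show ?thesis
        unfolding Lp(4,5) Lq(4,5) dimL[OF p(1,2) pS] dimL[OF qi]
        using N3(4)[of x] N4(4)[of x] xN' N'(6,7) len_fs k_def by (simp add: subset_iff)
    qed
    have "indep_mod (tangent_space X V q) (doubled fs)" by (rule indep_mod_doubled) (rule ind)
    then have qb_fs: "quotient_basis (tangent_space X (points X) q) (tangent_space X V q) (doubled fs)"
      unfolding quotient_basis_iff_dim[OF sC sD tq(4)]
      using set_fs set_doubled[OF tq(1)] dims by blast
    have len: "length (map (\<lambda>s. s q) ss) = length (doubled fs)" by (simp add: ss_def len_fs)
    have nth: "map (\<lambda>s. s q) ss ! j = L q (u j x)" if "j < 2*k" for j using that by (simp add: ss_def x_def)
    have diff: "map (\<lambda>s. s q) ss ! j - doubled fs ! j \<in> tangent_space X V q" if j: "j < length (doubled fs)" for j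
    proof -
      have j': "j < 2*k" using j len_fs by simp
      have "doubled fs ! j = L q (E j x)"
        using nth_doubled'[of j fs] j' fs_nth[of "j div 2"] by (simp add: len_fs E_def Lq(2))
      then have "map (\<lambda>s. s q) ss ! j - doubled fs ! j = L q (h j x)"
        by (simp add: nth[OF j'] u_def linear_add[OF Lq(1)])
      then show ?thesis unfolding Lq(5) using h(1)[OF xN'] by blast
    qed
    have qb: "quotient_basis (tangent_space X (points X) q) (tangent_space X V q) (map (\<lambda>s. s q) ss)"
      by (rule quotient_basis_cong[OF sC sD tq(4) qb_fs len diff])
    have "L q (u j x) \<in> tangent_space X (real_points X \<sigma>) q" if j: "j < 2*k" for j
    proof -
      have "Df x (h j x) = 0"
        using kernel_inclusion[OF alg VX qi(1,2) qVR, folded x_def] h(1)[OF xN'] by blast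
      then have "Df x (u j x) = 0" using E[OF xN' j] by (simp add: u_def linear_add[OF linf[OF xN]])
      moreover have "D\<rho> x (u j x) = 0" using h(2)[OF xN'] by (simp add: u_def linear_add[OF linr[OF xN]])
      ultimately show ?thesis unfolding Lq(6) by blast
    qed
    then have "set (map (\<lambda>s. s q) ss) \<subseteq> tangent_space X (real_points X \<sigma>) q"
      by (auto simp: ss_def x_def)
    moreover have "map (\<lambda>s. s q) ss \<in> complex_orientation (tangent_space X (points X) q) (tangent_space X V q)"
    proof -
      have "transition_matrix (tangent_space X V q) (map (\<lambda>s. s q) ss) (doubled fs) (1\<^sub>m (length (doubled fs)))"
        by (rule transition_one[OF len]) (rule diff, simp only: len)
      from complex_orientation_iff[OF tq(1,2,4) qb_fs[folded complex_quotient_basis_iff_doubled[OF tq(1)]] qb this]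
      show ?thesis by simp
    qed
    ultimately show ?thesis using qb by blast
  qed
  show ?thesis
  proof (rule that[of W ss])
    show "openin (classical_topology X) W" unfolding W_def by (rule openin_chart[OF N'(1)])
    show "p \<in> W" using p(1) N'(2) by (simp add: W_def a_def)
    show "continuous_field_on X (W \<inter> (V \<inter> real_points X \<sigma>)) s" if s: "s \<in> set ss" for s
    proof -
      obtain j where j: "j < 2*k" "s = (\<lambda>q. L q (u j (coord X i q)))" using s by (auto simp: ss_def)
      show ?thesis
      proof (rule continuous_field_from_chart[OF alg _ contu[of j]])
        show "q \<in> patch X i \<and> coord X i q \<in> N'" if "q \<in> W \<inter> (V \<inter> real_points X \<sigma>)" for q
          using that by (simp add: W_def)
        show "s q \<in> tangent_space X (points X) q \<and> s q $ i = u j (coord X i q)"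
          if q: "q \<in> W \<inter> (V \<inter> real_points X \<sigma>)" for q
        proof -
          have qi: "q \<in> patch X i" "coord X i q \<in> N" "q \<in> S" using q N'(3) by (auto simp: W_def S_def)
          have "s q \<in> set (map (\<lambda>s. s q) ss)" using s by simp
          then have "s q \<in> tangent_space X (real_points X \<sigma>) q" using main[of q] q by (auto simp: S_def)
          then have "s q \<in> tangent_space X (points X) q" using tsp(5)[of q] q by blast
          then show ?thesis using L(3)[OF qi] j(2) by simp
        qed
      qed
    qed
    show "quotient_basis (tangent_space X (real_points X \<sigma>) q) (tangent_space X (V \<inter> real_points X \<sigma>) q) (map (\<lambda>s. s q) ss) \<and>
       map (\<lambda>s. s q) ss \<in> complex_orientation (tangent_space X (points X) q) (tangent_space X V q)"
      if q: "q \<in> W \<inter> (V \<inter> real_points X \<sigma>)" for q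
    proof -
      have qVR: "q \<in> V" "q \<in> real_points X \<sigma>" using q by blast+
      note tq = tsp[OF qVR]
      show ?thesis
        using quotient_basis_slice_iff[OF complex_subspaceD(1)[OF tq(1)] tq(3,5,6,4) complex_subspaceD(1)[OF tq(2)] tq(7)]
          main[of q] q unfolding S_def by blast
    qed
  qed
qed

end

section \<open>The coorientation\<close>

lemma determined_coorientation_is_coorientation:
  fixes X :: "('a, 'n::finite, 'i::finite) variety"
  assumes X: "real_variety X \<sigma>" "nonsingular X" and Y: "carves_out X \<sigma> V Y"
  shows "coorientation X (real_points X \<sigma>) (Y \<inter> real_points X \<sigma>) (determined_coorientation X \<sigma> V Y)"
proof -
  have V: "subvariety X V" "transverse_to_real X \<sigma> V" and S: "Y \<inter> real_points X \<sigma> = V \<inter> real_points X \<sigma>"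
    using Y unfolding carves_out_def by blast+
  note tsp = transverse_tangent_spaces[OF X V]
  show ?thesis
    unfolding coorientation_def S determined_coorientation_def
  proof (intro conjI ballI)
    fix p assume "p \<in> V \<inter> real_points X \<sigma>"
    then have p: "p \<in> V" "p \<in> real_points X \<sigma>" by blast+
    note tp = tsp[OF p]
    show "orientation_of_quotient (tangent_space X (real_points X \<sigma>) p) (tangent_space X (V \<inter> real_points X \<sigma>) p)
      {vs. quotient_basis (tangent_space X (real_points X \<sigma>) p) (tangent_space X (V \<inter> real_points X \<sigma>) p) vs \<and>
           vs \<in> complex_orientation (tangent_space X (points X) p) (tangent_space X V p)}"
      by (rule orientation_of_transverse_slice[OF tp(1,2,4,3,5,6,7)])
    obtain i where i: "p \<in> patch X i" using p(2) unfolding real_points_def points_def by blast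
    obtain N f g \<rho> Df Dg D\<rho> Wf Wg W\<rho> where
      sc: "slice_chart X \<sigma> V i N f g \<rho> Df Dg D\<rho> Wf Wg W\<rho>" and aN: "coord X i p \<in> N"
      by (rule local_equations[OF X V p i]) (rule that)
    obtain W ss where W: "openin (classical_topology X) W" "p \<in> W"
      "\<And>s. s \<in> set ss \<Longrightarrow> continuous_field_on X (W \<inter> (V \<inter> real_points X \<sigma>)) s"
      "\<And>q. q \<in> W \<inter> (V \<inter> real_points X \<sigma>) \<Longrightarrow>
       quotient_basis (tangent_space X (real_points X \<sigma>) q) (tangent_space X (V \<inter> real_points X \<sigma>) q) (map (\<lambda>s. s q) ss) \<and>
       map (\<lambda>s. s q) ss \<in> complex_orientation (tangent_space X (points X) q) (tangent_space X V q)"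
      by (rule slice_chart.positive_frame[OF sc X V i aN p]) (rule that)
    have pW: "p \<in> W \<inter> (V \<inter> real_points X \<sigma>)" using W(2) p by blast
    show "\<exists>W ss. openin (classical_topology X) W \<and> p \<in> W \<and>
        (\<forall>s\<in>set ss. continuous_field_on X (W \<inter> (V \<inter> real_points X \<sigma>)) s) \<and>
        (\<forall>q\<in>W \<inter> (V \<inter> real_points X \<sigma>).
           quotient_basis (tangent_space X (real_points X \<sigma>) q) (tangent_space X (V \<inter> real_points X \<sigma>) q) (map (\<lambda>s. s q) ss) \<and>
           (map (\<lambda>s. s q) ss \<in> {vs. quotient_basis (tangent_space X (real_points X \<sigma>) q)
                 (tangent_space X (V \<inter> real_points X \<sigma>) q) vs \<and>
               vs \<in> complex_orientation (tangent_space X (points X) q) (tangent_space X V q)} \<longleftrightarrow>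
            map (\<lambda>s. s p) ss \<in> {vs. quotient_basis (tangent_space X (real_points X \<sigma>) p)
                 (tangent_space X (V \<inter> real_points X \<sigma>) p) vs \<and>
               vs \<in> complex_orientation (tangent_space X (points X) p) (tangent_space X V p)}))"
      using W(1-3) W(4) W(4)[OF pW] by (intro exI[of _ W] exI[of _ ss] conjI ballI) simp_all
  qed
qed

theorem mainTheorem7:
  fixes X :: "('a, 'n::finite, 'i::finite) variety" and \<sigma> :: "'a \<Rightarrow> 'a"
  assumes "real_variety X \<sigma>" and "nonsingular X"
  shows "(\<forall>Y. slice X \<sigma> Y \<longrightarrow>
            coorientable X (real_points X \<sigma>) (Y \<inter> real_points X \<sigma>)) \<and>
         (\<forall>Y V. real_subvariety X \<sigma> Y \<and> carves_out X \<sigma> V Y \<longrightarrow>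
            coorientation X (real_points X \<sigma>) (Y \<inter> real_points X \<sigma>)
              (determined_coorientation X \<sigma> V Y))"
  using determined_coorientation_is_coorientation[OF assms]
  unfolding slice_def coorientable_def by blast

end
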